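(* Let $N$ be a paraquaternionic CR-submanifold of a paraquaternionic K\"ahler manifold $(M,\sigma,g)$, with paraquaternionic distribution $\mathcal{D}$. Then $\mathcal{D}$ is integrable if and only if $N$ is $\mathcal{D}$-geodesic, i.e. $B(X,Y)=0$ for all $X,Y\in\Gamma(\mathcal{D})$, where $B$ is the second fundamental form of $N$ in $M$.
   Context: Everything is smooth; $\Gamma(E)$ denotes the sections of a bundle $E$. Put $\epsilon_1=1$, $\epsilon_2=\epsilon_3=-1$; indices $\alpha\in\{1,2,3\}$ are taken modulo 3. An almost paraquaternionic structure on $M$ is a rank-3 subbundle $\sigma\subset \mathrm{End}(TM)$ admitting on coordinate neighborhoods $U$ a canonical local basis $\{J_1,J_2,J_3\}$ with $J_\alpha^2=-\epsilon_\alpha \mathrm{Id}$ and $J_\alpha J_{\alpha+1}=-J_{\alpha+1}J_\alpha=\epsilon_{\alpha+2}J_{\alpha+2}$; on overlaps two canonical local bases are related by an $SO(2,1)$-valued matrix of functions. $(M,\sigma,g)$ is almost paraquaternionic hermitian if $g$ is a semi-Riemannian metric with $g(J_\alpha X,J_\alpha Y)=\epsilon_\alpha g(X,Y)$ for all $\alpha$ and all canonical local bases. It is paraquaternionic K\"ahler if moreover $\sigma$ is parallel with respect to the Levi-Civita connection $\overline\nabla$ of $g$; equivalently there are local 1-forms $\omega_1,\omega_2,\omega_3$ with $\overline\nabla_XJ_\alpha=-\epsilon_\alpha[\omega_{\alpha+2}(X)J_{\alpha+1}-\omega_{\alpha+1}(X)J_{\alpha+2}]$. A non-degenerate (immersed)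 submanifold $N$ of $M$ is one on which the induced metric, again denoted $g$, is non-degenerate. It is a paraquaternionic CR-submanifold if there is a non-degenerate distribution $\mathcal{D}\subset TN$ (the paraquaternionic distribution) such that, for every canonical local basis on $U$ and $x\in U\cap N$, $J_\alpha\mathcal{D}_x=\mathcal{D}_x$ and $J_\alpha\mathcal{D}^\perp_x\subset T_x^\perp N$ for $\alpha\in\{1,2,3\}$, where $\mathcal{D}^\perp$ is the orthogonal complement of $\mathcal{D}$ in $TN$. The second fundamental form $B$ is defined by the Gauss formula $\overline\nabla_XY=\nabla_XY+B(X,Y)$ for $X,Y\in\Gamma(TN)$, with $\nabla$ the Levi-Civita connection of $N$ and $B(X,Y)\in\Gamma(TN^\perp)$. *)

theory Defs
  imports "HOL-Analysis.Analysis"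
begin

section \<open>Smooth manifolds\<close>

primrec Ck_on :: "nat \<Rightarrow> 'a::real_normed_vector set \<Rightarrow> ('a \<Rightarrow> 'b::real_normed_vector) \<Rightarrow> bool"
  where
    "Ck_on 0 S f \<longleftrightarrow> continuous_on S f"
  | "Ck_on (Suc k) S f \<longleftrightarrow>
       (\<forall>x\<in>S. f differentiable (at x)) \<and> (\<forall>v. Ck_on k S (\<lambda>x. frechet_derivative f (at x) v))"

text \<open>The derivatives are two-sided (\<open>at x\<close>, not \<open>at x within S\<close>), so these notions are meaningful for
  open \<open>S\<close> only.\<close>

definition smooth_on :: "'a::real_normed_vector set \<Rightarrow> ('a \<Rightarrow> 'b::real_normed_vector) \<Rightarrow> bool"
  where "smooth_on S f \<longleftrightarrow> (\<forall>k. Ck_on k S f)"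

text \<open>A chart is a pair of a domain and a coordinate map; the values of the map off the domain are
  irrelevant.\<close>

type_synonym ('m, 'e) chart = "'m set \<times> ('m \<Rightarrow> 'e)"

definition chart_inv :: "('m, 'e) chart \<Rightarrow> 'e \<Rightarrow> 'm"
  where "chart_inv c = inv_into (fst c) (snd c)"

definition is_chart :: "('m::topological_space, 'e::euclidean_space) chart \<Rightarrow> bool"
  where "is_chart c \<longleftrightarrow> open (fst c) \<and> open (snd c ` fst c) \<and>
           homeomorphism (fst c) (snd c ` fst c) (snd c) (chart_inv c)"

definition compatible ::
    "('m, 'e::euclidean_space) chart \<Rightarrow> ('m, 'e) chart \<Rightarrow> bool"
  where "compatible c d \<longleftrightarrow>
           smooth_on (snd c ` (fst c \<inter> fst d)) (snd d \<circ> chart_inv c) \<and>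
           smooth_on (snd d ` (fst c \<inter> fst d)) (snd c \<circ> chart_inv d)"

text \<open>A smooth structure is a maximal smooth atlas on the whole type \<open>'m\<close>, which is thereby a smooth
  Hausdorff second countable manifold of dimension \<open>DIM('e)\<close>.\<close>

definition smooth_structure ::
    "('m::{t2_space, second_countable_topology}, 'e::euclidean_space) chart set \<Rightarrow> bool"
  where "smooth_structure A \<longleftrightarrow>
           (\<forall>c\<in>A. is_chart c) \<and> (\<Union>c\<in>A. fst c) = UNIV \<and>
           (\<forall>c\<in>A. \<forall>d\<in>A. compatible c d) \<and>
           (\<forall>c. is_chart c \<and> (\<forall>d\<in>A. compatible c d) \<longrightarrow> c \<in> A)"

definition smooth_function ::
    "('m, 'e::euclidean_space) chart set \<Rightarrow> 'm set \<Rightarrow> ('m \<Rightarrow> real) \<Rightarrow> bool"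
  where "smooth_function A W h \<longleftrightarrow>
           (\<forall>c\<in>A. smooth_on (snd c ` (fst c \<inter> W)) (h \<circ> chart_inv c))"

definition smooth_map ::
    "('n::topological_space, 'f::euclidean_space) chart set \<Rightarrow>
     ('m::topological_space, 'e::euclidean_space) chart set \<Rightarrow> ('n \<Rightarrow> 'm) \<Rightarrow> bool"
  where "smooth_map B A f \<longleftrightarrow> continuous_on UNIV f \<and>
           (\<forall>b\<in>B. \<forall>c\<in>A. smooth_on (snd b ` (fst b \<inter> f -` fst c)) (snd c \<circ> f \<circ> chart_inv b))"


section \<open>Tangent vectors and tensor fields\<close>

text \<open>The tangent space at \<open>p\<close> is modelled as the vector space \<open>'e\<close>, an element of \<open>'e\<close> being read as
  the tangent vector which has these components in a preferred chart \<open>chart_at A p\<close> around \<open>p\<close>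
  (chosen once and for all for each \<open>p\<close>). Thus a vector field is a function \<open>'m \<Rightarrow> 'e\<close>, and
  \<open>to_coords A c p\<close> is the differential at \<open>p\<close> of the chart \<open>c\<close>, a linear isomorphism giving the
  components in an arbitrary chart \<open>c\<close> around \<open>p\<close>. Nothing is assumed about how \<open>chart_at A p\<close>
  varies with \<open>p\<close>.\<close>

definition chart_at :: "('m, 'e) chart set \<Rightarrow> 'm \<Rightarrow> ('m, 'e) chart"
  where "chart_at A p = (SOME c. c \<in> A \<and> p \<in> fst c)"

definition to_coords ::
    "('m, 'e::euclidean_space) chart set \<Rightarrow> ('m, 'e) chart \<Rightarrow> 'm \<Rightarrow> 'e \<Rightarrow> 'e"
  where "to_coords A c p =
           frechet_derivative (snd c \<circ> chart_inv (chart_at A p)) (at (snd (chart_at A p) p))"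

text \<open>The vector field on \<open>fst c\<close> with constant components \<open>w\<close> in the chart \<open>c\<close>.\<close>

definition coord_field ::
    "('m, 'e::euclidean_space) chart set \<Rightarrow> ('m, 'e) chart \<Rightarrow> 'e \<Rightarrow> 'm \<Rightarrow> 'e"
  where "coord_field A c w p =
           frechet_derivative (snd (chart_at A p) \<circ> chart_inv c) (at (snd c p)) w"

definition differential ::
    "('n, 'f::euclidean_space) chart set \<Rightarrow> ('m, 'e::euclidean_space) chart set \<Rightarrow>
     ('n \<Rightarrow> 'm) \<Rightarrow> 'n \<Rightarrow> 'f \<Rightarrow> 'e"
  where "differential B A f p =
           frechet_derivative (snd (chart_at A (f p)) \<circ> f \<circ> chart_inv (chart_at B p))
             (at (snd (chart_at B p) p))"

definition smooth_vector_field ::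
    "('m, 'e::euclidean_space) chart set \<Rightarrow> 'm set \<Rightarrow> ('m \<Rightarrow> 'e) \<Rightarrow> bool"
  where "smooth_vector_field A W X \<longleftrightarrow>
           (\<forall>c\<in>A. smooth_on (snd c ` (fst c \<inter> W))
              (\<lambda>y. to_coords A c (chart_inv c y) (X (chart_inv c y))))"

definition smooth_endomorphism_field ::
    "('m, 'e::euclidean_space) chart set \<Rightarrow> 'm set \<Rightarrow> ('m \<Rightarrow> 'e \<Rightarrow>\<^sub>L 'e) \<Rightarrow> bool"
  where "smooth_endomorphism_field A W S \<longleftrightarrow>
           (\<forall>c\<in>A. \<forall>w. smooth_vector_field A (fst c \<inter> W)
              (\<lambda>x. blinfun_apply (S x) (coord_field A c w x)))"

definition nondegenerate_on :: "'e::real_vector set \<Rightarrow> ('e \<Rightarrow> 'e \<Rightarrow> real) \<Rightarrow> bool"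
  where "nondegenerate_on V b \<longleftrightarrow> (\<forall>u\<in>V. (\<forall>v\<in>V. b u v = 0) \<longrightarrow> u = 0)"

text \<open>The index of the metric is locally constant by continuity; it is not required to agree on
  different connected components.\<close>

definition semi_riemannian_metric ::
    "('m, 'e::euclidean_space) chart set \<Rightarrow> ('m \<Rightarrow> 'e \<Rightarrow> 'e \<Rightarrow> real) \<Rightarrow> bool"
  where "semi_riemannian_metric A g \<longleftrightarrow>
           (\<forall>p. bilinear (g p) \<and> (\<forall>u v. g p u v = g p v u) \<and> nondegenerate_on UNIV (g p)) \<and>
           (\<forall>c\<in>A. \<forall>u v. smooth_function A (fst c)
              (\<lambda>x. g x (coord_field A c u x) (coord_field A c v x)))"


section \<open>The Levi-Civita connection\<close>

text \<open>Christoffel symbols at \<open>p\<close> in the chart \<open>chart_at A p\<close>: \<open>christoffel A g p u w\<close> is the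
  covariant derivative at \<open>p\<close>, in direction \<open>u\<close>, of the coordinate field with components \<open>w\<close>.
  They are determined by the connection being torsion-free and metric.\<close>

definition christoffel ::
    "('m, 'e::euclidean_space) chart set \<Rightarrow> ('m \<Rightarrow> 'e \<Rightarrow> 'e \<Rightarrow> real) \<Rightarrow> 'm \<Rightarrow> 'e \<Rightarrow> 'e \<Rightarrow> 'e"
  where "christoffel A g p = (let c = chart_at A p in
           THE \<Gamma>. bilinear \<Gamma> \<and> (\<forall>u w. \<Gamma> u w = \<Gamma> w u) \<and>
             (\<forall>u w z. frechet_derivative
                 (\<lambda>y. g (chart_inv c y) (coord_field A c w (chart_inv c y))
                                         (coord_field A c z (chart_inv c y)))
                 (at (snd c p)) u
               = g p (\<Gamma> u w) z + g p w (\<Gamma> u z)))"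

text \<open>For \<open>f : N \<rightarrow> M\<close> and a vector field \<open>Z\<close> along \<open>f\<close> (\<open>Z p\<close> is tangent to \<open>M\<close> at \<open>f p\<close>),
  \<open>nabla_along B A g f Z p v\<close> is the derivative of \<open>Z\<close> in the direction \<open>v\<close> tangent to \<open>N\<close> at \<open>p\<close>,
  for the Levi-Civita connection of \<open>(M, g)\<close>; if \<open>Z\<close> is the restriction of a vector field \<open>Y\<close> of
  \<open>M\<close>, that is \<open>Z = Y \<circ> f\<close>, it is the covariant derivative of \<open>Y\<close> in the direction
  \<open>differential B A f p v\<close>.\<close>

definition nabla_along ::
    "('n, 'f::euclidean_space) chart set \<Rightarrow> ('m, 'e::euclidean_space) chart set \<Rightarrow>
     ('m \<Rightarrow> 'e \<Rightarrow> 'e \<Rightarrow> real) \<Rightarrow> ('n \<Rightarrow> 'm) \<Rightarrow> ('n \<Rightarrow> 'e) \<Rightarrow> 'n \<Rightarrow> 'f \<Rightarrow> 'e"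
  where "nabla_along B A g f Z p v = (let b = chart_at B p; c = chart_at A (f p) in
           frechet_derivative
             (\<lambda>y. to_coords A c (f (chart_inv b y)) (Z (chart_inv b y))) (at (snd b p)) v
           + christoffel A g (f p) (differential B A f p v) (Z p))"

definition nabla ::
    "('m, 'e::euclidean_space) chart set \<Rightarrow> ('m \<Rightarrow> 'e \<Rightarrow> 'e \<Rightarrow> real) \<Rightarrow>
     ('m \<Rightarrow> 'e) \<Rightarrow> 'm \<Rightarrow> 'e \<Rightarrow> 'e"
  where "nabla A g Y p v = nabla_along A A g (\<lambda>x. x) Y p v"

text \<open>A bundle \<open>\<sigma>\<close> of endomorphisms is parallel if the derivatives
  \<open>(\<nabla>\<^sub>v S) Y = \<nabla>\<^sub>v (S Y) - S (\<nabla>\<^sub>v Y)\<close> of its local sections \<open>S\<close> lie in \<open>\<sigma>\<close>.\<close>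

definition parallel_subbundle ::
    "('m::topological_space, 'e::euclidean_space) chart set \<Rightarrow> ('m \<Rightarrow> 'e \<Rightarrow> 'e \<Rightarrow> real) \<Rightarrow>
     ('m \<Rightarrow> ('e \<Rightarrow>\<^sub>L 'e) set) \<Rightarrow> bool"
  where "parallel_subbundle A g \<sigma> \<longleftrightarrow>
           (\<forall>W S. open W \<and> smooth_endomorphism_field A W S \<and> (\<forall>x\<in>W. S x \<in> \<sigma> x) \<longrightarrow>
              (\<forall>p\<in>W. \<forall>v. \<exists>T\<in>\<sigma> p. \<forall>Y. smooth_vector_field A W Y \<longrightarrow>
                 blinfun_apply T (Y p) =
                   nabla A g (\<lambda>x. blinfun_apply (S x) (Y x)) p v
                   - blinfun_apply (S p) (nabla A g Y p v)))"


section \<open>Paraquaternionic Kaehler manifolds\<close>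

text \<open>Indices live in the type \<open>3\<close> of integers modulo 3, so that \<open>3 = 0\<close>.\<close>

definition eps :: "3 \<Rightarrow> real"
  where "eps \<alpha> = (if \<alpha> = 1 then 1 else -1)"

definition SO21 :: "(real^3^3) set"
  where "SO21 = (let G = (\<chi> \<alpha> \<beta>. if \<alpha> = \<beta> then eps \<alpha> else 0) in
           {S. S ** G ** transpose S = G \<and> det S = 1})"

definition canonical_local_basis ::
    "('m, 'e::euclidean_space) chart set \<Rightarrow> ('m \<Rightarrow> ('e \<Rightarrow>\<^sub>L 'e) set) \<Rightarrow> 'm set \<Rightarrow>
     (3 \<Rightarrow> 'm \<Rightarrow> 'e \<Rightarrow>\<^sub>L 'e) \<Rightarrow> bool"
  where "canonical_local_basis A \<sigma> U J \<longleftrightarrow>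
           U \<in> fst ` A \<and> (\<forall>\<alpha>. smooth_endomorphism_field A U (J \<alpha>)) \<and>
           (\<forall>x\<in>U. \<sigma> x = span (range (\<lambda>\<alpha>. J \<alpha> x)) \<and>
              (\<forall>\<alpha>. J \<alpha> x o\<^sub>L J \<alpha> x = - eps \<alpha> *\<^sub>R id_blinfun \<and>
                   J \<alpha> x o\<^sub>L J (\<alpha> + 1) x = eps (\<alpha> + 2) *\<^sub>R J (\<alpha> + 2) x \<and>
                   - (J (\<alpha> + 1) x o\<^sub>L J \<alpha> x) = eps (\<alpha> + 2) *\<^sub>R J (\<alpha> + 2) x))"

definition almost_paraquaternionic ::
    "('m, 'e::euclidean_space) chart set \<Rightarrow> ('m \<Rightarrow> ('e \<Rightarrow>\<^sub>L 'e) set) \<Rightarrow> bool"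
  where "almost_paraquaternionic A \<sigma> \<longleftrightarrow>
           (\<forall>p. subspace (\<sigma> p) \<and> dim (\<sigma> p) = 3) \<and>
           (\<forall>p. \<exists>U J. p \<in> U \<and> canonical_local_basis A \<sigma> U J) \<and>
           (\<forall>U J U' J'. canonical_local_basis A \<sigma> U J \<and> canonical_local_basis A \<sigma> U' J' \<longrightarrow>
              (\<exists>S. (\<forall>\<alpha> \<beta>. smooth_function A (U \<inter> U') (\<lambda>x. S x $ \<alpha> $ \<beta>)) \<and>
                   (\<forall>x\<in>U \<inter> U'. S x \<in> SO21 \<and> (\<forall>\<alpha>. J' \<alpha> x = (\<Sum>\<beta>\<in>UNIV. S x $ \<alpha> $ \<beta> *\<^sub>R J \<beta> x)))))"

definition almost_paraquaternionic_hermitian ::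
    "('m, 'e::euclidean_space) chart set \<Rightarrow> ('m \<Rightarrow> ('e \<Rightarrow>\<^sub>L 'e) set) \<Rightarrow>
     ('m \<Rightarrow> 'e \<Rightarrow> 'e \<Rightarrow> real) \<Rightarrow> bool"
  where "almost_paraquaternionic_hermitian A \<sigma> g \<longleftrightarrow>
           almost_paraquaternionic A \<sigma> \<and> semi_riemannian_metric A g \<and>
           (\<forall>U J. canonical_local_basis A \<sigma> U J \<longrightarrow>
              (\<forall>x\<in>U. \<forall>\<alpha> u v. g x (blinfun_apply (J \<alpha> x) u) (blinfun_apply (J \<alpha> x) v)
                                 = eps \<alpha> * g x u v))"

definition paraquaternionic_kaehler ::
    "('m::topological_space, 'e::euclidean_space) chart set \<Rightarrow> ('m \<Rightarrow> ('e \<Rightarrow>\<^sub>L 'e) set) \<Rightarrow>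
     ('m \<Rightarrow> 'e \<Rightarrow> 'e \<Rightarrow> real) \<Rightarrow> bool"
  where "paraquaternionic_kaehler A \<sigma> g \<longleftrightarrow>
           almost_paraquaternionic_hermitian A \<sigma> g \<and> parallel_subbundle A g \<sigma>"


section \<open>Distributions\<close>

definition distribution ::
    "('m::topological_space, 'e::euclidean_space) chart set \<Rightarrow> ('m \<Rightarrow> 'e set) \<Rightarrow> bool"
  where "distribution A D \<longleftrightarrow>
           (\<exists>k. \<forall>p. \<exists>W X. open W \<and> p \<in> W \<and> (\<forall>i<k. smooth_vector_field A W (X i)) \<and>
              (\<forall>x\<in>W. D x = span ((\<lambda>i. X i x) ` {..<k}) \<and> dim (D x) = k))"

definition sections ::
    "('m, 'e::euclidean_space) chart set \<Rightarrow> ('m \<Rightarrow> 'e set) \<Rightarrow> ('m \<Rightarrow> 'e) set"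
  where "sections A D = {X. smooth_vector_field A UNIV X \<and> (\<forall>p. X p \<in> D p)}"

text \<open>An embedded submanifold \<open>L\<close>, described by slice charts \<open>c\<close> in which it is the affine subspace
  \<open>snd c p + V\<close> (so that its tangent spaces are \<open>V\<close> in these charts), and whose tangent spaces are
  those of \<open>D\<close>.\<close>

definition integral_manifold ::
    "('m, 'e::euclidean_space) chart set \<Rightarrow> ('m \<Rightarrow> 'e set) \<Rightarrow> 'm set \<Rightarrow> bool"
  where "integral_manifold A D L \<longleftrightarrow>
           (\<forall>p\<in>L. \<exists>c\<in>A. \<exists>V. p \<in> fst c \<and> subspace V \<and>
              L \<inter> fst c = {q \<in> fst c. snd c q - snd c p \<in> V} \<and>
              (\<forall>q\<in>L \<inter> fst c. to_coords A c q ` D q = V))"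

definition integrable_distribution ::
    "('m, 'e::euclidean_space) chart set \<Rightarrow> ('m \<Rightarrow> 'e set) \<Rightarrow> bool"
  where "integrable_distribution A D \<longleftrightarrow> (\<forall>p. \<exists>L. p \<in> L \<and> integral_manifold A D L)"


section \<open>Submanifolds\<close>

text \<open>An immersed submanifold \<open>N\<close> of \<open>M\<close> is given by its immersion \<open>f\<close>, which need not be injective.
  Points and tangent vectors of \<open>N\<close> are regarded as points and tangent vectors of \<open>M\<close> through \<open>f\<close> and
  its differential.\<close>

definition induced_metric ::
    "('n, 'f::euclidean_space) chart set \<Rightarrow> ('m, 'e::euclidean_space) chart set \<Rightarrow>
     ('m \<Rightarrow> 'e \<Rightarrow> 'e \<Rightarrow> real) \<Rightarrow> ('n \<Rightarrow> 'm) \<Rightarrow> 'n \<Rightarrow> 'f \<Rightarrow> 'f \<Rightarrow> real"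
  where "induced_metric B A g f p u v = g (f p) (differential B A f p u) (differential B A f p v)"

definition nondegenerate_submanifold ::
    "('n::topological_space, 'f::euclidean_space) chart set \<Rightarrow>
     ('m::topological_space, 'e::euclidean_space) chart set \<Rightarrow>
     ('m \<Rightarrow> 'e \<Rightarrow> 'e \<Rightarrow> real) \<Rightarrow> ('n \<Rightarrow> 'm) \<Rightarrow> bool"
  where "nondegenerate_submanifold B A g f \<longleftrightarrow>
           smooth_map B A f \<and> (\<forall>p. inj (differential B A f p)) \<and>
           (\<forall>p. nondegenerate_on UNIV (induced_metric B A g f p))"

definition normal_space ::
    "('n, 'f::euclidean_space) chart set \<Rightarrow> ('m, 'e::euclidean_space) chart set \<Rightarrow>
     ('m \<Rightarrow> 'e \<Rightarrow> 'e \<Rightarrow> real) \<Rightarrow> ('n \<Rightarrow> 'm) \<Rightarrow> 'n \<Rightarrow> 'e set"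
  where "normal_space B A g f p = {\<xi>. \<forall>w. g (f p) \<xi> (differential B A f p w) = 0}"

definition orthogonal_distribution ::
    "('n \<Rightarrow> 'f \<Rightarrow> 'f \<Rightarrow> real) \<Rightarrow> ('n \<Rightarrow> 'f set) \<Rightarrow> 'n \<Rightarrow> 'f set"
  where "orthogonal_distribution h D p = {v. \<forall>w\<in>D p. h p v w = 0}"

text \<open>Gauss formula: the Levi-Civita connection of \<open>M\<close> applied to the field \<open>Y\<close> (regarded as a field
  along \<open>f\<close>) minus the Levi-Civita connection of \<open>N\<close>.\<close>

definition second_fundamental_form ::
    "('n, 'f::euclidean_space) chart set \<Rightarrow> ('m, 'e::euclidean_space) chart set \<Rightarrow>
     ('m \<Rightarrow> 'e \<Rightarrow> 'e \<Rightarrow> real) \<Rightarrow> ('n \<Rightarrow> 'm) \<Rightarrow> ('n \<Rightarrow> 'f) \<Rightarrow> ('n \<Rightarrow> 'f) \<Rightarrow> 'n \<Rightarrow> 'e"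
  where "second_fundamental_form B A g f X Y p =
           nabla_along B A g f (\<lambda>x. differential B A f x (Y x)) p (X p)
           - differential B A f p (nabla B (induced_metric B A g f) Y p (X p))"

definition paraquaternionic_CR_submanifold ::
    "('n::topological_space, 'f::euclidean_space) chart set \<Rightarrow>
     ('m::topological_space, 'e::euclidean_space) chart set \<Rightarrow>
     ('m \<Rightarrow> ('e \<Rightarrow>\<^sub>L 'e) set) \<Rightarrow> ('m \<Rightarrow> 'e \<Rightarrow> 'e \<Rightarrow> real) \<Rightarrow> ('n \<Rightarrow> 'm) \<Rightarrow> ('n \<Rightarrow> 'f set) \<Rightarrow> bool"
  where "paraquaternionic_CR_submanifold B A \<sigma> g f D \<longleftrightarrow>
           nondegenerate_submanifold B A g f \<and> distribution B D \<and>
           (\<forall>p. nondegenerate_on (D p) (induced_metric B A g f p)) \<and>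
           (\<forall>U J. canonical_local_basis A \<sigma> U J \<longrightarrow>
              (\<forall>p \<alpha>. f p \<in> U \<longrightarrow>
                 blinfun_apply (J \<alpha> (f p)) ` differential B A f p ` D p
                   = differential B A f p ` D p \<and>
                 blinfun_apply (J \<alpha> (f p)) ` differential B A f p `
                     orthogonal_distribution (induced_metric B A g f) D p
                   \<subseteq> normal_space B A g f p))"

end

theory Submission
  imports Defs
begin

text \<open>Work at a point \<open>p\<close> of \<open>N\<close> with the symmetric bilinear map \<open>S\<close> given by the second derivative of
  the immersion corrected by the Christoffel symbols of \<open>M\<close>, so that
  \<open>\<nabla>\<^sub>v (df Y) = df (DY v) + S v Y\<close> and \<open>B(X, Y) = S X Y - df (\<Gamma> X Y)\<close> with \<open>\<Gamma>\<close> the Christoffel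
  symbols of \<open>N\<close>. As \<open>\<sigma>\<close> is parallel and preserves \<open>df D\<close>, passing from \<open>Y\<close> to \<open>J Y\<close> replaces
  \<open>\<nabla>\<^sub>v (df Y)\<close> by \<open>J \<nabla>\<^sub>v (df Y)\<close>, modulo \<open>df D\<close>.

  If \<open>D\<close> is integrable, \<open>\<nabla>\<^sub>v (df Y)\<close> modulo \<open>df D\<close> is symmetric in \<open>v\<close> and \<open>Y\<close> and commutes with
  the structures \<open>J\<close> in either argument; two of them anticommute, so it vanishes. Then \<open>B\<close> is both
  tangent and normal to \<open>N\<close> on \<open>D\<close>, hence zero.

  If \<open>B\<close> vanishes on \<open>D\<close>, then for \<open>Z\<close> in \<open>D\<^sup>\<bottom>\<close> the number \<open>g(\<nabla>\<^sub>v (df Y), Z)\<close> is, up to sign,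
  \<open>g(\<nabla>\<^sub>v (df (J Y)), J Z)\<close>, which is zero since \<open>J Z\<close> is normal; so \<open>D\<close> is closed under the
  connection of \<open>N\<close>, and Frobenius' theorem applies.\<close>

section \<open>Calculus of differentiable maps\<close>

text \<open>The tangent spaces are tied to the smooth structure only through a preferred chart at
  each point, chosen without any regularity, so everything is tested at single points. For the same
  reason integrability is compared with B through \<open>involutive_at\<close>, a condition on
  derivatives at one point, and not through Lie brackets of smooth fields: the field
  \<open>Y'\<close> with \<open>df Y' = J (df Y)\<close> is merely chosen at each point by inverting
  the injective \<open>df\<close>, and the argument uses that such a solution of a linear equation
  is differentiable at \<open>p\<close>. Linear equations with variable coefficients are studied for
  this purpose, and they give smoothness again in Frobenius' theorem. Connection 1-forms never
  appear: the derivative of \<open>J\<close> in a direction is some element of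
  \<open>\<sigma>\<close>, hence maps \<open>df D\<close> into itself and disappears modulo
  \<open>df D\<close>. The signs \<open>eps\<close> enter only as nonzero numbers of square 1, so
  one anticommuting pair settles the first direction and a single structure the second. B is tested
  on global sections, whereas frames of \<open>D\<close> are local; bump functions close this
  gap.\<close>

lemma frechet_derivative_cong_open:
  assumes "open S" "x \<in> S" "\<And>y. y \<in> S \<Longrightarrow> f y = g y"
  shows "frechet_derivative f (at x) = frechet_derivative g (at x)"
proof -
  have "(f has_derivative D) (at x) \<longleftrightarrow> (g has_derivative D) (at x)" for D
    using assms by (metis has_derivative_transform_within_open)
  then show ?thesis by (simp add: frechet_derivative_def)
qed

lemma frechet_derivative_eqI:
  "(f has_derivative D) (at x) \<Longrightarrow> frechet_derivative f (at x) = D"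
  by (metis frechet_derivative_at)

lemma Ck_on_cong:
  assumes "open S" "\<And>x. x \<in> S \<Longrightarrow> f x = g x" "Ck_on k S f"
  shows "Ck_on k S g"
  using assms
proof (induction k arbitrary: f g)
  case 0
  then show ?case by (simp cong: continuous_on_cong_simp)
next
  case (Suc k)
  have "frechet_derivative f (at x) = frechet_derivative g (at x)" if "x \<in> S" for x
    using frechet_derivative_cong_open[OF \<open>open S\<close> that] Suc.prems(2) by blast
  then have "Ck_on k S (\<lambda>x. frechet_derivative g (at x) v)" for v
    using Suc.IH[of "\<lambda>x. frechet_derivative f (at x) v"] Suc.prems by auto
  moreover have "g differentiable (at x)" if "x \<in> S" for x
    using Suc.prems that unfolding differentiable_def
    by (metis Ck_on.simps(2) differentiable_def has_derivative_transform_within_open)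
  ultimately show ?case by simp
qed

lemma Ck_on_subset: "Ck_on k S f \<Longrightarrow> T \<subseteq> S \<Longrightarrow> Ck_on k T f"
  by (induction k arbitrary: f) (auto intro: continuous_on_subset)

text \<open>Derivatives in \<open>Ck_on\<close> are two-sided, so the neighbourhoods
  \<open>T\<close> may leave \<open>S\<close>. This glues a cut-off field to zero outside its
  support.\<close>

lemma Ck_on_local:
  assumes "\<And>x. x \<in> S \<Longrightarrow> \<exists>T. open T \<and> x \<in> T \<and> Ck_on k T f"
  shows "Ck_on k S f"
  using assms
proof (induction k arbitrary: f)
  case 0
  show ?case
    using "0" by (metis Ck_on.simps(1) continuous_at_imp_continuous_on continuous_on_eq_continuous_at)
next
  case (Suc k)
  then show ?case by simp meson
qed

lemma Ck_on_Suc_imp: "Ck_on (Suc k) S f \<Longrightarrow> Ck_on k S f"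
proof (induction k arbitrary: f)
  case 0
  then show ?case
    by (auto intro!: differentiable_imp_continuous_on simp: differentiable_on_def differentiable_at_withinI)
next
  case (Suc k)
  have "Ck_on k S (\<lambda>x. frechet_derivative f (at x) v)" for v
    using Suc.prems Suc.IH by (metis Ck_on.simps(2))
  then show ?case using Suc.prems by simp
qed

lemma Ck_on_Suc_I:
  assumes "open S" "\<And>x. x \<in> S \<Longrightarrow> (f has_derivative f' x) (at x)"
    and "\<And>v. Ck_on k S (\<lambda>x. f' x v)"
  shows "Ck_on (Suc k) S f"
proof -
  have "Ck_on k S (\<lambda>x. frechet_derivative f (at x) v)" for v
    by (rule Ck_on_cong[OF assms(1) _ assms(3)[of v]]) (metis assms(2) frechet_derivative_eqI)
  then show ?thesis using assms(2) by (auto simp: differentiable_def)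
qed

lemma Ck_on_Suc_D:
  assumes "Ck_on (Suc k) S f" "x \<in> S"
  shows "(f has_derivative frechet_derivative f (at x)) (at x)"
  using assms by (simp add: frechet_derivative_works)

lemma Ck_on_Suc_D2: "Ck_on (Suc k) S f \<Longrightarrow> Ck_on k S (\<lambda>x. frechet_derivative f (at x) v)"
  by simp

lemma Ck_on_const: "Ck_on k S (\<lambda>x. c)"
  by (induction k arbitrary: c) auto

lemma Ck_on_bounded_linear:
  assumes "bounded_linear L" "open S" "Ck_on k S f"
  shows "Ck_on k S (\<lambda>x. L (f x))"
  using assms
proof (induction k arbitrary: f)
  case 0
  then show ?case by (auto intro: bounded_linear.continuous_on)
next
  case (Suc k)
  show ?case
  proof (rule Ck_on_Suc_I)
    show "((\<lambda>x. L (f x)) has_derivative (\<lambda>v. L (frechet_derivative f (at x) v))) (at x)"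
      if "x \<in> S" for x
      using bounded_linear.has_derivative[OF \<open>bounded_linear L\<close> Ck_on_Suc_D[OF Suc.prems(3) that]] .
    show "Ck_on k S (\<lambda>x. L (frechet_derivative f (at x) v))" for v
      by (rule Suc.IH) (use Suc.prems in auto)
  qed (use Suc.prems in auto)
qed

lemma Ck_on_id: "Ck_on k S (\<lambda>x. x)"
  by (cases k) (auto intro: Ck_on_const)

lemma Ck_on_add:
  assumes "open S" "Ck_on k S f" "Ck_on k S g"
  shows "Ck_on k S (\<lambda>x. f x + g x)"
  using assms
proof (induction k arbitrary: f g)
  case 0
  then show ?case by (auto intro: continuous_on_add)
next
  case (Suc k)
  show ?case
  proof (rule Ck_on_Suc_I)
    show "((\<lambda>x. f x + g x) has_derivative
        (\<lambda>v. frechet_derivative f (at x) v + frechet_derivative g (at x) v)) (at x)" if "x \<in> S" for x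
      by (intro has_derivative_add Ck_on_Suc_D[OF Suc.prems(2) that] Ck_on_Suc_D[OF Suc.prems(3) that])
    show "Ck_on k S (\<lambda>x. frechet_derivative f (at x) v + frechet_derivative g (at x) v)" for v
      by (rule Suc.IH) (use Suc.prems in auto)
  qed (use Suc.prems in auto)
qed

lemma Ck_on_sum:
  assumes "open S" "\<And>i. i \<in> I \<Longrightarrow> Ck_on k S (f i)"
  shows "Ck_on k S (\<lambda>x. \<Sum>i\<in>I. f i x)"
  using assms(2) by (induction I rule: infinite_finite_induct) (auto intro!: Ck_on_const Ck_on_add assms(1))

lemma Ck_on_bilinear:
  assumes "bounded_bilinear B" "open S" "Ck_on k S f" "Ck_on k S g"
  shows "Ck_on k S (\<lambda>x. B (f x) (g x))"
  using assms
proof (induction k arbitrary: f g)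
  case 0
  then show ?case by (auto intro: bounded_bilinear.continuous_on)
next
  case (Suc k)
  show ?case
  proof (rule Ck_on_Suc_I)
    show "((\<lambda>x. B (f x) (g x)) has_derivative
        (\<lambda>v. B (f x) (frechet_derivative g (at x) v) + B (frechet_derivative f (at x) v) (g x))) (at x)"
      if "x \<in> S" for x
      by (intro bounded_bilinear.FDERIV[OF Suc.prems(1)] Ck_on_Suc_D[OF Suc.prems(3) that] Ck_on_Suc_D[OF Suc.prems(4) that])
    show "Ck_on k S (\<lambda>x. B (f x) (frechet_derivative g (at x) v) + B (frechet_derivative f (at x) v) (g x))" for v
      by (intro Ck_on_add Suc.IH Suc.prems(1,2) Ck_on_Suc_D2[OF Suc.prems(3)] Ck_on_Suc_D2[OF Suc.prems(4)]
          Ck_on_Suc_imp[OF Suc.prems(3)] Ck_on_Suc_imp[OF Suc.prems(4)])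
  qed (use Suc.prems in auto)
qed

section \<open>Linear maps depending on a parameter\<close>

lemma linear_Basis_expansion:
  fixes L :: "'b::euclidean_space \<Rightarrow> 'c::real_vector"
  assumes "linear L"
  shows "L w = (\<Sum>i\<in>Basis. (w \<bullet> i) *\<^sub>R L i)"
proof -
  have "L w = L (\<Sum>i\<in>Basis. (w \<bullet> i) *\<^sub>R i)" by (simp add: euclidean_representation)
  also have "\<dots> = (\<Sum>i\<in>Basis. (w \<bullet> i) *\<^sub>R L i)"
    by (simp add: linear_sum[OF assms] linear_cmul[OF assms])
  finally show ?thesis .
qed

text \<open>Families of linear maps are given by their columns \<open>\<lambda>y. L y w\<close>, the
  form in which Jacobians arise. Expanding \<open>z y\<close> in the basis reduces application to a
  finite sum of scalar multiples of columns.\<close>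

lemma Ck_on_apply_linear:
  fixes z :: "'a::real_normed_vector \<Rightarrow> 'b::euclidean_space" and L :: "'a \<Rightarrow> 'b \<Rightarrow> 'c::real_normed_vector"
  assumes "open S" "\<And>y. y \<in> S \<Longrightarrow> linear (L y)"
    and "\<And>w. Ck_on k S (\<lambda>y. L y w)" "Ck_on k S z"
  shows "Ck_on k S (\<lambda>y. L y (z y))"
proof -
  have "Ck_on k S (\<lambda>y. \<Sum>i\<in>Basis. (z y \<bullet> i) *\<^sub>R L y i)"
    by (intro Ck_on_sum Ck_on_bilinear[OF bounded_bilinear_scaleR] assms
        Ck_on_bounded_linear[OF bounded_linear_inner_left])
  then show ?thesis
    by (rule Ck_on_cong[OF assms(1), rotated]) (metis assms(2) linear_Basis_expansion)
qed

text \<open>Product rule for a family known by its columns. Linearity of \<open>L' v\<close> comes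
  from uniqueness of the derivative, applied to the basis expansion of a constant \<open>w\<close>;
  later it yields linearity of the derivative of a metric in its arguments.\<close>

lemma has_derivative_apply_linear:
  fixes z :: "'a::real_normed_vector \<Rightarrow> 'b::euclidean_space" and L :: "'a \<Rightarrow> 'b \<Rightarrow> 'c::real_normed_vector"
  assumes "open S" "y0 \<in> S" and lin: "\<And>y. y \<in> S \<Longrightarrow> linear (L y)"
    and L': "\<And>w. ((\<lambda>y. L y w) has_derivative (\<lambda>v. L' v w)) (at y0)"
    and z': "(z has_derivative z') (at y0)"
  shows "((\<lambda>y. L y (z y)) has_derivative (\<lambda>v. L y0 (z' v) + L' v (z y0))) (at y0)"
    and "linear (L' v)"
proof -
  have der: "((\<lambda>y. \<Sum>i\<in>Basis. (z y \<bullet> i) *\<^sub>R L y i) has_derivative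
      (\<lambda>v. \<Sum>i\<in>Basis. (z y0 \<bullet> i) *\<^sub>R L' v i + (z' v \<bullet> i) *\<^sub>R L y0 i)) (at y0)"
    if "(z has_derivative z') (at y0)" for z z'
    by (intro has_derivative_sum has_derivative_scaleR L' has_derivative_inner_left that)
  have L'_exp: "L' v w = (\<Sum>i\<in>Basis. (w \<bullet> i) *\<^sub>R L' v i)" for v w
  proof -
    have "((\<lambda>y. \<Sum>i\<in>Basis. (w \<bullet> i) *\<^sub>R L y i) has_derivative
      (\<lambda>v. \<Sum>i\<in>Basis. (w \<bullet> i) *\<^sub>R L' v i)) (at y0)"
      using der[of "\<lambda>_. w" "\<lambda>_. 0"] by simp
    then have "((\<lambda>y. L y w) has_derivative (\<lambda>v. \<Sum>i\<in>Basis. (w \<bullet> i) *\<^sub>R L' v i)) (at y0)"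
      by (rule has_derivative_transform_within_open[OF _ assms(1,2)]) (metis lin linear_Basis_expansion)
    with L'[of w] show ?thesis by (metis has_derivative_unique)
  qed
  show "linear (L' v)"
  proof (rule linearI)
    fix a b and r :: real
    show "L' v (a + b) = L' v a + L' v b"
      unfolding L'_exp[of v "a+b"] L'_exp[of v a] L'_exp[of v b]
      by (simp add: inner_add_left scaleR_add_left sum.distrib)
    show "L' v (r *\<^sub>R a) = r *\<^sub>R L' v a"
      unfolding L'_exp[of v "r *\<^sub>R a"] L'_exp[of v a] by (simp add: scaleR_sum_right)
  qed
  have "(\<Sum>i\<in>Basis. (z y0 \<bullet> i) *\<^sub>R L' v i + (z' v \<bullet> i) *\<^sub>R L y0 i) = L y0 (z' v) + L' v (z y0)" for v
    unfolding sum.distrib L'_exp[symmetric] linear_Basis_expansion[OF lin[OF assms(2)], symmetric]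
    by simp
  then have "((\<lambda>y. \<Sum>i\<in>Basis. (z y \<bullet> i) *\<^sub>R L y i) has_derivative
      (\<lambda>v. L y0 (z' v) + L' v (z y0))) (at y0)"
    using der[OF z'] by simp
  then show "((\<lambda>y. L y (z y)) has_derivative (\<lambda>v. L y0 (z' v) + L' v (z y0))) (at y0)"
    by (rule has_derivative_transform_within_open[OF _ assms(1,2)]) (metis lin linear_Basis_expansion)
qed

text \<open>The derivative of the composite is a linear map depending on \<open>g x\<close>, applied
  to the derivative of \<open>g\<close>. Its columns are C^k by the induction hypothesis, and the
  middle space is Euclidean so that columns suffice.\<close>

lemma Ck_on_compose:
  fixes g :: "'a::real_normed_vector \<Rightarrow> 'b::euclidean_space" and f :: "'b \<Rightarrow> 'c::real_normed_vector"
  assumes "open S" "open T" "\<And>x. x \<in> S \<Longrightarrow> g x \<in> T" "Ck_on k T f" "Ck_on k S g"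
  shows "Ck_on k S (\<lambda>x. f (g x))"
  using assms(4,5)
proof (induction k arbitrary: f)
  case 0
  then show ?case using assms(3) by (auto intro: continuous_on_compose2)
next
  case (Suc k)
  show ?case
  proof (rule Ck_on_Suc_I[OF assms(1)])
    show "((\<lambda>x. f (g x)) has_derivative
        (\<lambda>v. frechet_derivative f (at (g x)) (frechet_derivative g (at x) v))) (at x)" if "x \<in> S" for x
      using diff_chain_at[OF Ck_on_Suc_D[OF Suc.prems(2) that] Ck_on_Suc_D[OF Suc.prems(1) assms(3)[OF that]]]
      by (simp add: o_def)
    show "Ck_on k S (\<lambda>x. frechet_derivative f (at (g x)) (frechet_derivative g (at x) v))" for v
    proof (rule Ck_on_apply_linear[OF assms(1)])
      show "linear (frechet_derivative f (at (g x)))" if "x \<in> S" for x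
        using Suc.prems assms(3)[OF that] by (simp add: linear_frechet_derivative)
      show "Ck_on k S (\<lambda>x. frechet_derivative f (at (g x)) w)" for w
        by (rule Suc.IH[of "\<lambda>y. frechet_derivative f (at y) w"])
          (rule Ck_on_Suc_D2[OF Suc.prems(1)], rule Ck_on_Suc_imp[OF Suc.prems(2)])
      show "Ck_on k S (\<lambda>x. frechet_derivative g (at x) v)" using Suc.prems by simp
    qed
  qed
qed

section \<open>Linear equations with variable coefficients\<close>

lemma linear_family_bounded_below:
  fixes A :: "'a::real_normed_vector \<Rightarrow> 'b::euclidean_space \<Rightarrow> 'c::euclidean_space"
  assumes "open S" "y0 \<in> S" and lin: "\<And>y. y \<in> S \<Longrightarrow> linear (A y)"
    and cont: "\<And>w. continuous (at y0) (\<lambda>y. A y w)" and inj: "inj (A y0)"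
  shows "\<exists>T K. open T \<and> y0 \<in> T \<and> T \<subseteq> S \<and> K > 0 \<and> (\<forall>y\<in>T. \<forall>w. norm w \<le> K * norm (A y w))"
proof -
  obtain L where L: "linear L" "L \<circ> A y0 = id"
    using linear_injective_left_inverse[OF lin[OF assms(2)] inj] by blast
  obtain C where C: "C > 0" "\<And>x. norm (L x) \<le> norm x * C"
    using bounded_linear.pos_bounded[OF linear_conv_bounded_linear[THEN iffD1, OF L(1)]] by blast
  \<comment> \<open>\<open>N y\<close> dominates the operator norm of \<open>A y - A y0\<close> but
    involves only columns, whose continuity is the assumption.\<close>
  define N where "N y = (\<Sum>i\<in>Basis. norm (A y i - A y0 i))" for y
  have Nb: "norm (A y w - A y0 w) \<le> norm w * N y" if "y \<in> S" for y w
  proof -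
    have "A y w - A y0 w = (\<Sum>i\<in>Basis. (w \<bullet> i) *\<^sub>R (A y i - A y0 i))"
      using linear_Basis_expansion[OF lin[OF that], of w] linear_Basis_expansion[OF lin[OF assms(2)], of w]
      by (simp add: sum_subtractf scaleR_diff_right)
    also have "norm \<dots> \<le> (\<Sum>i\<in>Basis. norm w * norm (A y i - A y0 i))"
      by (rule sum_norm_le) (simp add: Basis_le_norm mult_right_mono)
    finally show ?thesis by (simp add: N_def sum_distrib_left)
  qed
  have "continuous (at y0) N" unfolding N_def
    by (intro continuous_intros cont)
  moreover have "N y0 = 0" by (simp add: N_def)
  ultimately have "(N \<longlongrightarrow> 0) (at y0)" by (metis isCont_def)
  \<comment> \<open>With this threshold the perturbation contributes at most
    \<open>norm w / 2\<close>, which is absorbed on the left; hence the constant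
    \<open>2 * C\<close>.\<close>
  then have "eventually (\<lambda>y. N y < 1 / (2 * C)) (at y0)"
    using C(1) by (intro order_tendstoD(2)) auto
  then have "eventually (\<lambda>y. N y < 1 / (2 * C)) (nhds y0)"
    unfolding eventually_at_filter
  proof (rule eventually_mono)
    fix y assume "y \<noteq> y0 \<longrightarrow> y \<in> UNIV \<longrightarrow> N y < 1 / (2 * C)"
    then show "N y < 1 / (2 * C)" using \<open>N y0 = 0\<close> C(1) by (cases "y = y0") auto
  qed
  then obtain T where T: "open T" "y0 \<in> T" "\<And>y. y \<in> T \<Longrightarrow> N y < 1 / (2 * C)"
    unfolding eventually_nhds by blast
  have "norm w \<le> 2 * C * norm (A y w)" if y: "y \<in> T \<inter> S" for y w
  proof -
    have "w = L (A y w) - L (A y w - A y0 w)"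
      using L(2) by (simp add: linear_diff[OF L(1)] fun_eq_iff)
    then have "norm w \<le> norm (L (A y w)) + norm (L (A y w - A y0 w))"
      by (metis norm_triangle_ineq4)
    also have "\<dots> \<le> norm (A y w) * C + (norm w * N y) * C"
      using C Nb[of y w] y by (meson IntD2 add_mono mult_right_mono less_imp_le order_trans)
    also have "(norm w * N y) * C \<le> norm w * (1 / (2 * C)) * C"
      using T(3)[of y] y C(1) by (intro mult_right_mono mult_left_mono) auto
    also have "norm w * (1 / (2 * C)) * C = norm w / 2" using C(1) by simp
    finally show ?thesis by (simp add: field_simps)
  qed
  moreover have "open (T \<inter> S)" "y0 \<in> T \<inter> S" "T \<inter> S \<subseteq> S" "2 * C > 0" using T assms C by auto
  ultimately show ?thesis by (intro exI[of _ "T \<inter> S"] exI[of _ "2 * C"] conjI ballI allI)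
qed

text \<open>The error \<open>w y - w y0\<close> solves the equation with right-hand side
  \<open>z y - A y (w y0)\<close>, which tends to 0, and the uniform lower bound on
  \<open>A y\<close> transfers this to the error.\<close>

lemma implicit_linear_continuous:
  fixes A :: "'a::real_normed_vector \<Rightarrow> 'b::euclidean_space \<Rightarrow> 'c::euclidean_space"
  assumes S: "open S" "y0 \<in> S" and lin: "\<And>y. y \<in> S \<Longrightarrow> linear (A y)"
    and A: "\<And>u. continuous (at y0) (\<lambda>y. A y u)" and inj: "inj (A y0)"
    and z: "continuous (at y0) z" and sol: "\<And>y. y \<in> S \<Longrightarrow> A y (w y) = z y"
  shows "continuous (at y0) w"
proof -
  obtain T K where T: "open T" "y0 \<in> T" "T \<subseteq> S"
    and K: "\<And>y u. y \<in> T \<Longrightarrow> norm u \<le> K * norm (A y u)"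
    using linear_family_bounded_below[OF S lin A inj] by meson
  have "((\<lambda>y. z y - A y (w y0)) \<longlongrightarrow> z y0 - A y0 (w y0)) (at y0)"
    using z A[of "w y0"] unfolding isCont_def by (rule tendsto_diff)
  then have "((\<lambda>y. z y - A y (w y0)) \<longlongrightarrow> 0) (at y0)" using sol[OF S(2)] by simp
  then have lim: "((\<lambda>y. K * norm (z y - A y (w y0))) \<longlongrightarrow> 0) (at y0)"
    by (intro tendsto_mult_right_zero tendsto_norm_zero)
  have bd: "norm (w y - w y0) \<le> K * norm (z y - A y (w y0))" if "y \<in> T" for y
    using K[OF that, of "w y - w y0"] subsetD[OF T(3) that] by (simp add: linear_diff[OF lin] sol)
  show ?thesis unfolding isCont_def
    by (rule Lim_null_comparison[OF _ lim, THEN LIM_zero_cancel])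
      (rule eventually_mono[OF eventually_at_in_open'[OF T(1,2)] bd])
qed

text \<open>A factor tending to 0 times a differentiable factor vanishing at \<open>x\<close> is of
  smaller order than the distance to \<open>x\<close>. In the application the first factor is a
  component of a solution so far known only to be continuous.\<close>

lemma has_derivative_scaleR_zero:
  fixes \<phi> :: "'a::real_normed_vector \<Rightarrow> real"
  assumes F: "(F has_derivative F') (at x)" and "F x = 0"
    and \<phi>: "(\<phi> \<longlongrightarrow> 0) (at x)" and "\<phi> x = 0"
  shows "((\<lambda>y. \<phi> y *\<^sub>R F y) has_derivative (\<lambda>v. 0)) (at x)"
proof -
  obtain M where M: "\<And>v. norm (F' v) \<le> norm v * M" "M > 0"
    using bounded_linear.pos_bounded[OF has_derivative_bounded_linear[OF F]] by blast
  let ?q = "\<lambda>y. (F y - F x - F' (y - x)) /\<^sub>R norm (y - x)"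
  have "(?q \<longlongrightarrow> 0) (at x)" using F by (simp add: has_derivative_at_within)
  then have "((\<lambda>y. \<bar>\<phi> y\<bar> * (norm (?q y) + M)) \<longlongrightarrow> 0 * (0 + M)) (at x)"
    by (intro tendsto_mult tendsto_add tendsto_const tendsto_norm_zero tendsto_rabs_zero \<phi>)
  then have lim: "((\<lambda>y. \<bar>\<phi> y\<bar> * (norm (?q y) + M)) \<longlongrightarrow> 0) (at x)" by simp
  have bd: "norm ((\<phi> y *\<^sub>R F y - \<phi> x *\<^sub>R F x - 0) /\<^sub>R norm (y - x)) \<le> \<bar>\<phi> y\<bar> * (norm (?q y) + M)"
    if "y \<noteq> x" for y
  proof -
    have n: "norm (y - x) > 0" using that by simp
    have "norm (F y) \<le> norm (F y - F' (y - x)) + norm (F' (y - x))"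
      by (metis diff_add_cancel norm_triangle_ineq)
    also have "\<dots> \<le> norm (F y - F' (y - x)) + norm (y - x) * M" using M(1) by simp
    finally have "norm (F y) / norm (y - x) \<le> norm (F y - F' (y - x)) / norm (y - x) + M"
      using n by (simp add: field_simps)
    also have "norm (F y - F' (y - x)) / norm (y - x) = norm (?q y)"
      using \<open>F x = 0\<close> by (simp add: divide_inverse mult.commute)
    finally have "norm (F y) / norm (y - x) \<le> norm (?q y) + M" .
    then have "\<bar>\<phi> y\<bar> * (norm (F y) / norm (y - x)) \<le> \<bar>\<phi> y\<bar> * (norm (?q y) + M)"
      by (rule mult_left_mono) simp
    then show ?thesis using \<open>F x = 0\<close> by (simp add: divide_inverse abs_mult mult.commute mult.left_commute)
  qed
  have "((\<lambda>y. (\<phi> y *\<^sub>R F y - \<phi> x *\<^sub>R F x - 0) /\<^sub>R norm (y - x)) \<longlongrightarrow> 0) (at x)"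
    by (rule Lim_null_comparison[OF _ lim]) (simp only: eventually_at_filter, intro always_eventually allI impI bd)
  then show ?thesis unfolding has_derivative_at_within by (simp only: bounded_linear_zero simp_thms)
qed

text \<open>Solving \<open>A y (w y) = z y\<close> for \<open>w\<close> gains its regularity from \<open>A\<close> and \<open>z\<close>, by differentiating the
  equation.\<close>

lemma implicit_linear_has_derivative:
  fixes A :: "'a::real_normed_vector \<Rightarrow> 'b::euclidean_space \<Rightarrow> 'c::euclidean_space"
  assumes S: "open S" "y0 \<in> S" and lin: "\<And>y. y \<in> S \<Longrightarrow> linear (A y)"
    and A': "\<And>w. ((\<lambda>y. A y w) has_derivative (\<lambda>v. A' v w)) (at y0)" and inj: "inj (A y0)"
    and z': "(z has_derivative z') (at y0)" and sol: "\<And>y. y \<in> S \<Longrightarrow> A y (w y) = z y"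
  obtains w' where "(w has_derivative w') (at y0)" "\<And>v. A y0 (w' v) = z' v - A' v (w y0)"
proof -
  have contA: "continuous (at y0) (\<lambda>y. A y u)" for u
    using A' has_derivative_continuous by blast
  obtain L where L: "linear L" "L \<circ> A y0 = id"
    using linear_injective_left_inverse[OF lin[OF S(2)] inj] by blast
  have bL: "bounded_linear L" using L(1) linear_conv_bounded_linear by blast
  define w0 where "w0 = w y0"
  define d where "d y = z y - A y w0" for y
  have d': "(d has_derivative (\<lambda>v. z' v - A' v w0)) (at y0)"
    unfolding d_def by (intro has_derivative_diff z' A')
  have dw: "A y (w y - w0) = d y" if "y \<in> S" for y
    using sol[OF that] by (simp add: d_def linear_diff[OF lin[OF that]])
  have "continuous (at y0) w"
    by (rule implicit_linear_continuous[OF S lin contA inj has_derivative_continuous[OF z'] sol])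
  then have wcont: "(w \<longlongrightarrow> w0) (at y0)" by (simp add: isCont_def w0_def)
  txt \<open>The error of \<open>w\<close> is controlled by applying \<open>A y0\<close>'s left inverse to
    \<open>A y0 (w y - w0) = d y - (A y - A y0) (w y - w0)\<close>.\<close>
  have key: "((\<lambda>y. w y - w0 - L (d y)) has_derivative (\<lambda>v. 0)) (at y0)"
  proof -
    have eq: "w y - w0 - L (d y) = - L (\<Sum>i\<in>Basis. ((w y - w0) \<bullet> i) *\<^sub>R (A y i - A y0 i))" if "y \<in> S" for y
    proof -
      have "(\<Sum>i\<in>Basis. ((w y - w0) \<bullet> i) *\<^sub>R (A y i - A y0 i)) = A y (w y - w0) - A y0 (w y - w0)"
        using linear_Basis_expansion[OF lin[OF that], of "w y - w0"]
          linear_Basis_expansion[OF lin[OF S(2)], of "w y - w0"]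
        by (simp add: sum_subtractf scaleR_diff_right)
      moreover have "L (A y0 (w y - w0)) = w y - w0" using L(2) by (simp add: fun_eq_iff)
      ultimately show ?thesis using dw[OF that] by (simp add: linear_diff[OF L(1)])
    qed
    have term0: "((\<lambda>y. ((w y - w0) \<bullet> i) *\<^sub>R (A y i - A y0 i)) has_derivative (\<lambda>v. 0)) (at y0)" for i
    proof (rule has_derivative_scaleR_zero)
      show "((\<lambda>y. A y i - A y0 i) has_derivative (\<lambda>v. A' v i)) (at y0)"
        using has_derivative_diff[OF A' has_derivative_const, of i "A y0 i"] by simp
      show "((\<lambda>y. (w y - w0) \<bullet> i) \<longlongrightarrow> 0) (at y0)"
        using tendsto_inner[OF LIM_zero[OF wcont] tendsto_const, of i] by simp
    qed (simp_all add: w0_def)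
    have "((\<lambda>y. - L (\<Sum>i\<in>Basis. ((w y - w0) \<bullet> i) *\<^sub>R (A y i - A y0 i))) has_derivative
        (\<lambda>v. - L (\<Sum>i\<in>(Basis::'b set). 0))) (at y0)"
      by (intro has_derivative_minus bounded_linear.has_derivative[OF bL] has_derivative_sum term0)
    then have "((\<lambda>y. - L (\<Sum>i\<in>Basis. ((w y - w0) \<bullet> i) *\<^sub>R (A y i - A y0 i))) has_derivative (\<lambda>v. 0)) (at y0)"
      by (simp add: linear_0[OF L(1)])
    then show ?thesis
      by (rule has_derivative_transform_within_open[OF _ S]) (simp add: eq)
  qed
  have "((\<lambda>y. (w y - w0 - L (d y)) + L (d y) + w0) has_derivative (\<lambda>v. 0 + L (z' v - A' v w0) + 0)) (at y0)"
    by (intro has_derivative_add key bounded_linear.has_derivative[OF bL] d' has_derivative_const)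
  then have w': "(w has_derivative (\<lambda>v. L (z' v - A' v w0))) (at y0)" by simp
  \<comment> \<open>The derivative of \<open>w\<close> is known so far only through the left inverse
    \<open>L\<close>. Differentiating the equation itself determines its image under
    \<open>A y0\<close>.\<close>
  have "((\<lambda>y. A y (w y)) has_derivative (\<lambda>v. A y0 (L (z' v - A' v w0)) + A' v (w y0))) (at y0)"
    by (rule has_derivative_apply_linear(1)[OF S lin A' w'])
  then have "(z has_derivative (\<lambda>v. A y0 (L (z' v - A' v w0)) + A' v (w y0))) (at y0)"
    by (rule has_derivative_transform_within_open[OF _ S]) (simp add: sol)
  from has_derivative_unique[OF z' this]
  have "A y0 (L (z' v - A' v w0)) = z' v - A' v (w y0)" for v
    by (metis add_diff_cancel_right')
  then show thesis by (rule that[OF w'])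
qed

text \<open>Bootstrapping: the derivative of \<open>w\<close> solves the same equation, whose new
  right-hand side is the derivative of \<open>z\<close> minus the derivative of \<open>A\<close>
  applied to \<open>w\<close>, and this is C^k as soon as \<open>w\<close> is. The induction
  therefore runs over all right-hand sides and solutions.\<close>

lemma implicit_linear_Ck_on:
  fixes A :: "'a::real_normed_vector \<Rightarrow> 'b::euclidean_space \<Rightarrow> 'c::euclidean_space"
  assumes S: "open S" and lin: "\<And>y. y \<in> S \<Longrightarrow> linear (A y)" and inj: "\<And>y. y \<in> S \<Longrightarrow> inj (A y)"
    and A: "\<And>w. Ck_on k S (\<lambda>y. A y w)" and z: "Ck_on k S z"
    and sol: "\<And>y. y \<in> S \<Longrightarrow> A y (w y) = z y"
  shows "Ck_on k S w"
  using A z sol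
proof (induction k arbitrary: z w)
  case 0
  have "continuous (at y) w" if y: "y \<in> S" for y
  proof (rule implicit_linear_continuous[where A=A and w=w, OF S y lin _ inj[OF y] _ 0(3)])
    show "continuous (at y) (\<lambda>y. A y u)" "continuous (at y) z" for u
      using 0(1)[of u] 0(2) S y by (simp_all add: continuous_on_eq_continuous_at)
  qed
  then show ?case by (simp add: continuous_at_imp_continuous_on)
next
  case (Suc k)
  have A': "((\<lambda>y. A y u) has_derivative (\<lambda>v. frechet_derivative (\<lambda>y. A y u) (at y) v)) (at y)"
    if "y \<in> S" for y u
    using Ck_on_Suc_D[OF Suc.prems(1) that] .
  have z': "(z has_derivative frechet_derivative z (at y)) (at y)" if "y \<in> S" for y
    using Ck_on_Suc_D[OF Suc.prems(2) that] .
  have "\<exists>w'. (w has_derivative w') (at y) \<and>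
      (\<forall>v. A y (w' v) = frechet_derivative z (at y) v - frechet_derivative (\<lambda>x. A x (w y)) (at y) v)" if y: "y \<in> S" for y
    by (rule implicit_linear_has_derivative[OF S y lin A'[OF y] inj[OF y] z'[OF y] Suc.prems(3)]) blast+
  then obtain w' where w': "\<And>y. y \<in> S \<Longrightarrow> (w has_derivative w' y) (at y)"
    and w'_eq: "\<And>y v. y \<in> S \<Longrightarrow>
      A y (w' y v) = frechet_derivative z (at y) v - frechet_derivative (\<lambda>x. A x (w y)) (at y) v"
    by metis
  have linA': "linear (\<lambda>u. frechet_derivative (\<lambda>x. A x u) (at y) v)" if "y \<in> S" for y v
    by (rule has_derivative_apply_linear(2)[OF S that lin A'[OF that] has_derivative_const])
  have Ak: "Ck_on k S (\<lambda>y. A y u)" for u using Suc.prems(1) Ck_on_Suc_imp by blast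
  have Ckw: "Ck_on k S w"
    by (rule Suc.IH[OF Ak Ck_on_Suc_imp[OF Suc.prems(2)] Suc.prems(3)])
  have "Ck_on k S (\<lambda>y. frechet_derivative (\<lambda>x. A x (w y)) (at y) v)" for v
    by (rule Ck_on_apply_linear[where L="\<lambda>y u. frechet_derivative (\<lambda>x. A x u) (at y) v",
          OF S linA' Ck_on_Suc_D2[OF Suc.prems(1)] Ckw])
  then have rhs: "Ck_on k S (\<lambda>y. frechet_derivative z (at y) v + (-1) *\<^sub>R frechet_derivative (\<lambda>x. A x (w y)) (at y) v)" for v
    by (rule Ck_on_add[OF S Ck_on_Suc_D2[OF Suc.prems(2)] Ck_on_bounded_linear[OF bounded_linear_scaleR_right S]])
  have Ckw': "Ck_on k S (\<lambda>y. w' y v)" for v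
  proof (rule Suc.IH[OF Ak rhs[of v]])
    show "A y (w' y v) = frechet_derivative z (at y) v + (-1) *\<^sub>R frechet_derivative (\<lambda>x. A x (w y)) (at y) v"
      if "y \<in> S" for y
      using w'_eq[OF that] by simp
  qed
  show ?case by (rule Ck_on_Suc_I[OF S w' Ckw'])
qed

section \<open>Second derivatives and bump functions\<close>

text \<open>The second difference is the increment over \<open>[0, t]\<close> of a first difference
  in the direction \<open>w\<close>. Its derivative is controlled by the expansion of
  \<open>\<lambda>y. f' y v\<close> at the one point \<open>x\<close>, and the mean value inequality
  does the rest.\<close>

lemma second_difference_estimate:
  fixes f :: "'a::real_normed_vector \<Rightarrow> 'b::real_normed_vector"
  assumes S: "open S" "x \<in> S" and f': "\<And>y. y \<in> S \<Longrightarrow> (f has_derivative f' y) (at y)"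
    and A: "((\<lambda>y. f' y v) has_derivative A) (at x)" and e: "e > 0"
  shows "\<exists>d>0. \<forall>t. 0 < t \<longrightarrow> t < d \<longrightarrow>
    norm (f (x + t *\<^sub>R v + t *\<^sub>R w) - f (x + t *\<^sub>R v) - f (x + t *\<^sub>R w) + f x - (t * t) *\<^sub>R A w) \<le> e * (t * t)"
proof -
  \<comment> \<open>All points used lie within \<open>t * M\<close> of \<open>x\<close>; the summand
    1 keeps \<open>M\<close> positive. The factor 2 in \<open>\<eta>\<close> pays for the two points
    at which the expansion is used.\<close>
  define M where "M = norm v + norm w + 1"
  have M: "M > 0" unfolding M_def by (simp add: add_nonneg_pos)
  define \<eta> where "\<eta> = e / (2 * M)"
  have \<eta>: "\<eta> > 0" using e M by (simp add: \<eta>_def)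
  have blA: "bounded_linear A" using A by (rule has_derivative_bounded_linear)
  obtain \<delta> where \<delta>: "\<delta> > 0"
    "\<And>y. norm (y - x) < \<delta> \<Longrightarrow> norm (f' y v - f' x v - A (y - x)) \<le> \<eta> * norm (y - x)"
    using A \<eta> unfolding has_derivative_at_alt by meson
  obtain \<rho> where \<rho>: "\<rho> > 0" "ball x \<rho> \<subseteq> S"
    using S open_contains_ball by meson
  define d where "d = min \<delta> \<rho> / M"
  have d: "d > 0" using \<delta>(1) \<rho>(1) M by (simp add: d_def)
  have main: "norm (f (x + t *\<^sub>R v + t *\<^sub>R w) - f (x + t *\<^sub>R v) - f (x + t *\<^sub>R w) + f x - (t * t) *\<^sub>R A w) \<le> e * (t * t)"
    if t: "0 < t" "t < d" for t
  proof -
    \<comment> \<open>The expected second-order term is subtracted linearly in \<open>s\<close>, so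
      that \<open>g t - g 0\<close> is exactly the quantity to be estimated.\<close>
    define g where "g s = f (x + s *\<^sub>R v + t *\<^sub>R w) - f (x + s *\<^sub>R v) - (s * t) *\<^sub>R A w" for s
    define g' where "g' s = f' (x + s *\<^sub>R v + t *\<^sub>R w) v - f' (x + s *\<^sub>R v) v - t *\<^sub>R A w" for s
    have tM: "t * M < min \<delta> \<rho>" using t M by (simp add: d_def pos_less_divide_eq)
    have n1: "norm (s *\<^sub>R v + t *\<^sub>R w) \<le> t * M" "norm (s *\<^sub>R v) \<le> t * M" if s: "s \<in> {0..t}" for s
    proof -
      have a: "norm (s *\<^sub>R v) \<le> t * norm v" using s by (simp add: mult_right_mono)
      have "norm (s *\<^sub>R v + t *\<^sub>R w) \<le> norm (s *\<^sub>R v) + norm (t *\<^sub>R w)" by (rule norm_triangle_ineq)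
      also have "\<dots> \<le> t * norm v + t * norm w" using a t by simp
      also have "\<dots> \<le> t * M" using t by (simp add: M_def distrib_left)
      finally show "norm (s *\<^sub>R v + t *\<^sub>R w) \<le> t * M" .
      have "t * norm v \<le> t * M" using t by (simp add: M_def distrib_left)
      with a show "norm (s *\<^sub>R v) \<le> t * M" by simp
    qed
    have inS: "x + s *\<^sub>R v + t *\<^sub>R w \<in> S" "x + s *\<^sub>R v \<in> S" if s: "s \<in> {0..t}" for s
      using n1[OF s] tM \<rho>(2) by (auto simp: subset_iff dist_norm norm_minus_commute add.assoc)
    have dg: "(g has_derivative (\<lambda>r. r *\<^sub>R g' s)) (at s within {0..t})" if s: "s \<in> {0..t}" for s
    proof -
      have lin: "linear (f' y)" if "y \<in> S" for y
        using f'[OF that] has_derivative_linear by blast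
      have "((\<lambda>s. f (x + s *\<^sub>R v + t *\<^sub>R w)) has_derivative (\<lambda>r. f' (x + s *\<^sub>R v + t *\<^sub>R w) (r *\<^sub>R v))) (at s)"
        by (rule has_derivative_compose[where g=f and x=s and f="\<lambda>s. x + s *\<^sub>R v + t *\<^sub>R w", OF _ f'[OF inS(1)[OF s]]])
          (auto intro!: derivative_eq_intros)
      moreover have "((\<lambda>s. f (x + s *\<^sub>R v)) has_derivative (\<lambda>r. f' (x + s *\<^sub>R v) (r *\<^sub>R v))) (at s)"
        by (rule has_derivative_compose[where g=f and x=s and f="\<lambda>s. x + s *\<^sub>R v", OF _ f'[OF inS(2)[OF s]]])
          (auto intro!: derivative_eq_intros)
      moreover have "((\<lambda>s. (s * t) *\<^sub>R A w) has_derivative (\<lambda>r. (r * t) *\<^sub>R A w)) (at s)"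
        by (auto intro!: derivative_eq_intros)
      ultimately have "(g has_derivative (\<lambda>r. f' (x + s *\<^sub>R v + t *\<^sub>R w) (r *\<^sub>R v) - f' (x + s *\<^sub>R v) (r *\<^sub>R v)
          - (r * t) *\<^sub>R A w)) (at s)"
        unfolding g_def by (intro has_derivative_diff)
      moreover have "f' (x + s *\<^sub>R v + t *\<^sub>R w) (r *\<^sub>R v) - f' (x + s *\<^sub>R v) (r *\<^sub>R v) - (r * t) *\<^sub>R A w = r *\<^sub>R g' s" for r
        using inS[OF s] by (simp add: g'_def linear_cmul[OF lin] scaleR_diff_right)
      ultimately have "(g has_derivative (\<lambda>r. r *\<^sub>R g' s)) (at s)" by simp
      then show ?thesis by (rule has_derivative_at_withinI)
    qed
    have bd: "onorm (\<lambda>r. r *\<^sub>R g' s) \<le> 2 * \<eta> * (t * M)" if s: "s \<in> {0..t}" for s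
    proof (rule onorm_bound)
      show "0 \<le> 2 * \<eta> * (t * M)" using \<eta> t M by simp
      let ?a = "s *\<^sub>R v + t *\<^sub>R w" and ?b = "s *\<^sub>R v"
      have 1: "norm (f' (x + ?a) v - f' x v - A ?a) \<le> \<eta> * norm ?a"
        using \<delta>(2)[of "x + ?a"] n1[OF s] tM by simp
      have 2: "norm (f' (x + ?b) v - f' x v - A ?b) \<le> \<eta> * norm ?b"
        using \<delta>(2)[of "x + ?b"] n1[OF s] tM by simp
      have "g' s = (f' (x + ?a) v - f' x v - A ?a) - (f' (x + ?b) v - f' x v - A ?b)"
        by (simp add: g'_def linear_add[OF bounded_linear.linear[OF blA]]
            linear_cmul[OF bounded_linear.linear[OF blA]] add.assoc)
      then have "norm (g' s) \<le> \<eta> * norm ?a + \<eta> * norm ?b"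
        using 1 2 norm_triangle_ineq4[of "f' (x + ?a) v - f' x v - A ?a" "f' (x + ?b) v - f' x v - A ?b"] by simp
      also have "\<dots> \<le> \<eta> * (t * M) + \<eta> * (t * M)"
        using n1[OF s] \<eta> by (intro add_mono mult_left_mono) auto
      also have "\<dots> = 2 * \<eta> * (t * M)" by simp
      finally have "norm (g' s) \<le> 2 * \<eta> * (t * M)" .
      then show "norm (r *\<^sub>R g' s) \<le> 2 * \<eta> * (t * M) * norm r" for r
        by (simp add: mult.commute mult_left_mono)
    qed
    have "norm (g t - g 0) \<le> 2 * \<eta> * (t * M) * norm (t - 0)"
      by (rule differentiable_bound[OF _ dg bd]) (use t in auto)
    also have "\<dots> = e * (t * t)" using t M by (simp add: \<eta>_def)
    finally show ?thesis by (simp add: g_def algebra_simps)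
  qed
  show ?thesis using d main by blast
qed

text \<open>The second difference is symmetric in \<open>v\<close> and \<open>w\<close>, and divided
  by \<open>t * t\<close> it tends to \<open>A w\<close> as well as to \<open>B v\<close>.\<close>

lemma second_derivative_symmetric:
  fixes f :: "'a::real_normed_vector \<Rightarrow> 'b::real_normed_vector"
  assumes S: "open S" "x \<in> S" and f': "\<And>y. y \<in> S \<Longrightarrow> (f has_derivative f' y) (at y)"
    and A: "((\<lambda>y. f' y v) has_derivative A) (at x)" and B: "((\<lambda>y. f' y w) has_derivative B) (at x)"
  shows "A w = B v"
proof -
  have "norm (A w - B v) \<le> e" if e: "e > 0" for e
  proof -
    have e2: "e / 2 > 0" using e by simp
    obtain d1 where d1: "d1 > 0" "\<And>t. 0 < t \<Longrightarrow> t < d1 \<Longrightarrow>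
      norm (f (x + t *\<^sub>R v + t *\<^sub>R w) - f (x + t *\<^sub>R v) - f (x + t *\<^sub>R w) + f x - (t * t) *\<^sub>R A w) \<le> (e/2) * (t * t)"
      using second_difference_estimate[OF S f' A e2, of w] by meson
    obtain d2 where d2: "d2 > 0" "\<And>t. 0 < t \<Longrightarrow> t < d2 \<Longrightarrow>
      norm (f (x + t *\<^sub>R w + t *\<^sub>R v) - f (x + t *\<^sub>R w) - f (x + t *\<^sub>R v) + f x - (t * t) *\<^sub>R B v) \<le> (e/2) * (t * t)"
      using second_difference_estimate[OF S f' B e2, of v] by meson
    define t where "t = min d1 d2 / 2"
    have t: "0 < t" "t < d1" "t < d2" using d1(1) d2(1) by (auto simp: t_def)
    let ?D = "f (x + t *\<^sub>R v + t *\<^sub>R w) - f (x + t *\<^sub>R v) - f (x + t *\<^sub>R w) + f x"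
    have eqD: "f (x + t *\<^sub>R w + t *\<^sub>R v) - f (x + t *\<^sub>R w) - f (x + t *\<^sub>R v) + f x = ?D"
      by (simp add: algebra_simps)
    have "(t * t) *\<^sub>R (A w - B v) = (?D - (t * t) *\<^sub>R B v) - (?D - (t * t) *\<^sub>R A w)"
      by (simp add: scaleR_diff_right)
    then have "norm ((t * t) *\<^sub>R (A w - B v)) \<le> norm (?D - (t * t) *\<^sub>R B v) + norm (?D - (t * t) *\<^sub>R A w)"
      by (metis norm_triangle_ineq4)
    also have "\<dots> \<le> (e/2) * (t * t) + (e/2) * (t * t)"
      using d1(2)[OF t(1,2)] d2(2)[OF t(1,3)] unfolding eqD by (intro add_mono)
    finally have "(t * t) * norm (A w - B v) \<le> (t * t) * e" using t by (simp add: mult.commute)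
    then show ?thesis using t by simp
  qed
  then have "norm (A w - B v) \<le> 0" by (rule field_le_epsilon[of _ 0, simplified])
  then show ?thesis by simp
qed

lemma Ck_on_second_derivative_symmetric:
  fixes f :: "'a::real_normed_vector \<Rightarrow> 'b::real_normed_vector"
  assumes "open S" "x \<in> S" "Ck_on (Suc (Suc k)) S f"
  shows "frechet_derivative (\<lambda>y. frechet_derivative f (at y) v) (at x) w =
    frechet_derivative (\<lambda>y. frechet_derivative f (at y) w) (at x) v"
  by (rule second_derivative_symmetric[OF assms(1,2) Ck_on_Suc_D[OF assms(3)]
        Ck_on_Suc_D[OF Ck_on_Suc_D2[OF assms(3)] assms(2)] Ck_on_Suc_D[OF Ck_on_Suc_D2[OF assms(3)] assms(2)]])

text \<open>The family \<open>flat n\<close> is closed under differentiation up to linear combinations, and \<open>flat 0\<close> is the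
  standard smooth function that is flat at the origin.\<close>

definition flat :: "nat \<Rightarrow> real \<Rightarrow> real"
  where "flat n x = (if x > 0 then exp (- inverse x) * inverse x ^ n else 0)"

lemma flat_tendsto_0: "(flat n \<longlongrightarrow> 0) (at 0)"
  unfolding filterlim_at_split
proof
  show "(flat n \<longlongrightarrow> 0) (at_left 0)"
    by (rule tendsto_eventually) (auto simp: eventually_at_left_field flat_def intro!: exI[of _ "-1"])
  have "((\<lambda>x. inverse x ^ n / exp (inverse x)) \<longlongrightarrow> (0::real)) (at_right 0)"
    by (rule filterlim_compose[OF tendsto_power_div_exp_0 filterlim_inverse_at_top_right])
  then show "(flat n \<longlongrightarrow> 0) (at_right 0)"
    by (rule Lim_transform_eventually)
      (auto simp: eventually_at_right_field flat_def exp_minus field_simps intro!: exI[of _ 1])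
qed

lemma flat_has_derivative: "(flat n has_real_derivative flat (n + 2) x - n * flat (n + 1) x) (at x)"
proof -
  consider "x > 0" | "x < 0" | "x = 0" by linarith
  then show ?thesis
  proof cases
    case 1
    have "((\<lambda>x. exp (- inverse x) * inverse x ^ n) has_real_derivative flat (n + 2) x - n * flat (n + 1) x) (at x)"
    proof (cases n)
      case 0
      show ?thesis using 1 unfolding flat_def 0
        by (auto intro!: derivative_eq_intros simp: field_simps power2_eq_square)
    next
      case (Suc m)
      have inv: "(inverse has_real_derivative - (inverse x * inverse x)) (at x)"
        using DERIV_inverse'[OF DERIV_ident, of x UNIV] 1 by simp
      have ex: "((\<lambda>x. exp (- inverse x)) has_real_derivative exp (- inverse x) * (inverse x * inverse x)) (at x)"
        using DERIV_fun_exp[OF DERIV_minus[OF inv]] by simp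
      have "((\<lambda>x. exp (- inverse x) * inverse x ^ Suc m) has_real_derivative
          exp (- inverse x) * (inverse x * inverse x) * inverse x ^ Suc m +
          (1 + real m) * (- (inverse x * inverse x) * inverse x ^ m) * exp (- inverse x)) (at x)"
        by (rule DERIV_mult[OF ex DERIV_power_Suc[OF inv, of m]])
      then show ?thesis using 1 unfolding Suc
        by (simp add: flat_def algebra_simps)
    qed
    then show ?thesis
      by (rule has_field_derivative_transform_within_open[where S="{0<..}"]) (use 1 in \<open>auto simp: flat_def\<close>)
  next
    case 2
    have "((\<lambda>x. 0) has_real_derivative flat (n + 2) x - n * flat (n + 1) x) (at x)"
      using 2 by (simp add: flat_def)
    then show ?thesis
      by (rule has_field_derivative_transform_within_open[where S="{..<0}"]) (use 2 in \<open>auto simp: flat_def\<close>)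
  next
    case 3
    \<comment> \<open>For \<open>h\<close> other than 0 the difference quotient at 0 is
      \<open>flat (n + 1) h\<close>.\<close>
    have "((\<lambda>h. (flat n (0 + h) - flat n 0) / h) \<longlongrightarrow> 0) (at 0)"
      by (rule Lim_transform_eventually[OF flat_tendsto_0[of "n + 1"]])
        (auto simp: eventually_at_filter flat_def field_simps)
    then show ?thesis unfolding 3 DERIV_def by (simp add: flat_def)
  qed
qed

lemma Ck_on_flat: "Ck_on k UNIV (flat n)"
proof (induction k arbitrary: n)
  case 0
  then show ?case
    unfolding Ck_on.simps
    by (intro continuous_at_imp_continuous_on ballI DERIV_isCont[OF flat_has_derivative])
next
  case (Suc k)
  show ?case
  proof (rule Ck_on_Suc_I)
    show "(flat n has_derivative (*) (flat (n + 2) x - n * flat (n + 1) x)) (at x)" for x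
      using flat_has_derivative unfolding has_field_derivative_def .
    have "Ck_on k UNIV (\<lambda>x. v *\<^sub>R (flat (n + 2) x + (- real n) *\<^sub>R flat (n + 1) x))" for v
      by (intro Ck_on_bounded_linear[OF bounded_linear_scaleR_right] Ck_on_add Suc.IH open_UNIV)
    then show "Ck_on k UNIV (\<lambda>x. (flat (n + 2) x - n * flat (n + 1) x) * v)" for v
      by (simp add: algebra_simps)
  qed simp
qed

lemma bump_function_exists:
  fixes y0 :: "'a::euclidean_space"
  assumes "r > 0"
  shows "\<exists>\<beta>::'a \<Rightarrow> real. smooth_on UNIV \<beta> \<and> \<beta> y0 = 1 \<and> (\<forall>y. y \<notin> ball y0 r \<longrightarrow> \<beta> y = 0)"
proof -
  \<comment> \<open>The squared distance keeps the argument polynomial, hence smooth also at the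
    centre; the first factor normalizes the value there to 1.\<close>
  define \<beta> where "\<beta> y = inverse (flat 0 (r^2)) *\<^sub>R flat 0 (r^2 + (-1) *\<^sub>R ((y + - y0) \<bullet> (y + - y0)))" for y
  have "Ck_on k UNIV \<beta>" for k
    unfolding \<beta>_def
    by (intro Ck_on_bounded_linear[OF bounded_linear_scaleR_right] open_UNIV Ck_on_compose[OF _ _ _ Ck_on_flat]
        Ck_on_add Ck_on_const Ck_on_bilinear[OF bounded_bilinear_inner] Ck_on_id) auto
  moreover have "\<beta> y0 = 1" using assms by (simp add: \<beta>_def flat_def)
  moreover have "\<beta> y = 0" if "y \<notin> ball y0 r" for y
  proof -
    have "r \<le> norm (y - y0)" using that by (simp add: dist_norm norm_minus_commute)
    then have "r^2 \<le> norm (y - y0) ^ 2" using assms by (intro power_mono) auto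
    then show ?thesis by (simp add: \<beta>_def flat_def power2_norm_eq_inner)
  qed
  ultimately show ?thesis unfolding smooth_on_def by (intro exI[of _ \<beta>]) auto
qed

section \<open>Total differential equations\<close>

text \<open>Picard iteration for the total differential equation \<open>Du = G(u)\<close>. If the vector fields
  \<open>y \<mapsto> G y v\<close> commute, the defects \<open>Du\<^sub>n - G(u\<^sub>n)\<close> of the iterates tend to \<open>0\<close>
  uniformly, so no theory of ordinary differential equations is needed.\<close>

primrec picard :: "('a::euclidean_space \<Rightarrow> 'a \<Rightarrow>\<^sub>L 'a) \<Rightarrow> 'a \<Rightarrow> nat \<Rightarrow> 'a \<Rightarrow> 'a"
  where
    "picard G y0 0 x = y0"
  | "picard G y0 (Suc n) x = y0 + integral (cbox 0 1) (\<lambda>t. G (picard G y0 n (t *\<^sub>R x)) x)"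

text \<open>The derivative in \<open>x\<close> of the integrand
  \<open>G (u (t *\<^sub>R x)) x\<close>, with \<open>u'\<close> that of \<open>u\<close>: the first
  term comes from the outer \<open>x\<close>, the second from the inner one, with the factor
  \<open>t\<close> of the chain rule. It is formed in the operator space so that it can be
  integrated there.\<close>

definition picard_integrand ::
    "('a::euclidean_space \<Rightarrow> 'a \<Rightarrow>\<^sub>L 'a) \<Rightarrow> ('a \<Rightarrow> 'a \<Rightarrow>\<^sub>L ('a \<Rightarrow>\<^sub>L 'a)) \<Rightarrow>
     ('a \<Rightarrow> 'a) \<Rightarrow> ('a \<Rightarrow> 'a \<Rightarrow>\<^sub>L 'a) \<Rightarrow> 'a \<Rightarrow> real \<Rightarrow> 'a \<Rightarrow>\<^sub>L 'a"
  where "picard_integrand G G' u u' x t =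
    G (u (t *\<^sub>R x)) + t *\<^sub>R ((blinfun.prod_left x o\<^sub>L G' (u (t *\<^sub>R x))) o\<^sub>L u' (t *\<^sub>R x))"

primrec picard_deriv ::
    "('a::euclidean_space \<Rightarrow> 'a \<Rightarrow>\<^sub>L 'a) \<Rightarrow> ('a \<Rightarrow> 'a \<Rightarrow>\<^sub>L ('a \<Rightarrow>\<^sub>L 'a)) \<Rightarrow> 'a \<Rightarrow> nat \<Rightarrow> 'a \<Rightarrow> 'a \<Rightarrow>\<^sub>L 'a"
  where
    "picard_deriv G G' y0 0 x = 0"
  | "picard_deriv G G' y0 (Suc n) x = integral (cbox 0 1)
       (picard_integrand G G' (picard G y0 n) (picard_deriv G G' y0 n) x)"

lemma frobenius_solution:
  fixes G :: "'a::euclidean_space \<Rightarrow> 'a \<Rightarrow>\<^sub>L 'a" and G' :: "'a \<Rightarrow> 'a \<Rightarrow>\<^sub>L ('a \<Rightarrow>\<^sub>L 'a)"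
  assumes S: "open S" "y0 \<in> S"
    and G': "\<And>y. y \<in> S \<Longrightarrow> (G has_derivative G' y) (at y)"
    and contG': "continuous_on S G'"
    and sym: "\<And>y v w. y \<in> S \<Longrightarrow> G' y (G y v) w = G' y (G y w) v"
  shows "\<exists>r u. r > 0 \<and> u 0 = y0 \<and> (\<forall>x\<in>ball 0 r. u x \<in> S \<and> (u has_derivative G (u x)) (at x))"
proof -
  obtain R where R: "R > 0" "cball y0 R \<subseteq> S" using S open_contains_cball by meson
  have contG: "continuous_on S G"
    using G' has_derivative_continuous continuous_at_imp_continuous_on by metis
  have "bounded (G ` cball y0 R)" "bounded (G' ` cball y0 R)"
    using compact_continuous_image[OF continuous_on_subset[OF contG R(2)]]
      compact_continuous_image[OF continuous_on_subset[OF contG' R(2)]] compact_imp_bounded by auto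
  then obtain K1 K2 where K1: "\<And>y. y \<in> cball y0 R \<Longrightarrow> norm (G y) \<le> K1"
    and K2: "\<And>y. y \<in> cball y0 R \<Longrightarrow> norm (G' y) \<le> K2"
    unfolding bounded_iff by blast
  define K where "K = max 1 (max K1 K2)"
  have K: "K \<ge> 1" "\<And>y. y \<in> cball y0 R \<Longrightarrow> norm (G y) \<le> K" "\<And>y. y \<in> cball y0 R \<Longrightarrow> norm (G' y) \<le> K"
    using K1 K2 by (auto simp: K_def intro: le_max_iff_disj[THEN iffD2])
  have lip: "norm (G a - G b) \<le> K * norm (a - b)" if "a \<in> cball y0 R" "b \<in> cball y0 R" for a b
  proof (rule differentiable_bound[where S="cball y0 R"])
    show "(G has_derivative G' y) (at y within cball y0 R)" if "y \<in> cball y0 R" for y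
      using G' R(2) that has_derivative_at_withinI by blast
    show "onorm (blinfun_apply (G' y)) \<le> K" if "y \<in> cball y0 R" for y
      using K(3)[OF that] by (simp add: norm_blinfun.rep_eq)
  qed (use that in auto)
  \<comment> \<open>The bound \<open>R / K\<close> keeps all iterates in \<open>cball y0 R\<close>.
    The bound \<open>1 / (4 * K)\<close> makes \<open>r * K\<close> at most 1/4, enough to halve at
    each iteration both the bound on the steps and the old part of the defect.\<close>
  define r where "r = min (1 / (4 * K)) (R / K)"
  have r: "r > 0" "r * K \<le> 1 / 4" "r * K \<le> R"
  proof -
    show "r > 0" using K(1) R(1) by (simp add: r_def)
    have "r \<le> 1 / (4 * K)" "r \<le> R / K" by (auto simp: r_def)
    then show "r * K \<le> 1 / 4" "r * K \<le> R"
      using K(1) by (auto simp: pos_le_divide_eq field_simps)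
  qed
  define B where "B = ball (0::'a) r"
  have B: "open B" "convex B" "0 \<in> B" using r(1) by (auto simp: B_def)
  have scale: "t *\<^sub>R x \<in> B" if "x \<in> B" "t \<in> {0..1}" for x t
  proof -
    have "norm (t *\<^sub>R x) \<le> norm x" using that by (simp add: mult_left_le_one_le)
    then show ?thesis using that(1) by (simp add: B_def)
  qed
  define u where "u = picard G y0"
  define u' where "u' = picard_deriv G G' y0"
  define F where "F n = picard_integrand G G' (u n) (u' n)" for n
  have u0: "u 0 x = y0" and uS: "u (Suc n) x = y0 + integral (cbox 0 1) (\<lambda>t. G (u n (t *\<^sub>R x)) x)" for n x
    by (simp_all add: u_def)
  have u'0: "u' 0 x = 0" and u'S: "u' (Suc n) x = integral (cbox 0 1) (F n x)" for n x
    by (simp_all add: u'_def u_def F_def)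
  have Fapp: "F n x t v = G (u n (t *\<^sub>R x)) v + t *\<^sub>R G' (u n (t *\<^sub>R x)) (u' n (t *\<^sub>R x) v) x" for n x t v
    by (simp add: F_def picard_integrand_def blinfun.add_left blinfun.scaleR_left)

  have contF: "continuous_on (B \<times> cbox 0 1) (\<lambda>(x, t). F n x t)"
    if un: "\<And>x. x \<in> B \<Longrightarrow> u n x \<in> cball y0 R" and du: "\<And>x. x \<in> B \<Longrightarrow> (u n has_derivative u' n x) (at x)"
      and cu': "continuous_on B (u' n)" for n
  proof -
    have cu: "continuous_on B (u n)"
      using du has_derivative_continuous continuous_at_imp_continuous_on by metis
    have sc: "continuous_on (B \<times> cbox 0 1) (\<lambda>p. snd p *\<^sub>R fst p)" "\<And>p. p \<in> B \<times> cbox 0 1 \<Longrightarrow> snd p *\<^sub>R fst p \<in> B"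
      using scale by (auto intro!: continuous_intros)
    have c1: "continuous_on (B \<times> cbox 0 1) (\<lambda>p. u n (snd p *\<^sub>R fst p))"
      by (rule continuous_on_compose2[OF cu sc(1)]) (use sc(2) in blast)
    have m1: "(\<lambda>p. u n (snd p *\<^sub>R fst p)) ` (B \<times> cbox 0 1) \<subseteq> S"
      using sc(2) un R(2) by blast
    have c2: "continuous_on (B \<times> cbox 0 1) (\<lambda>p. G (u n (snd p *\<^sub>R fst p)))"
      by (rule continuous_on_compose2[OF contG c1 m1])
    have c3: "continuous_on (B \<times> cbox 0 1) (\<lambda>p. G' (u n (snd p *\<^sub>R fst p)))"
      by (rule continuous_on_compose2[OF contG' c1 m1])
    have c4: "continuous_on (B \<times> cbox 0 1) (\<lambda>p. u' n (snd p *\<^sub>R fst p))"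
      by (rule continuous_on_compose2[OF cu' sc(1)]) (use sc(2) in blast)
    show ?thesis unfolding F_def picard_integrand_def split_beta
      by (intro continuous_on_add continuous_on_scaleR continuous_on_snd continuous_on_id c2
          bounded_bilinear.continuous_on[OF bounded_bilinear_blinfun_compose] c3 c4
          bounded_linear.continuous_on[OF blinfun.bounded_linear_prod_left] continuous_on_fst)
  qed
  have contGu: "continuous_on (cbox 0 1) (\<lambda>t. G (u n (t *\<^sub>R x)) v)"
    if un: "\<And>x. x \<in> B \<Longrightarrow> u n x \<in> cball y0 R" and cu: "continuous_on B (u n)" and x: "x \<in> B" for n x v
  proof -
    have sc: "continuous_on (cbox 0 1) (\<lambda>t. t *\<^sub>R x)" "(\<lambda>t. t *\<^sub>R x) ` cbox 0 1 \<subseteq> B"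
      using scale[OF x] by (auto intro!: continuous_intros)
    have c1: "continuous_on (cbox 0 1) (\<lambda>t. u n (t *\<^sub>R x))"
      by (rule continuous_on_compose2[OF cu sc])
    have "continuous_on (cbox 0 1) (\<lambda>t. G (u n (t *\<^sub>R x)))"
      by (rule continuous_on_compose2[OF contG c1]) (use sc(2) un R(2) in blast)
    then show ?thesis
      by (intro bounded_bilinear.continuous_on[OF bounded_bilinear_blinfun_apply] continuous_on_const)
  qed
  \<comment> \<open>The next iterate is differentiated under the integral sign, which requires joint
    continuity of \<open>F n\<close>; so continuity of \<open>u' n\<close> is carried along in the
    induction.\<close>
  have inv: "(\<forall>x\<in>B. u n x \<in> cball y0 R) \<and> (\<forall>x\<in>B. (u n has_derivative u' n x) (at x)) \<and> continuous_on B (u' n)" for n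
  proof (induction n)
    case 0
    have "u 0 = (\<lambda>x. y0)" "u' 0 = (\<lambda>x. 0)" by (auto simp: u0 u'0)
    then show ?case using R(1) by simp
  next
    case (Suc n)
    then have un: "\<And>x. x \<in> B \<Longrightarrow> u n x \<in> cball y0 R" and du: "\<And>x. x \<in> B \<Longrightarrow> (u n has_derivative u' n x) (at x)"
      and cu': "continuous_on B (u' n)" by auto
    note cF = contF[OF un du cu']
    have cu: "continuous_on B (u n)"
      using du has_derivative_continuous continuous_at_imp_continuous_on by metis
    have intG: "(\<lambda>t. G (u n (t *\<^sub>R x)) x) integrable_on cbox 0 1" if x: "x \<in> B" for x
      by (rule integrable_continuous[OF contGu[OF un cu x]])
    have 1: "u (Suc n) x \<in> cball y0 R" if x: "x \<in> B" for x
    proof -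
      have "norm (integral (cbox 0 1) (\<lambda>t. G (u n (t *\<^sub>R x)) x)) \<le> (K * r) * measure lborel (cbox 0 (1::real))"
      proof (rule integrable_bound[OF _ intG[OF x]])
        fix t :: real assume t: "t \<in> cbox 0 1"
        have "norm (G (u n (t *\<^sub>R x)) x) \<le> norm (G (u n (t *\<^sub>R x))) * norm x" by (rule norm_blinfun)
        also have "\<dots> \<le> K * r"
          using K(2)[OF un[OF scale[OF x, of t]]] t x K(1) by (intro mult_mono) (auto simp: B_def)
        finally show "norm (G (u n (t *\<^sub>R x)) x) \<le> K * r" .
      qed (use K(1) r(1) in auto)
      then show ?thesis using r(3) by (simp add: uS dist_norm mult.commute)
    qed
    have 2: "(u (Suc n) has_derivative u' (Suc n) x) (at x)" if x: "x \<in> B" for x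
    proof -
      have fx: "((\<lambda>x. G (u n (t *\<^sub>R x)) x) has_derivative blinfun_apply (F n x t)) (at x within B)"
        if x: "x \<in> B" and t: "t \<in> cbox 0 1" for x t
      proof -
        have tx: "t *\<^sub>R x \<in> B" using scale[OF x] t by simp
        have "((\<lambda>x. u n (t *\<^sub>R x)) has_derivative (\<lambda>v. u' n (t *\<^sub>R x) (t *\<^sub>R v))) (at x)"
          by (rule has_derivative_compose[where f="\<lambda>x. t *\<^sub>R x" and g="u n", OF _ du[OF tx]])
            (auto intro!: derivative_eq_intros)
        then have "((\<lambda>x. G (u n (t *\<^sub>R x))) has_derivative (\<lambda>v. G' (u n (t *\<^sub>R x)) (u' n (t *\<^sub>R x) (t *\<^sub>R v)))) (at x)"
          by (rule has_derivative_compose[where g=G and f="\<lambda>x. u n (t *\<^sub>R x)", OF _ G'[OF subsetD[OF R(2) un[OF tx]]]])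
        then have "((\<lambda>x. G (u n (t *\<^sub>R x)) x) has_derivative
            (\<lambda>v. G (u n (t *\<^sub>R x)) v + G' (u n (t *\<^sub>R x)) (u' n (t *\<^sub>R x) (t *\<^sub>R v)) x)) (at x)"
          by (rule bounded_bilinear.FDERIV[OF bounded_bilinear_blinfun_apply _ has_derivative_ident])
        then have "((\<lambda>x. G (u n (t *\<^sub>R x)) x) has_derivative blinfun_apply (F n x t)) (at x)"
          by (simp add: Fapp[abs_def] blinfun.scaleR_right blinfun.scaleR_left)
        then show ?thesis by (rule has_derivative_at_withinI)
      qed
      have "((\<lambda>x. integral (cbox 0 1) (\<lambda>t. G (u n (t *\<^sub>R x)) x)) has_derivative integral (cbox 0 1) (F n x)) (at x within B)"
        by (rule leibniz_rule[OF fx intG cF x B(2)])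
      then have "((\<lambda>x. y0 + integral (cbox 0 1) (\<lambda>t. G (u n (t *\<^sub>R x)) x)) has_derivative integral (cbox 0 1) (F n x)) (at x within B)"
        using has_derivative_add[OF has_derivative_const] by fastforce
      then show ?thesis
        unfolding at_within_open[OF x B(1)] u'S uS[abs_def] .
    qed
    have 3: "continuous_on B (u' (Suc n))"
      using integral_continuous_on_param[OF cF] by (simp add: u'S[abs_def])
    show ?case using 1 2 3 by blast
  qed
  then have un: "\<And>n x. x \<in> B \<Longrightarrow> u n x \<in> cball y0 R" and du: "\<And>n x. x \<in> B \<Longrightarrow> (u n has_derivative u' n x) (at x)"
    and cu': "\<And>n. continuous_on B (u' n)" by blast+
  have cF1: "continuous_on (cbox 0 1) (F n x)" if x: "x \<in> B" for n x
    by (rule continuous_on_compose2[OF contF[OF un du cu'], where f="\<lambda>t. (x, t)", simplified])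
      (use x in \<open>auto intro!: continuous_intros\<close>)
  have intF: "F n x integrable_on cbox 0 1" if "x \<in> B" for n x
    by (rule integrable_continuous[OF cF1[OF that]])
  have cGu: "continuous_on (cbox 0 1) (\<lambda>t. G (u n (t *\<^sub>R x)) v)" if x: "x \<in> B" for n x v
    using contGu[OF un _ x] du has_derivative_continuous continuous_at_imp_continuous_on by metis
  have step: "norm (u (Suc n) x - u n x) \<le> R / 2 ^ n" if "x \<in> B" for n x
    using that
  proof (induction n arbitrary: x)
    case 0
    then show ?case using un[of x "Suc 0"] by (simp add: u0 dist_norm norm_minus_commute)
  next
    case (Suc n)
    have "u (Suc (Suc n)) x - u (Suc n) x =
        integral (cbox 0 1) (\<lambda>t. G (u (Suc n) (t *\<^sub>R x)) x - G (u n (t *\<^sub>R x)) x)"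
      unfolding uS[of "Suc n"] uS[of n x]
      using integral_diff[OF integrable_continuous[OF cGu[OF Suc.prems, of "Suc n" x]]
          integrable_continuous[OF cGu[OF Suc.prems, of n x]]] by simp
    also have "norm \<dots> \<le> (K * (R / 2 ^ n) * r) * measure lborel (cbox 0 (1::real))"
    proof (rule integrable_bound)
      show "(\<lambda>t. G (u (Suc n) (t *\<^sub>R x)) x - G (u n (t *\<^sub>R x)) x) integrable_on cbox 0 1"
        by (intro integrable_diff integrable_continuous cGu Suc.prems)
      fix t :: real assume t: "t \<in> cbox 0 1"
      have tx: "t *\<^sub>R x \<in> B" using scale[OF Suc.prems] t by simp
      have "norm (G (u (Suc n) (t *\<^sub>R x)) x - G (u n (t *\<^sub>R x)) x)
          \<le> norm (G (u (Suc n) (t *\<^sub>R x)) - G (u n (t *\<^sub>R x))) * norm x"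
        by (metis blinfun.diff_left norm_blinfun)
      also have "\<dots> \<le> (K * (R / 2 ^ n)) * r"
      proof (rule mult_mono)
        have "norm (G (u (Suc n) (t *\<^sub>R x)) - G (u n (t *\<^sub>R x))) \<le> K * norm (u (Suc n) (t *\<^sub>R x) - u n (t *\<^sub>R x))"
          by (rule lip[OF un[OF tx] un[OF tx]])
        also have "\<dots> \<le> K * (R / 2 ^ n)"
          using Suc.IH[OF tx] K(1) by (intro mult_left_mono) auto
        finally show "norm (G (u (Suc n) (t *\<^sub>R x)) - G (u n (t *\<^sub>R x))) \<le> K * (R / 2 ^ n)" .
      qed (use Suc.prems K(1) R(1) in \<open>auto simp: B_def\<close>)
      finally show "norm (G (u (Suc n) (t *\<^sub>R x)) x - G (u n (t *\<^sub>R x)) x) \<le> K * (R / 2 ^ n) * r" .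
    qed (use K(1) R(1) r(1) in auto)
    also have "\<dots> = (r * K) * (R / 2 ^ n)" by simp
    also have "\<dots> \<le> (1 / 2) * (R / 2 ^ n)"
      using r(2) R(1) by (intro mult_right_mono) auto
    finally show ?case by simp
  qed
  \<comment> \<open>The solution of \<open>a (Suc n) = a n / 2 + K * (R / 2 ^ n)\<close> with
    \<open>a 0 = K\<close>: half the old defect plus the change of \<open>G\<close> along one
    step.\<close>
  define a where "a n = (K + 2 * real n * K * R) / 2 ^ n" for n
  have a0: "a n \<ge> 0" for n using K(1) R(1) by (simp add: a_def)
  have defect: "norm (u' n x - G (u n x)) \<le> a n" if "x \<in> B" for n x
    using that
  proof (induction n arbitrary: x)
    case 0
    show ?case using K(2)[OF un[OF 0, of 0]] by (simp add: u'0 a_def)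
  next
    case (Suc n)
    note x = Suc.prems
    have "norm (u' (Suc n) x - G (u n x)) \<le> a n / 2"
    proof (rule norm_blinfun_bound)
      fix v
      \<comment> \<open>\<open>?h\<close> is the derivative of
        \<open>\<lambda>t. t *\<^sub>R G (u n (t *\<^sub>R x)) v\<close>, so its integral is
        \<open>G (u n x) v\<close>. This puts the value to be compared with
        \<open>u' (Suc n) x v\<close> under an integral over the same interval.\<close>
      let ?h = "\<lambda>t. G (u n (t *\<^sub>R x)) v + t *\<^sub>R G' (u n (t *\<^sub>R x)) (u' n (t *\<^sub>R x) x) v"
      have "(?h has_integral ((\<lambda>t. t *\<^sub>R G (u n (t *\<^sub>R x)) v) 1 - (\<lambda>t. t *\<^sub>R G (u n (t *\<^sub>R x)) v) 0)) {0..1}"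
      proof (rule fundamental_theorem_of_calculus)
        fix t :: real assume t: "t \<in> {0..1}"
        have tx: "t *\<^sub>R x \<in> B" using scale[OF x t] .
        have "((\<lambda>t. u n (t *\<^sub>R x)) has_derivative (\<lambda>s. u' n (t *\<^sub>R x) (s *\<^sub>R x))) (at t)"
          by (rule has_derivative_compose[where f="\<lambda>t. t *\<^sub>R x" and g="u n", OF _ du[OF tx]])
            (auto intro!: derivative_eq_intros)
        then have "((\<lambda>t. G (u n (t *\<^sub>R x))) has_derivative (\<lambda>s. G' (u n (t *\<^sub>R x)) (u' n (t *\<^sub>R x) (s *\<^sub>R x)))) (at t)"
          by (rule has_derivative_compose[where g=G and f="\<lambda>t. u n (t *\<^sub>R x)", OF _ G'[OF subsetD[OF R(2) un[OF tx]]]])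
        then have "((\<lambda>t. G (u n (t *\<^sub>R x)) v) has_derivative (\<lambda>s. G' (u n (t *\<^sub>R x)) (u' n (t *\<^sub>R x) (s *\<^sub>R x)) v)) (at t)"
          using bounded_bilinear.FDERIV[OF bounded_bilinear_blinfun_apply _ has_derivative_const, of _ _ t UNIV v] by simp
        then have "((\<lambda>t. t *\<^sub>R G (u n (t *\<^sub>R x)) v) has_derivative
            (\<lambda>s. t *\<^sub>R G' (u n (t *\<^sub>R x)) (u' n (t *\<^sub>R x) (s *\<^sub>R x)) v + s *\<^sub>R G (u n (t *\<^sub>R x)) v)) (at t)"
          by (rule has_derivative_scaleR[OF has_derivative_ident])
        then have "((\<lambda>t. t *\<^sub>R G (u n (t *\<^sub>R x)) v) has_vector_derivative ?h t) (at t)"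
          unfolding has_vector_derivative_def
          by (simp add: blinfun.scaleR_right blinfun.scaleR_left scaleR_add_right add.commute mult.commute)
        then show "((\<lambda>t. t *\<^sub>R G (u n (t *\<^sub>R x)) v) has_vector_derivative ?h t) (at t within {0..1})"
          by (rule has_vector_derivative_at_within)
      qed simp
      then have h: "(?h has_integral G (u n x) v) (cbox 0 1)" by simp
      have Fi: "((\<lambda>t. F n x t v) has_integral u' (Suc n) x v) (cbox 0 1)"
        unfolding u'S blinfun_apply_integral[OF intF[OF x]]
        by (rule integrable_integral[OF integrable_continuous],
            intro bounded_bilinear.continuous_on[OF bounded_bilinear_blinfun_apply] continuous_on_const cF1 x)
      have "norm (u' (Suc n) x v - G (u n x) v) \<le> (a n / 2 * norm v) * measure lborel (cbox 0 (1::real))"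
      proof (rule has_integral_bound[OF _ has_integral_diff[OF Fi h]])
        fix t :: real assume t: "t \<in> cbox 0 1"
        have tx: "t *\<^sub>R x \<in> B" using scale[OF x] t by simp
        let ?y = "u n (t *\<^sub>R x)"
        have yS: "?y \<in> S" using un[OF tx] R(2) by blast
        \<comment> \<open>Once the old defect \<open>E\<close> is split off, the terms with
          \<open>G\<close> in place of \<open>u' n\<close> cancel by \<open>sym\<close>; what
          remains is linear in \<open>E\<close>.\<close>
        define E where "E = u' n (t *\<^sub>R x) - G ?y"
        have nE: "norm E \<le> a n" unfolding E_def by (rule Suc.IH[OF tx])
        have u'E: "u' n (t *\<^sub>R x) w = E w + G ?y w" for w by (simp add: E_def blinfun.diff_left)
        have "F n x t v - ?h t = t *\<^sub>R (G' ?y (E v) x - G' ?y (E x) v)"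
          unfolding Fapp u'E by (simp add: blinfun.add_right blinfun.add_left scaleR_add_right
              scaleR_diff_right sym[OF yS, of v x])
        also have "norm \<dots> \<le> 1 * norm (G' ?y (E v) x - G' ?y (E x) v)"
          unfolding norm_scaleR using t by (intro mult_right_mono) auto
        also have "\<dots> \<le> norm (G' ?y (E v) x) + norm (G' ?y (E x) v)"
          using norm_triangle_ineq4 by simp
        also have "\<dots> \<le> K * (a n * norm v) * r + K * (a n * r) * norm v"
        proof (rule add_mono)
          have g: "norm (G' ?y (E p) q) \<le> K * (a n * norm p) * norm q" for p q
          proof -
            have "norm (G' ?y (E p) q) \<le> norm (G' ?y (E p)) * norm q" by (rule norm_blinfun)
            also have "\<dots> \<le> (K * (a n * norm p)) * norm q"
            proof (rule mult_right_mono)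
              have "norm (G' ?y (E p)) \<le> norm (G' ?y) * norm (E p)" by (rule norm_blinfun)
              also have "\<dots> \<le> K * norm (E p)"
                by (rule mult_right_mono[OF K(3)[OF un[OF tx, of n]] norm_ge_zero])
              also have "norm (E p) \<le> norm E * norm p" by (rule norm_blinfun)
              also have "norm E * norm p \<le> a n * norm p" by (rule mult_right_mono[OF nE norm_ge_zero])
              finally show "norm (G' ?y (E p)) \<le> K * (a n * norm p)" using K(1) by simp
            qed simp
            finally show ?thesis .
          qed
          have nx: "norm x \<le> r" using x by (simp add: B_def)
          show "norm (G' ?y (E v) x) \<le> K * (a n * norm v) * r"
            using order_trans[OF g[of v x] mult_left_mono[OF nx]] a0[of n] K(1) by simp
          have "K * (a n * norm x) * norm v \<le> K * (a n * r) * norm v"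
            using nx a0[of n] K(1) by (intro mult_right_mono mult_left_mono) auto
          with g[of x v] show "norm (G' ?y (E x) v) \<le> K * (a n * r) * norm v" by simp
        qed
        also have "\<dots> = 2 * (r * K) * (a n * norm v)" by simp
        also have "\<dots> \<le> (1 / 2) * (a n * norm v)"
          using r(2) a0[of n] by (intro mult_right_mono) auto
        finally show "norm (F n x t v - ?h t) \<le> a n / 2 * norm v" by simp
      qed (use a0[of n] in simp)
      then show "norm ((u' (Suc n) x - G (u n x)) v) \<le> a n / 2 * norm v"
        by (simp add: blinfun.diff_left)
    qed (use a0[of n] in simp)
    moreover have "norm (G (u (Suc n) x) - G (u n x)) \<le> K * (R / 2 ^ n)"
    proof -
      have "norm (G (u (Suc n) x) - G (u n x)) \<le> K * norm (u (Suc n) x - u n x)"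
        by (rule lip[OF un[OF x] un[OF x]])
      also have "\<dots> \<le> K * (R / 2 ^ n)" using step[OF x, of n] K(1) by (intro mult_left_mono) auto
      finally show ?thesis .
    qed
    moreover have "norm (u' (Suc n) x - G (u (Suc n) x)) \<le>
        norm (u' (Suc n) x - G (u n x)) + norm (G (u (Suc n) x) - G (u n x))"
      using norm_triangle_ineq4[of "u' (Suc n) x - G (u n x)" "G (u (Suc n) x) - G (u n x)"] by simp
    moreover have "a n / 2 + K * (R / 2 ^ n) = a (Suc n)"
      by (simp add: a_def field_simps)
    ultimately show ?case by simp
  qed
  have dist_iter: "norm (u (n + k) x - u n x) \<le> 2 * R / 2 ^ n" if x: "x \<in> B" for n k x
  proof -
    have "norm (u (n + k) x - u n x) \<le> 2 * R / 2 ^ n - 2 * R / 2 ^ (n + k)"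
    proof (induction k)
      case 0
      show ?case by simp
    next
      case (Suc k)
      have "norm (u (n + Suc k) x - u n x) \<le> norm (u (Suc (n + k)) x - u (n + k) x) + norm (u (n + k) x - u n x)"
        using norm_triangle_ineq[of "u (Suc (n + k)) x - u (n + k) x" "u (n + k) x - u n x"] by simp
      also have "\<dots> \<le> R / 2 ^ (n + k) + (2 * R / 2 ^ n - 2 * R / 2 ^ (n + k))"
        using step[OF x, of "n + k"] Suc.IH by simp
      finally show ?case by (simp add: field_simps)
    qed
    also have "\<dots> \<le> 2 * R / 2 ^ n" using R(1) by simp
    finally show ?thesis .
  qed
  have lim2: "(\<lambda>n. c / 2 ^ n) \<longlonglongrightarrow> (0::real)" for c
  proof -
    have "(\<lambda>n. c * (1 / 2) ^ n) \<longlonglongrightarrow> c * (0::real)"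
      by (intro tendsto_mult tendsto_const LIMSEQ_realpow_zero) auto
    then show ?thesis by (simp add: power_one_over)
  qed
  have conv: "convergent (\<lambda>n. u n x)" if x: "x \<in> B" for x
  proof -
    have "Cauchy (\<lambda>n. u n x)"
    proof (rule CauchyI')
      fix e :: real assume "e > 0"
      then have "\<forall>\<^sub>F n in sequentially. 2 * R / 2 ^ n < e"
        using order_tendstoD(2)[OF lim2] by blast
      then obtain N where N: "\<And>n. n \<ge> N \<Longrightarrow> 2 * R / 2 ^ n < e" unfolding eventually_sequentially by blast
      have "dist (u m x) (u n x) < e" if "m \<ge> N" "n > m" for m n
        using dist_iter[OF x, of m "n - m"] N[OF that(1)] that(2) by (simp add: dist_norm norm_minus_commute)
      then show "\<exists>M. \<forall>m\<ge>M. \<forall>n>m. dist (u m x) (u n x) < e" by blast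
    qed
    then show ?thesis by (simp add: Cauchy_convergent_iff)
  qed
  define U where "U x = lim (\<lambda>n. u n x)" for x
  have limU: "(\<lambda>n. u n x) \<longlonglongrightarrow> U x" if "x \<in> B" for x
    unfolding U_def using conv[OF that] convergent_LIMSEQ_iff by blast
  have UR: "U x \<in> cball y0 R" if "x \<in> B" for x
    using closed_sequentially[OF closed_cball _ limU[OF that]] un[OF that] by blast
  have distU: "norm (u n x - U x) \<le> 2 * R / 2 ^ n" if x: "x \<in> B" for n x
  proof (rule tendsto_upperbound)
    show "(\<lambda>k. norm (u n x - u (k + n) x)) \<longlonglongrightarrow> norm (u n x - U x)"
      by (intro tendsto_norm tendsto_diff tendsto_const LIMSEQ_ignore_initial_segment limU x)
    show "\<forall>\<^sub>F k in sequentially. norm (u n x - u (k + n) x) \<le> 2 * R / 2 ^ n"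
      using dist_iter[OF x, of n] by (simp add: norm_minus_commute add.commute)
  qed simp
  have lim_b: "(\<lambda>n. a n + K * (2 * R / 2 ^ n)) \<longlonglongrightarrow> 0"
  proof -
    have "(\<lambda>n. real n * (1 / 2) ^ n) \<longlonglongrightarrow> 0"
      by (rule powser_times_n_limit_0) simp
    from tendsto_add[OF tendsto_add[OF lim2[of K] tendsto_mult[OF tendsto_const[of "2 * K * R"] this]] lim2[of "K * (2 * R)"]]
    have "(\<lambda>n. K / 2 ^ n + (2 * K * R) * (real n * (1 / 2) ^ n) + K * (2 * R) / 2 ^ n) \<longlonglongrightarrow> 0" by simp
    moreover have "K / 2 ^ n + (2 * K * R) * (real n * (1 / 2) ^ n) + K * (2 * R) / 2 ^ n = a n + K * (2 * R / 2 ^ n)" for n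
      by (simp add: a_def add_divide_distrib power_one_over)
    ultimately show ?thesis by simp
  qed
  \<comment> \<open>The derivatives \<open>u' n\<close> converge uniformly to
    \<open>G (U x)\<close>, because the defect and the Lipschitz error of replacing
    \<open>u n\<close> by \<open>U\<close> both tend to 0.\<close>
  have "\<exists>g. \<forall>x\<in>B. (\<lambda>n. u n x) \<longlonglongrightarrow> g x \<and> (g has_derivative G (U x)) (at x within B)"
  proof (rule has_derivative_sequence[where f="u" and f'="\<lambda>n x. blinfun_apply (u' n x)"])
    show "convex B" "(0::'a) \<in> B" by (rule B)+
    show "(u n has_derivative u' n x) (at x within B)" if "x \<in> B" for n x
      using du[OF that] by (rule has_derivative_at_withinI)
    show "(\<lambda>n. u n 0) \<longlonglongrightarrow> U 0" by (rule limU[OF B(3)])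
    fix e :: real assume "e > 0"
    then have "\<forall>\<^sub>F n in sequentially. a n + K * (2 * R / 2 ^ n) < e"
      using order_tendstoD(2)[OF lim_b] by blast
    then show "\<forall>\<^sub>F n in sequentially. \<forall>x\<in>B. \<forall>h. norm (u' n x h - G (U x) h) \<le> e * norm h"
    proof (rule eventually_mono, intro ballI allI)
      fix n x h assume n: "a n + K * (2 * R / 2 ^ n) < e" and x: "x \<in> B"
      have "norm (u' n x - G (U x)) \<le> norm (u' n x - G (u n x)) + norm (G (u n x) - G (U x))"
        using norm_triangle_ineq[of "u' n x - G (u n x)" "G (u n x) - G (U x)"] by simp
      also have "\<dots> \<le> a n + K * (2 * R / 2 ^ n)"
        using defect[OF x, of n] lip[OF un[OF x, of n] UR[OF x]] distU[OF x, of n] K(1)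
        by (meson add_mono mult_left_mono order_trans zero_le_one)
      finally have "norm (u' n x - G (U x)) \<le> e" using n by simp
      then have "norm ((u' n x - G (U x)) h) \<le> e * norm h"
        by (meson mult_right_mono norm_blinfun norm_ge_zero order_trans)
      then show "norm (u' n x h - G (U x) h) \<le> e * norm h" by (simp add: blinfun.diff_left)
    qed
  qed
  then obtain g where g: "\<And>x. x \<in> B \<Longrightarrow> (\<lambda>n. u n x) \<longlonglongrightarrow> g x"
    "\<And>x. x \<in> B \<Longrightarrow> (g has_derivative G (U x)) (at x within B)" by blast
  have gU: "g x = U x" if "x \<in> B" for x
    using LIMSEQ_unique[OF g(1)[OF that] limU[OF that]] .
  have "(g has_derivative G (g x)) (at x)" if "x \<in> B" for x
    using g(2)[OF that] unfolding at_within_open[OF that B(1)] gU[OF that] .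
  moreover have "g x \<in> S" if "x \<in> B" for x using UR[OF that] gU[OF that] R(2) by auto
  moreover have "g 0 = y0"
  proof -
    have "u n 0 = y0" for n by (cases n) (simp_all add: u0 uS blinfun.zero_right)
    with g(1)[OF B(3)] have "(\<lambda>n. y0) \<longlonglongrightarrow> g 0" by (simp only:)
    from LIMSEQ_unique[OF this tendsto_const] show ?thesis .
  qed
  ultimately show ?thesis
    using r(1) unfolding B_def by (intro exI[of _ r] exI[of _ g] conjI ballI)
qed

section \<open>Charts and coordinates\<close>

lemma smooth_on_cong:
  assumes "open S" "\<And>x. x \<in> S \<Longrightarrow> f x = g x" "smooth_on S f"
  shows "smooth_on S g"
  using assms Ck_on_cong unfolding smooth_on_def by metis

lemma smooth_on_subset: "smooth_on S f \<Longrightarrow> T \<subseteq> S \<Longrightarrow> smooth_on T f"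
  unfolding smooth_on_def using Ck_on_subset by blast

lemma smooth_on_compose:
  fixes g :: "'a::real_normed_vector \<Rightarrow> 'b::euclidean_space" and f :: "'b \<Rightarrow> 'c::real_normed_vector"
  assumes "open S" "open T" "\<And>x. x \<in> S \<Longrightarrow> g x \<in> T" "smooth_on T f" "smooth_on S g"
  shows "smooth_on S (\<lambda>x. f (g x))"
  unfolding smooth_on_def
proof
  fix k show "Ck_on k S (\<lambda>x. f (g x))"
    by (rule Ck_on_compose[OF assms(1-3)]) (use assms(4,5) in \<open>auto simp: smooth_on_def\<close>)
qed

lemma smooth_on_frechet_derivative:
  "smooth_on S f \<Longrightarrow> smooth_on S (\<lambda>x. frechet_derivative f (at x) v)"
  unfolding smooth_on_def using Ck_on_Suc_D2 by blast

lemma smooth_on_has_derivative: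
  "smooth_on S f \<Longrightarrow> x \<in> S \<Longrightarrow> (f has_derivative frechet_derivative f (at x)) (at x)"
  unfolding smooth_on_def using Ck_on_Suc_D by blast

lemma smooth_structure_chart:
  assumes "smooth_structure A" "c \<in> A"
  shows "open (fst c)" "open (snd c ` fst c)" "continuous_on (fst c) (snd c)"
    "continuous_on (snd c ` fst c) (chart_inv c)"
    "\<And>p. p \<in> fst c \<Longrightarrow> chart_inv c (snd c p) = p"
    "\<And>y. y \<in> snd c ` fst c \<Longrightarrow> snd c (chart_inv c y) = y"
    "\<And>y. y \<in> snd c ` fst c \<Longrightarrow> chart_inv c y \<in> fst c"
proof -
  have h: "is_chart c" using assms by (auto simp: smooth_structure_def)
  then have hom: "homeomorphism (fst c) (snd c ` fst c) (snd c) (chart_inv c)" by (simp add: is_chart_def)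
  show "open (fst c)" "open (snd c ` fst c)" using h by (auto simp: is_chart_def)
  show "continuous_on (fst c) (snd c)" "continuous_on (snd c ` fst c) (chart_inv c)"
    "\<And>p. p \<in> fst c \<Longrightarrow> chart_inv c (snd c p) = p"
    "\<And>y. y \<in> snd c ` fst c \<Longrightarrow> snd c (chart_inv c y) = y"
    using hom by (auto simp: homeomorphism_def)
  then show "\<And>y. y \<in> snd c ` fst c \<Longrightarrow> chart_inv c y \<in> fst c" by auto
qed

lemma chart_image_Int:
  assumes "smooth_structure A" "c \<in> A"
  shows "snd c ` (fst c \<inter> W) = snd c ` fst c \<inter> chart_inv c -` W"
  using smooth_structure_chart(5-7)[OF assms] by (auto simp: image_iff)

lemma open_chart_image:
  assumes "smooth_structure A" "c \<in> A" "open W"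
  shows "open (snd c ` (fst c \<inter> W))"
  unfolding chart_image_Int[OF assms(1,2)]
  using continuous_open_preimage[OF smooth_structure_chart(4)[OF assms(1,2)] smooth_structure_chart(2)[OF assms(1,2)] assms(3)] .

lemma chart_at_in:
  assumes "smooth_structure A"
  shows "chart_at A p \<in> A" "p \<in> fst (chart_at A p)"
proof -
  have "\<exists>c. c \<in> A \<and> p \<in> fst c" using assms unfolding smooth_structure_def by blast
  then have "chart_at A p \<in> A \<and> p \<in> fst (chart_at A p)" unfolding chart_at_def by (rule someI_ex)
  then show "chart_at A p \<in> A" "p \<in> fst (chart_at A p)" by auto
qed

text \<open>A common form of \<open>to_coords\<close>, \<open>coord_field\<close> and
  \<open>differential\<close>: the first two are the case of the identity map. Linearity, smoothness
  and the chain rule are thus proved once.\<close>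

definition jac :: "('n, 'f::euclidean_space) chart \<Rightarrow> ('m, 'e::euclidean_space) chart \<Rightarrow> ('n \<Rightarrow> 'm) \<Rightarrow> 'n \<Rightarrow> 'f \<Rightarrow> 'e"
  where "jac b c f p = frechet_derivative (\<lambda>y. snd c (f (chart_inv b y))) (at (snd b p))"

text \<open>Plain second partial derivatives in two charts. They have no invariant meaning; a change
  of chart produces them as an additional symmetric term.\<close>

definition hess :: "('n, 'f::euclidean_space) chart \<Rightarrow> ('m, 'e::euclidean_space) chart \<Rightarrow> ('n \<Rightarrow> 'm) \<Rightarrow> 'n \<Rightarrow> 'f \<Rightarrow> 'f \<Rightarrow> 'e"
  where "hess b c f p u w =
    frechet_derivative (\<lambda>y. frechet_derivative (\<lambda>y. snd c (f (chart_inv b y))) (at y) w) (at (snd b p)) u"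

definition local_rep :: "('m, 'e::euclidean_space) chart set \<Rightarrow> ('m, 'e) chart \<Rightarrow> ('m \<Rightarrow> 'e) \<Rightarrow> 'e \<Rightarrow> 'e"
  where "local_rep A c X y = to_coords A c (chart_inv c y) (X (chart_inv c y))"

lemma to_coords_eq_jac: "to_coords A c p = jac (chart_at A p) c (\<lambda>x. x) p"
  by (simp add: to_coords_def jac_def o_def)

lemma coord_field_eq_jac: "coord_field A c w p = jac c (chart_at A p) (\<lambda>x. x) p w"
  by (simp add: coord_field_def jac_def o_def)

lemma differential_eq_jac: "differential B A f p = jac (chart_at B p) (chart_at A (f p)) f p"
  by (simp add: differential_def jac_def o_def)

lemma smooth_map_ident:
  assumes "smooth_structure A"
  shows "smooth_map A A (\<lambda>x. x)"
  using assms unfolding smooth_map_def smooth_structure_def compatible_def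
  by (auto simp: o_def vimage_def Int_def)

section \<open>Jacobians and Hessians of a smooth map\<close>

context
  fixes B :: "('n::{t2_space, second_countable_topology}, 'f::euclidean_space) chart set"
    and A :: "('m::{t2_space, second_countable_topology}, 'e::euclidean_space) chart set"
    and f :: "'n \<Rightarrow> 'm"
  assumes B: "smooth_structure B" and A: "smooth_structure A" and f: "smooth_map B A f"
begin

lemma smooth_map_domain:
  assumes "b \<in> B" "c \<in> A"
  shows "open (snd b ` (fst b \<inter> f -` fst c))"
    "y \<in> snd b ` (fst b \<inter> f -` fst c) \<Longrightarrow> chart_inv b y \<in> fst b"
    "y \<in> snd b ` (fst b \<inter> f -` fst c) \<Longrightarrow> f (chart_inv b y) \<in> fst c"
    "y \<in> snd b ` (fst b \<inter> f -` fst c) \<Longrightarrow> snd b (chart_inv b y) = y"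
    "smooth_on (snd b ` (fst b \<inter> f -` fst c)) (\<lambda>y. snd c (f (chart_inv b y)))"
proof -
  have "open (f -` fst c)"
    using f smooth_structure_chart(1)[OF A assms(2)] unfolding smooth_map_def
    by (simp add: continuous_on_eq_continuous_at open_vimage)
  then show "open (snd b ` (fst b \<inter> f -` fst c))"
    by (rule open_chart_image[OF B assms(1)])
  show "y \<in> snd b ` (fst b \<inter> f -` fst c) \<Longrightarrow> chart_inv b y \<in> fst b"
    "y \<in> snd b ` (fst b \<inter> f -` fst c) \<Longrightarrow> f (chart_inv b y) \<in> fst c"
    "y \<in> snd b ` (fst b \<inter> f -` fst c) \<Longrightarrow> snd b (chart_inv b y) = y"
    using smooth_structure_chart(5)[OF B assms(1)] by auto
  show "smooth_on (snd b ` (fst b \<inter> f -` fst c)) (\<lambda>y. snd c (f (chart_inv b y)))"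
    using f assms unfolding smooth_map_def by (simp add: o_def)
qed

lemma jac_has_derivative:
  assumes "b \<in> B" "c \<in> A" "p \<in> fst b" "f p \<in> fst c"
  shows "((\<lambda>y. snd c (f (chart_inv b y))) has_derivative jac b c f p) (at (snd b p))"
  unfolding jac_def
  by (rule smooth_on_has_derivative[OF smooth_map_domain(5)[OF assms(1,2)]]) (use assms in auto)

lemma linear_jac:
  assumes "b \<in> B" "c \<in> A" "p \<in> fst b" "f p \<in> fst c"
  shows "linear (jac b c f p)"
  using jac_has_derivative[OF assms] has_derivative_linear by blast

lemma jac_chart_inv:
  assumes "b \<in> B" "c \<in> A" "y \<in> snd b ` (fst b \<inter> f -` fst c)"
  shows "jac b c f (chart_inv b y) = frechet_derivative (\<lambda>y. snd c (f (chart_inv b y))) (at y)"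
  by (simp add: jac_def smooth_map_domain(4)[OF assms])

lemma jac_smooth:
  assumes "b \<in> B" "c \<in> A"
  shows "smooth_on (snd b ` (fst b \<inter> f -` fst c)) (\<lambda>y. jac b c f (chart_inv b y) w)"
  by (rule smooth_on_cong[OF smooth_map_domain(1)[OF assms] _
        smooth_on_frechet_derivative[OF smooth_map_domain(5)[OF assms]]])
    (simp add: jac_chart_inv[OF assms])

lemma hess_has_derivative:
  assumes "b \<in> B" "c \<in> A" "p \<in> fst b" "f p \<in> fst c"
  shows "((\<lambda>y. jac b c f (chart_inv b y) w) has_derivative (\<lambda>u. hess b c f p u w)) (at (snd b p))"
proof (rule has_derivative_transform_within_open[OF _ smooth_map_domain(1)[OF assms(1,2)]])
  show "((\<lambda>y. frechet_derivative (\<lambda>y. snd c (f (chart_inv b y))) (at y) w) has_derivative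
      (\<lambda>u. hess b c f p u w)) (at (snd b p))"
    unfolding hess_def
    by (rule smooth_on_has_derivative[OF smooth_on_frechet_derivative[OF smooth_map_domain(5)[OF assms(1,2)]]])
      (use assms in auto)
qed (use assms in \<open>auto simp: jac_chart_inv\<close>)

lemma hess_symmetric:
  assumes "b \<in> B" "c \<in> A" "p \<in> fst b" "f p \<in> fst c"
  shows "hess b c f p u w = hess b c f p w u"
  unfolding hess_def
  by (rule Ck_on_second_derivative_symmetric[OF smooth_map_domain(1)[OF assms(1,2)]])
    (use assms smooth_map_domain(5)[OF assms(1,2)] in \<open>auto simp: smooth_on_def\<close>)

lemma linear_hess1:
  assumes "b \<in> B" "c \<in> A" "p \<in> fst b" "f p \<in> fst c"
  shows "linear (\<lambda>u. hess b c f p u w)"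
  using hess_has_derivative[OF assms] has_derivative_linear by blast

lemma bilinear_hess:
  assumes "b \<in> B" "c \<in> A" "p \<in> fst b" "f p \<in> fst c"
  shows "bilinear (hess b c f p)"
  using linear_hess1[OF assms] hess_symmetric[OF assms] unfolding bilinear_def by simp

end

lemma jac_chain:
  fixes C :: "('k::{t2_space, second_countable_topology}, 'g::euclidean_space) chart set"
    and B :: "('n::{t2_space, second_countable_topology}, 'f::euclidean_space) chart set"
    and A :: "('m::{t2_space, second_countable_topology}, 'e::euclidean_space) chart set"
  assumes C: "smooth_structure C" and B: "smooth_structure B" and A: "smooth_structure A"
    and h: "smooth_map C B h" and f: "smooth_map B A f"
    and ch: "c \<in> C" "b \<in> B" "a \<in> A" "p \<in> fst c" "h p \<in> fst b" "f (h p) \<in> fst a"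
  shows "jac c a (\<lambda>x. f (h x)) p = jac b a f (h p) \<circ> jac c b h p"
proof -
  have inv: "chart_inv c (snd c p) = p" by (rule smooth_structure_chart(5)[OF C ch(1,4)])
  have "((\<lambda>y. snd a (f (chart_inv b y))) \<circ> (\<lambda>y. snd b (h (chart_inv c y))) has_derivative
      jac b a f (h p) \<circ> jac c b h p) (at (snd c p))"
    using jac_has_derivative[OF B A f ch(2,3,5,6)]
    by (intro diff_chain_at jac_has_derivative[OF C B h ch(1,2,4,5)]) (simp add: inv)
  then have "((\<lambda>y. snd a (f (h (chart_inv c y)))) has_derivative jac b a f (h p) \<circ> jac c b h p) (at (snd c p))"
    by (rule has_derivative_transform_within_open[OF _ smooth_map_domain(1)[OF C B h ch(1,2)]])
      (use ch smooth_structure_chart(5)[OF B ch(2)] smooth_structure_chart(5)[OF C ch(1)] in auto)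
  then show ?thesis unfolding jac_def[of c a] by (rule frechet_derivative_eqI)
qed

section \<open>Coordinate changes and coordinate fields\<close>

context
  fixes A :: "('m::{t2_space, second_countable_topology}, 'e::euclidean_space) chart set"
  assumes A: "smooth_structure A"
begin

lemmas idA = smooth_map_ident[OF A]

lemma jac_ident_same:
  assumes "c \<in> A" "p \<in> fst c"
  shows "jac c c (\<lambda>x. x) p = (\<lambda>v. v)"
proof -
  have "((\<lambda>y. snd c (chart_inv c y)) has_derivative (\<lambda>v. v)) (at (snd c p))"
    by (rule has_derivative_transform_within_open[OF has_derivative_ident smooth_structure_chart(2)[OF A assms(1)]])
      (use assms smooth_structure_chart(6)[OF A assms(1)] in auto)
  then show ?thesis unfolding jac_def by (rule frechet_derivative_eqI)
qed

lemma jac_ident_trans: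
  assumes "a \<in> A" "b \<in> A" "c \<in> A" "p \<in> fst a" "p \<in> fst b" "p \<in> fst c"
  shows "jac b c (\<lambda>x. x) p (jac a b (\<lambda>x. x) p v) = jac a c (\<lambda>x. x) p v"
  using jac_chain[OF A A A idA idA assms] by (simp add: fun_eq_iff)

lemma jac_ident_inverse:
  assumes "a \<in> A" "b \<in> A" "p \<in> fst a" "p \<in> fst b"
  shows "jac b a (\<lambda>x. x) p (jac a b (\<lambda>x. x) p v) = v"
  using jac_ident_trans[OF assms(1,2,1,3,4,3)] jac_ident_same[OF assms(1,3)] by simp

lemma to_coords_coord_field:
  assumes "c \<in> A" "p \<in> fst c"
  shows "to_coords A c p (coord_field A c w p) = w"
  unfolding to_coords_eq_jac coord_field_eq_jac
  by (rule jac_ident_inverse[OF assms(1) chart_at_in(1)[OF A] assms(2) chart_at_in(2)[OF A]])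

lemma coord_field_to_coords:
  assumes "c \<in> A" "p \<in> fst c"
  shows "coord_field A c (to_coords A c p v) p = v"
  unfolding to_coords_eq_jac coord_field_eq_jac
  by (rule jac_ident_inverse[OF chart_at_in(1)[OF A] assms(1) chart_at_in(2)[OF A] assms(2)])

lemma to_coords_chart_at: "to_coords A (chart_at A p) p = (\<lambda>v. v)"
  unfolding to_coords_eq_jac by (rule jac_ident_same[OF chart_at_in[OF A]])

lemma coord_field_chart_at: "coord_field A (chart_at A p) w p = w"
  unfolding coord_field_eq_jac using jac_ident_same[OF chart_at_in[OF A]] by simp

lemma linear_to_coords:
  assumes "c \<in> A" "p \<in> fst c"
  shows "linear (to_coords A c p)"
  unfolding to_coords_eq_jac
  by (rule linear_jac[OF A A idA chart_at_in(1)[OF A] assms(1) chart_at_in(2)[OF A] assms(2)])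

lemma linear_coord_field:
  assumes "c \<in> A" "p \<in> fst c"
  shows "linear (\<lambda>w. coord_field A c w p)"
  unfolding coord_field_eq_jac
  by (rule linear_jac[OF A A idA assms(1) chart_at_in(1)[OF A] assms(2) chart_at_in(2)[OF A]])

lemma jac_to_coords:
  assumes "c \<in> A" "d \<in> A" "p \<in> fst c" "p \<in> fst d"
  shows "jac c d (\<lambda>x. x) p (to_coords A c p v) = to_coords A d p v"
  unfolding to_coords_eq_jac
  by (rule jac_ident_trans[OF chart_at_in(1)[OF A] assms(1,2) chart_at_in(2)[OF A] assms(3,4)])

lemma smooth_vector_field_iff:
  "smooth_vector_field A W X \<longleftrightarrow> (\<forall>c\<in>A. smooth_on (snd c ` (fst c \<inter> W)) (local_rep A c X))"
  unfolding smooth_vector_field_def local_rep_def[abs_def] by simp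

text \<open>The preferred charts at the individual points cancel: in a chart \<open>d\<close> the
  field has the components \<open>jac c d (\<lambda>x. x) p w\<close>, a column of the Jacobian of a
  transition map.\<close>

lemma smooth_coord_field:
  assumes c: "c \<in> A"
  shows "smooth_vector_field A (fst c) (coord_field A c w)"
  unfolding smooth_vector_field_iff
proof
  fix d assume d: "d \<in> A"
  have S: "open (snd d ` (fst d \<inter> fst c))" "open (snd c ` (fst c \<inter> fst d))"
    using open_chart_image[OF A] smooth_structure_chart(1)[OF A] c d by blast+
  have 1: "smooth_on (snd c ` (fst c \<inter> fst d)) (\<lambda>y. jac c d (\<lambda>x. x) (chart_inv c y) w)"
    using jac_smooth[OF A A idA c d] by (simp add: vimage_def Int_def)
  have 2: "smooth_on (snd d ` (fst d \<inter> fst c)) (\<lambda>y. snd c (chart_inv d y))"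
    using smooth_map_domain(5)[OF A A idA d c] by (simp add: vimage_def Int_def)
  have "smooth_on (snd d ` (fst d \<inter> fst c)) (\<lambda>y. jac c d (\<lambda>x. x) (chart_inv c (snd c (chart_inv d y))) w)"
    by (rule smooth_on_compose[OF S _ 1 2]) (use smooth_structure_chart(5)[OF A d] in auto)
  then show "smooth_on (snd d ` (fst d \<inter> fst c)) (local_rep A d (coord_field A c w))"
  proof (rule smooth_on_cong[OF S(1), rotated])
    fix y assume "y \<in> snd d ` (fst d \<inter> fst c)"
    then have q: "chart_inv d y \<in> fst c" "chart_inv d y \<in> fst d"
      using smooth_structure_chart(5)[OF A d] by auto
    show "jac c d (\<lambda>x. x) (chart_inv c (snd c (chart_inv d y))) w = local_rep A d (coord_field A c w) y"
      unfolding local_rep_def smooth_structure_chart(5)[OF A c q(1)]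
      using jac_to_coords[OF c d q, of "coord_field A c w (chart_inv d y)"] to_coords_coord_field[OF c q(1)] by simp
  qed
qed

end

text \<open>Both sides are the Jacobian of \<open>f\<close> from the preferred chart at
  \<open>p\<close> to \<open>c\<close>, factored once through the preferred chart at
  \<open>f p\<close> and once through \<open>b\<close>.\<close>

lemma to_coords_differential:
  fixes B :: "('n::{t2_space, second_countable_topology}, 'f::euclidean_space) chart set"
    and A :: "('m::{t2_space, second_countable_topology}, 'e::euclidean_space) chart set"
  assumes B: "smooth_structure B" and A: "smooth_structure A" and f: "smooth_map B A f"
    and bc: "b \<in> B" "c \<in> A" "p \<in> fst b" "f p \<in> fst c"
  shows "to_coords A c (f p) (differential B A f p v) = jac b c f p (to_coords B b p v)"
proof -
  have "jac (chart_at B p) c f p = jac (chart_at A (f p)) c (\<lambda>x. x) (f p) \<circ> jac (chart_at B p) (chart_at A (f p)) f p"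
    by (rule jac_chain[OF B A A f smooth_map_ident[OF A] chart_at_in(1)[OF B] chart_at_in(1)[OF A] bc(2)
          chart_at_in(2)[OF B] chart_at_in(2)[OF A] bc(4)])
  moreover have "jac (chart_at B p) c f p = jac b c f p \<circ> jac (chart_at B p) b (\<lambda>x. x) p"
    by (rule jac_chain[OF B B A smooth_map_ident[OF B] f chart_at_in(1)[OF B] bc(1,2)
          chart_at_in(2)[OF B] bc(3,4)])
  ultimately show ?thesis unfolding to_coords_eq_jac differential_eq_jac by (metis o_apply)
qed

section \<open>Involutivity and Koszul's formula\<close>

text \<open>In charts the pushed-forward field is the Jacobian applied to
  \<open>local_rep B b Y\<close>, and the product rule gives the two terms. \<open>Y\<close> is
  taken differentiable at \<open>p\<close> only, since \<open>involutive_at\<close> quantifies over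
  such fields.\<close>

lemma has_derivative_differential:
  fixes B :: "('n::{t2_space, second_countable_topology}, 'f::euclidean_space) chart set"
    and A :: "('m::{t2_space, second_countable_topology}, 'e::euclidean_space) chart set"
  assumes B: "smooth_structure B" and A: "smooth_structure A" and f: "smooth_map B A f"
    and bc: "b \<in> B" "c \<in> A" "p \<in> fst b" "f p \<in> fst c"
    and DY: "(local_rep B b Y has_derivative DY) (at (snd b p))"
  shows "((\<lambda>y. to_coords A c (f (chart_inv b y)) (differential B A f (chart_inv b y) (Y (chart_inv b y))))
    has_derivative (\<lambda>v. jac b c f p (DY v) + hess b c f p v (to_coords B b p (Y p)))) (at (snd b p))"
proof -
  let ?S = "snd b ` (fst b \<inter> f -` fst c)"
  note dom = smooth_map_domain[OF B A f bc(1,2)]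
  have inv: "chart_inv b (snd b p) = p" by (rule smooth_structure_chart(5)[OF B bc(1,3)])
  have y0: "snd b p \<in> ?S" using bc by auto
  have "((\<lambda>y. jac b c f (chart_inv b y) (local_rep B b Y y)) has_derivative
      (\<lambda>v. jac b c f (chart_inv b (snd b p)) (DY v) + hess b c f p v (local_rep B b Y (snd b p)))) (at (snd b p))"
    by (rule has_derivative_apply_linear(1)[OF dom(1) y0 linear_jac[OF B A f bc(1,2) dom(2,3)]
          hess_has_derivative[OF B A f bc] DY])
  then have "((\<lambda>y. jac b c f (chart_inv b y) (local_rep B b Y y)) has_derivative
      (\<lambda>v. jac b c f p (DY v) + hess b c f p v (to_coords B b p (Y p)))) (at (snd b p))"
    by (simp add: inv local_rep_def)
  then show ?thesis
    by (rule has_derivative_transform_within_open[OF _ dom(1) y0])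
      (simp add: to_coords_differential[OF B A f bc(1,2) dom(2,3)] local_rep_def)
qed

lemma differential_ident:
  assumes "smooth_structure B"
  shows "differential B B (\<lambda>x. x) p = (\<lambda>v. v)"
  unfolding differential_eq_jac by (rule jac_ident_same[OF assms chart_at_in[OF assms]])

text \<open>The preceding formula for the identity map, composed with the coordinate change on the
  source.\<close>

lemma local_rep_change:
  fixes B :: "('n::{t2_space, second_countable_topology}, 'f::euclidean_space) chart set"
  assumes B: "smooth_structure B" and bd: "b \<in> B" "d \<in> B" "p \<in> fst b" "p \<in> fst d"
    and DY: "(local_rep B b Y has_derivative DY) (at (snd b p))"
  shows "(local_rep B d Y has_derivative (\<lambda>v. jac b d (\<lambda>x. x) p (DY (jac d b (\<lambda>x. x) p v))
    + hess b d (\<lambda>x. x) p (jac d b (\<lambda>x. x) p v) (to_coords B b p (Y p)))) (at (snd d p))"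
proof -
  note I = smooth_map_ident[OF B]
  have inv: "chart_inv d (snd d p) = p" by (rule smooth_structure_chart(5)[OF B bd(2,4)])
  let ?F = "\<lambda>y. to_coords B d (chart_inv b y) (Y (chart_inv b y))"
  have "(?F has_derivative (\<lambda>v. jac b d (\<lambda>x. x) p (DY v) + hess b d (\<lambda>x. x) p v (to_coords B b p (Y p)))) (at (snd b p))"
    using has_derivative_differential[OF B B I bd DY] by (simp add: differential_ident[OF B])
  then have "(?F has_derivative (\<lambda>v. jac b d (\<lambda>x. x) p (DY v) + hess b d (\<lambda>x. x) p v (to_coords B b p (Y p))))
      (at (snd b (chart_inv d (snd d p))))" by (simp add: inv)
  then have "((\<lambda>y. ?F (snd b (chart_inv d y))) has_derivative (\<lambda>v. jac b d (\<lambda>x. x) p (DY (jac d b (\<lambda>x. x) p v))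
    + hess b d (\<lambda>x. x) p (jac d b (\<lambda>x. x) p v) (to_coords B b p (Y p)))) (at (snd d p))"
    by (rule has_derivative_compose[where g="?F" and f="\<lambda>y. snd b (chart_inv d y)",
          OF jac_has_derivative[OF B B I bd(2,1,4,3)]])
  then show ?thesis
    by (rule has_derivative_transform_within_open[OF _ smooth_map_domain(1)[OF B B I bd(2,1)]])
      (use bd smooth_structure_chart(5)[OF B bd(1)] smooth_structure_chart(5)[OF B bd(2)] in \<open>auto simp: local_rep_def\<close>)
qed

text \<open>Frobenius' condition at a point \<open>p\<close>, in the coordinates of the chart \<open>b\<close>: modulo \<open>D\<close>, the derivative
  of a section \<open>Y\<close> of \<open>D\<close> in a direction \<open>v\<close> of \<open>D\<close> depends only on \<open>v\<close> and \<open>Y p\<close>, symmetrically.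
  This implies that brackets of sections lie in \<open>D\<close>, and only requires \<open>Y\<close> to be differentiable at \<open>p\<close>.\<close>

definition involutive_at ::
    "('n::topological_space, 'f::euclidean_space) chart set \<Rightarrow> ('n \<Rightarrow> 'f set) \<Rightarrow> ('n, 'f) chart \<Rightarrow> 'n \<Rightarrow> bool"
  where "involutive_at B D b p \<longleftrightarrow> (\<exists>Q. bilinear Q \<and> (\<forall>u w. Q u w = Q w u) \<and>
    (\<forall>Y W DY. open W \<and> p \<in> W \<and> (\<forall>q\<in>W. Y q \<in> D q) \<and>
       (local_rep B b Y has_derivative DY) (at (snd b p)) \<longrightarrow>
       (\<forall>v\<in>to_coords B b p ` D p. DY v - Q v (to_coords B b p (Y p)) \<in> to_coords B b p ` D p)))"

lemma involutive_atI:
  assumes "bilinear Q" "\<And>u w. Q u w = Q w u"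
    and "\<And>Y W DY v. open W \<Longrightarrow> p \<in> W \<Longrightarrow> (\<And>q. q \<in> W \<Longrightarrow> Y q \<in> D q) \<Longrightarrow>
       (local_rep B b Y has_derivative DY) (at (snd b p)) \<Longrightarrow> v \<in> to_coords B b p ` D p \<Longrightarrow>
       DY v - Q v (to_coords B b p (Y p)) \<in> to_coords B b p ` D p"
  shows "involutive_at B D b p"
  unfolding involutive_at_def
  by (intro exI[of _ Q] conjI assms(1) allI assms(2) impI ballI) (elim conjE, rule assms(3), auto)

text \<open>A change of chart adds a Hessian term to the derivative; being bilinear and symmetric,
  it is absorbed into \<open>Q\<close>. This is one reason for leaving \<open>Q\<close> free in the
  condition.\<close>

lemma involutive_at_change:
  fixes B :: "('n::{t2_space, second_countable_topology}, 'f::euclidean_space) chart set"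
  assumes B: "smooth_structure B" and bd: "b \<in> B" "d \<in> B" "p \<in> fst b" "p \<in> fst d"
    and inv: "involutive_at B D b p"
  shows "involutive_at B D d p"
proof -
  obtain Q where Q: "bilinear Q" "\<forall>u w. Q u w = Q w u"
    and Qd: "\<forall>Y W DY. open W \<and> p \<in> W \<and> (\<forall>q\<in>W. Y q \<in> D q) \<and>
       (local_rep B b Y has_derivative DY) (at (snd b p)) \<longrightarrow>
       (\<forall>v\<in>to_coords B b p ` D p. DY v - Q v (to_coords B b p (Y p)) \<in> to_coords B b p ` D p)"
    using inv unfolding involutive_at_def by (elim exE conjE)
  define J where "J = jac b d (\<lambda>x. x) p"
  define I where "I = jac d b (\<lambda>x. x) p"
  define H where "H = hess b d (\<lambda>x. x) p"
  note idB = smooth_map_ident[OF B]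
  have linJ: "linear J" unfolding J_def by (rule linear_jac[OF B B idB bd])
  have linI: "linear I" unfolding I_def by (rule linear_jac[OF B B idB bd(2,1,4,3)])
  have bilH: "bilinear H" unfolding H_def by (rule bilinear_hess[OF B B idB bd])
  have symH: "H u w = H w u" for u w unfolding H_def by (rule hess_symmetric[OF B B idB bd])
  have Jb: "J (to_coords B b p v) = to_coords B d p v" for v
    unfolding J_def by (rule jac_to_coords[OF B bd])
  have Id: "I (to_coords B d p v) = to_coords B b p v" for v
    unfolding I_def by (rule jac_to_coords[OF B bd(2,1,4,3)])
  show ?thesis
  proof (rule involutive_atI[where Q="\<lambda>u w. J (Q (I u) (I w)) + H (I u) (I w)"])
    have "linear (\<lambda>u. J (Q (I u) (I w)))" "linear (\<lambda>u. J (Q (I w) (I u)))"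
      "linear (\<lambda>u. H (I u) (I w))" "linear (\<lambda>u. H (I w) (I u))" for w
      using linear_compose[OF linI linear_compose[OF _ linJ], of "\<lambda>u. Q u (I w)"]
        linear_compose[OF linI linear_compose[OF _ linJ], of "\<lambda>u. Q (I w) u"]
        linear_compose[OF linI, of "\<lambda>u. H u (I w)"] linear_compose[OF linI, of "\<lambda>u. H (I w) u"]
        Q(1) bilH unfolding bilinear_def o_def by auto
    then show "bilinear (\<lambda>u w. J (Q (I u) (I w)) + H (I u) (I w))"
      unfolding bilinear_def by (auto intro: linear_compose_add)
    show "J (Q (I u) (I w)) + H (I u) (I w) = J (Q (I w) (I u)) + H (I w) (I u)" for u w
      using Q(2) symH by metis
    fix Y W DY v
    assume W: "open W" "p \<in> W" "\<And>q. q \<in> W \<Longrightarrow> Y q \<in> D q"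
      and DY: "(local_rep B d Y has_derivative DY) (at (snd d p))" and v: "v \<in> to_coords B d p ` D p"
    obtain DYb where DYb: "(local_rep B b Y has_derivative DYb) (at (snd b p))"
      using local_rep_change[OF B bd(2,1,4,3) DY] by blast
    have DY_eq: "DY v = J (DYb (I v)) + H (I v) (to_coords B b p (Y p))"
      using has_derivative_unique[OF DY local_rep_change[OF B bd DYb]] by (simp add: J_def I_def H_def)
    have "I v \<in> to_coords B b p ` D p" using v Id by auto
    with Qd[rule_format, of W Y DYb] W DYb obtain x where x: "x \<in> D p"
      "DYb (I v) - Q (I v) (to_coords B b p (Y p)) = to_coords B b p x" by blast
    have "DY v - (J (Q (I v) (I (to_coords B d p (Y p)))) + H (I v) (I (to_coords B d p (Y p))))
        = J (DYb (I v) - Q (I v) (to_coords B b p (Y p)))"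
      unfolding DY_eq Id linear_diff[OF linJ] by simp
    also have "\<dots> = to_coords B d p x" unfolding x(2) Jb ..
    finally show "DY v - (J (Q (I v) (I (to_coords B d p (Y p)))) + H (I v) (I (to_coords B d p (Y p))))
        \<in> to_coords B d p ` D p" using x(1) by simp
  qed
qed

section \<open>Nondegenerate forms and the Levi-Civita connection at a point\<close>

lemma nondegenerate_represents_on:
  fixes b :: "'a::euclidean_space \<Rightarrow> 'a \<Rightarrow> real"
  assumes b: "bilinear b" "nondegenerate_on V b" and V: "subspace V" and \<phi>: "linear \<phi>"
  shows "\<exists>x\<in>V. \<forall>z\<in>V. b x z = \<phi> z"
proof -
  obtain I where I: "I \<subseteq> V" "independent I" "V \<subseteq> span I" using basis_exists by metis
  have finI: "finite I" using I(2) by (rule independent_imp_finite)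
  have sp: "span I = V" using I(1,3) V by (metis span_minimal subset_antisym)
  \<comment> \<open>\<open>T\<close> records the values of \<open>b x\<close> on the basis
    \<open>I\<close> as coefficients with respect to \<open>I\<close> itself. It thus maps
    \<open>V\<close> to \<open>V\<close>, and injectivity, which is nondegeneracy, forces
    surjectivity.\<close>
  define T where "T x = (\<Sum>i\<in>I. b x i *\<^sub>R i)" for x
  have bl: "linear (\<lambda>x. b x z)" and br: "linear (b z)" for z using b(1) by (auto simp: bilinear_def)
  have linT: "linear T" unfolding T_def
    by (rule linearI) (simp_all add: linear_add[OF bl] linear_cmul[OF bl] scaleR_add_left sum.distrib scaleR_sum_right)
  have coeff: "b x i = a i" if "T x = (\<Sum>i\<in>I. a i *\<^sub>R i)" "i \<in> I" for x a i
  proof -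
    have "(\<Sum>i\<in>I. (b x i - a i) *\<^sub>R i) = 0" using that(1) by (simp add: T_def scaleR_diff_left sum_subtractf)
    then show ?thesis using independentD[OF I(2) finI order_refl _ that(2), of "\<lambda>i. b x i - a i"] by simp
  qed
  have eq_on: "\<forall>z\<in>V. \<psi> z = \<theta> z" if "linear \<psi>" "linear \<theta>" "\<And>i. i \<in> I \<Longrightarrow> \<psi> i = \<theta> i" for \<psi> \<theta> :: "'a \<Rightarrow> real"
    using linear_eq_on[OF that(1,2), of _ I] that(3) unfolding sp by blast
  have "inj_on T (span I)"
  proof (rule inj_onI)
    fix x y assume xy: "x \<in> span I" "y \<in> span I" "T x = T y"
    then have "T (x - y) = (\<Sum>i\<in>I. 0 *\<^sub>R i)" by (simp add: linear_diff[OF linT])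
    then have "b (x - y) i = 0" if "i \<in> I" for i using coeff[OF _ that, of "x - y" "\<lambda>_. 0"] by simp
    then have "\<forall>z\<in>V. b (x - y) z = 0"
      using eq_on[OF br[of "x - y"], of "\<lambda>_. 0"] by (simp add: linear_zero)
    moreover have "x - y \<in> V" using xy by (simp add: sp V subspace_diff)
    ultimately have "x - y = 0" using b(2) unfolding nondegenerate_on_def by blast
    then show "x = y" by simp
  qed
  then have "dim (T ` V) = dim V"
    using dim_image_eq[OF linT, of V] sp by (simp add: span_eq_iff[THEN iffD2, OF V])
  moreover have "T ` V \<subseteq> V"
    unfolding T_def using I(1) V by (auto intro!: subspace_sum subspace_scale)
  ultimately have "T ` V = V"
    using subspace_dim_equal[OF linear_subspace_image[OF linT V] V] by simp
  moreover have "(\<Sum>i\<in>I. \<phi> i *\<^sub>R i) \<in> V"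
    using I(1) V by (auto intro!: subspace_sum subspace_scale)
  ultimately obtain x where x: "x \<in> V" "T x = (\<Sum>i\<in>I. \<phi> i *\<^sub>R i)" by (metis imageE)
  have "\<forall>z\<in>V. b x z = \<phi> z"
    by (rule eq_on[OF br \<phi> coeff[OF x(2)]])
  then show ?thesis using x(1) by blast
qed

text \<open>Alternating the two exchanges leads back to the start after six steps, three of which
  change the sign. This gives both uniqueness of the Levi-Civita connection and normality of the
  second fundamental form.\<close>

lemma symmetric_alternating_zero:
  fixes F :: "'a \<Rightarrow> 'a \<Rightarrow> 'a \<Rightarrow> real"
  assumes "\<And>u w z. F u w z = F w u z" "\<And>u w z. F u w z = - F u z w"
  shows "F u w z = 0"
proof -
  have "F u w z = - F u z w" "F u z w = F z u w" "F z u w = - F z w u" "F z w u = F w z u"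
    "F w z u = - F w u z" "F w u z = F u w z"
    using assms by blast+
  then show ?thesis by linarith
qed

text \<open>The fundamental lemma of semi-Riemannian geometry at one point, as linear algebra:
  \<open>d u w z\<close> stands for the derivative in the direction \<open>u\<close> of the
  component of the metric at \<open>w\<close> and \<open>z\<close>.\<close>

lemma koszul:
  fixes b :: "'a::euclidean_space \<Rightarrow> 'a \<Rightarrow> real" and d :: "'a \<Rightarrow> 'a \<Rightarrow> 'a \<Rightarrow> real"
  assumes b: "bilinear b" "\<And>u v. b u v = b v u" "nondegenerate_on UNIV b"
    and d: "\<And>w z. linear (\<lambda>u. d u w z)" "\<And>u z. linear (\<lambda>w. d u w z)" "\<And>u w z. d u w z = d u z w"
  shows "\<exists>!\<Gamma>. bilinear \<Gamma> \<and> (\<forall>u w. \<Gamma> u w = \<Gamma> w u) \<and> (\<forall>u w z. d u w z = b (\<Gamma> u w) z + b w (\<Gamma> u z))"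
proof -
  have bl: "linear (\<lambda>x. b x z)" for z using b(1) by (auto simp: bilinear_def)
  have ext: "x = y" if "\<And>z. b x z = b y z" for x y
  proof -
    have "b (x - y) z = 0" for z using that by (simp add: linear_diff[OF bl])
    then have "x - y = 0" using b(3) unfolding nondegenerate_on_def by blast
    then show ?thesis by simp
  qed
  \<comment> \<open>Koszul's formula for coordinate fields, whose brackets vanish.\<close>
  define k where "k u w z = (d u w z + d w u z - d z u w) / 2" for u w z
  have d3: "linear (\<lambda>z. d u w z)" for u w using d(2)[of u w] d(3) by simp
  have add: "d (u + u') w z = d u w z + d u' w z" "d u (w + w') z = d u w z + d u w' z" "d u w (z + z') = d u w z + d u w z'"
    and scale: "d (r *\<^sub>R u) w z = r * d u w z" "d u (r *\<^sub>R w) z = r * d u w z" "d u w (r *\<^sub>R z) = r * d u w z"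
    for u u' w w' z z' r
    using linear_add[OF d(1)] linear_add[OF d(2)] linear_add[OF d3]
      linear_cmul[OF d(1)] linear_cmul[OF d(2)] linear_cmul[OF d3] by auto
  have k3: "linear (k u w)" for u w
    unfolding k_def by (rule linearI) (simp_all add: add scale field_simps)
  have "\<exists>x. \<forall>z. b x z = k u w z" for u w
    using nondegenerate_represents_on[OF b(1,3) subspace_UNIV k3] by simp
  then obtain \<Gamma> where \<Gamma>: "\<And>u w z. b (\<Gamma> u w) z = k u w z" by metis
  have sym: "\<Gamma> u w = \<Gamma> w u" for u w
    by (rule ext) (simp add: \<Gamma> k_def d(3)[of _ u w])
  have lin: "linear (\<lambda>u. \<Gamma> u w)" for w
  proof (rule linearI)
    show "\<Gamma> (x + y) w = \<Gamma> x w + \<Gamma> y w" for x y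
      by (rule ext) (simp add: \<Gamma> linear_add[OF bl] k_def add field_simps)
    show "\<Gamma> (r *\<^sub>R x) w = r *\<^sub>R \<Gamma> x w" for r x
      by (rule ext) (simp add: \<Gamma> linear_cmul[OF bl] k_def scale field_simps)
  qed
  have compat: "d u w z = b (\<Gamma> u w) z + b w (\<Gamma> u z)" for u w z
    unfolding b(2)[of w "\<Gamma> u z"] \<Gamma> k_def using d(3) by (simp add: field_simps)
  show ?thesis
  proof (rule ex1I[of _ \<Gamma>])
    show "bilinear \<Gamma> \<and> (\<forall>u w. \<Gamma> u w = \<Gamma> w u) \<and> (\<forall>u w z. d u w z = b (\<Gamma> u w) z + b w (\<Gamma> u z))"
      using lin sym compat unfolding bilinear_def by auto
  next
    fix \<Gamma>' assume \<Gamma>': "bilinear \<Gamma>' \<and> (\<forall>u w. \<Gamma>' u w = \<Gamma>' w u) \<and> (\<forall>u w z. d u w z = b (\<Gamma>' u w) z + b w (\<Gamma>' u z))"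
    have "b (\<Gamma>' u w) z - b (\<Gamma> u w) z = 0" for u w z
    proof (rule symmetric_alternating_zero[where F="\<lambda>u w z. b (\<Gamma>' u w) z - b (\<Gamma> u w) z"])
      show "b (\<Gamma>' u w) z - b (\<Gamma> u w) z = b (\<Gamma>' w u) z - b (\<Gamma> w u) z" for u w z
        using \<Gamma>' sym by metis
      show "b (\<Gamma>' u w) z - b (\<Gamma> u w) z = - (b (\<Gamma>' u z) w - b (\<Gamma> u z) w)" for u w z
      proof -
        have "d u w z = b (\<Gamma>' u w) z + b w (\<Gamma>' u z)" using \<Gamma>' by blast
        with compat[of u w z] show ?thesis by (simp add: b(2)[of w])
      qed
    qed
    then show "\<Gamma>' = \<Gamma>" by (intro HOL.ext ext) simp
  qed
qed

section \<open>The second fundamental form in coordinates\<close>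

definition metric_rep ::
    "('m, 'e::euclidean_space) chart set \<Rightarrow> ('m \<Rightarrow> 'e \<Rightarrow> 'e \<Rightarrow> real) \<Rightarrow> ('m, 'e) chart \<Rightarrow> 'e \<Rightarrow> 'e \<Rightarrow> 'e \<Rightarrow> real"
  where "metric_rep A g c y w z =
    g (chart_inv c y) (coord_field A c w (chart_inv c y)) (coord_field A c z (chart_inv c y))"

text \<open>By \<open>koszul\<close> the definite description in \<open>christoffel\<close> is
  satisfied by exactly one map. The derivative \<open>dh\<close> is a parameter because the induced
  metric supplies it in terms of \<open>second_derivative\<close>, the ambient metric
  directly.\<close>

lemma christoffel_properties:
  fixes B :: "('n::{t2_space, second_countable_topology}, 'f::euclidean_space) chart set"
    and h :: "'n \<Rightarrow> 'f \<Rightarrow> 'f \<Rightarrow> real"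
  assumes B: "smooth_structure B"
    and h: "\<And>q. bilinear (h q)" "\<And>q u v. h q u v = h q v u" "nondegenerate_on UNIV (h p)"
    and dh: "\<And>w z. ((\<lambda>y. metric_rep B h (chart_at B p) y w z) has_derivative (\<lambda>u. dh u w z)) (at (snd (chart_at B p) p))"
  shows "bilinear (christoffel B h p)" "christoffel B h p u w = christoffel B h p w u"
    "dh u w z = h p (christoffel B h p u w) z + h p w (christoffel B h p u z)"
proof -
  let ?b = "chart_at B p"
  note b = chart_at_in[OF B, of p]
  have lin: "linear (metric_rep B h ?b y w)" if "y \<in> snd ?b ` fst ?b" for y w
  proof -
    have q: "chart_inv ?b y \<in> fst ?b" by (rule smooth_structure_chart(7)[OF B b(1) that])
    have "linear (h (chart_inv ?b y) (coord_field B ?b w (chart_inv ?b y)))"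
      using h(1) by (simp add: bilinear_def)
    then show ?thesis unfolding metric_rep_def
      using linear_compose[OF linear_coord_field[OF B b(1) q]] by (simp add: o_def)
  qed
  have y0: "snd ?b p \<in> snd ?b ` fst ?b" using b by blast
  have d2: "linear (\<lambda>z. dh u w z)" for u w
    by (rule has_derivative_apply_linear(2)[OF smooth_structure_chart(2)[OF B b(1)] y0 lin dh has_derivative_const])
  have d1: "linear (\<lambda>u. dh u w z)" for w z using dh has_derivative_linear by blast
  have dsym: "dh u w z = dh u z w" for u w z
  proof -
    have "(\<lambda>y. metric_rep B h ?b y w z) = (\<lambda>y. metric_rep B h ?b y z w)"
      unfolding metric_rep_def by (rule HOL.ext) (rule h(2))
    with dh[of w z] have "((\<lambda>y. metric_rep B h ?b y z w) has_derivative (\<lambda>u. dh u w z)) (at (snd ?b p))"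
      by (simp only:)
    from has_derivative_unique[OF this dh[of z w]]
    have "(\<lambda>u. dh u w z) = (\<lambda>u. dh u z w)" .
    from fun_cong[OF this, of u] show ?thesis .
  qed
  have d3: "linear (\<lambda>w. dh u w z)" for u z
    using d2[of u z] dsym by simp
  have eq: "frechet_derivative (\<lambda>y. h (chart_inv ?b y) (coord_field B ?b w (chart_inv ?b y))
      (coord_field B ?b z (chart_inv ?b y))) (at (snd ?b p)) u = dh u w z" for u w z
    using frechet_derivative_eqI[OF dh[of w z]] unfolding metric_rep_def by simp
  have chr: "christoffel B h p = (THE \<Gamma>. bilinear \<Gamma> \<and> (\<forall>u w. \<Gamma> u w = \<Gamma> w u) \<and>
      (\<forall>u w z. dh u w z = h p (\<Gamma> u w) z + h p w (\<Gamma> u z)))"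
    unfolding christoffel_def Let_def eq ..
  have P: "bilinear (christoffel B h p) \<and> (\<forall>u w. christoffel B h p u w = christoffel B h p w u) \<and>
      (\<forall>u w z. dh u w z = h p (christoffel B h p u w) z + h p w (christoffel B h p u z))"
    unfolding chr by (rule theI'[OF koszul[where b="h p" and d=dh, OF h(1,2,3) d1 d3 dsym]])
  show "bilinear (christoffel B h p)" "christoffel B h p u w = christoffel B h p w u"
    "dh u w z = h p (christoffel B h p u w) z + h p w (christoffel B h p u z)"
    using P by blast+
qed

lemma metric_rep_has_derivative:
  fixes A :: "('m::{t2_space, second_countable_topology}, 'e::euclidean_space) chart set"
  assumes A: "smooth_structure A" and g: "semi_riemannian_metric A g" and c: "c \<in> A" "p \<in> fst c"
  shows "((\<lambda>y. metric_rep A g c y w z) has_derivative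
    (\<lambda>u. frechet_derivative (\<lambda>y. metric_rep A g c y w z) (at (snd c p)) u)) (at (snd c p))"
proof (rule smooth_on_has_derivative)
  have "smooth_function A (fst c) (\<lambda>x. g x (coord_field A c w x) (coord_field A c z x))"
    using g c unfolding semi_riemannian_metric_def by blast
  from bspec[OF this[unfolded smooth_function_def] c(1)] show "smooth_on (snd c ` (fst c \<inter> fst c)) (\<lambda>y. metric_rep A g c y w z)"
    unfolding metric_rep_def o_def .
qed (use c in auto)

section \<open>The Gauss formula for a nondegenerate immersion\<close>

locale submanifold =
  fixes B :: "('n::{t2_space, second_countable_topology}, 'f::euclidean_space) chart set"
    and A :: "('m::{t2_space, second_countable_topology}, 'e::euclidean_space) chart set"
    and g :: "'m \<Rightarrow> 'e \<Rightarrow> 'e \<Rightarrow> real" and f :: "'n \<Rightarrow> 'm"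
  assumes A: "smooth_structure A" and B: "smooth_structure B"
    and g: "semi_riemannian_metric A g" and N: "nondegenerate_submanifold B A g f"
begin

abbreviation h where "h \<equiv> induced_metric B A g f"

abbreviation df where "df \<equiv> differential B A f"

text \<open>The covariant derivative of \<open>df\<close> for the Levi-Civita connection of the
  ambient manifold and the flat connection of the chart \<open>chart_at B p\<close> on the source.
  The Christoffel symbols of the source are subtracted separately.\<close>

definition second_derivative :: "'n \<Rightarrow> 'f \<Rightarrow> 'f \<Rightarrow> 'e"
  where "second_derivative p u w =
    hess (chart_at B p) (chart_at A (f p)) f p u w + christoffel A g (f p) (df p u) (df p w)"

lemma smooth_f: "smooth_map B A f" and inj_df: "inj (df p)" and nondeg_h: "nondegenerate_on UNIV (h p)"
  using N by (auto simp: nondegenerate_submanifold_def)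

lemma bilinear_g: "bilinear (g x)" and sym_g: "g x u v = g x v u" and nondeg_g: "nondegenerate_on UNIV (g x)"
  using g by (auto simp: semi_riemannian_metric_def)

lemma linear_df: "linear (df p)"
  unfolding differential_eq_jac
  by (rule linear_jac[OF B A smooth_f chart_at_in(1)[OF B] chart_at_in(1)[OF A] chart_at_in(2)[OF B] chart_at_in(2)[OF A]])

lemma bilinear_h: "bilinear (h p)"
  using bilinear_g[of "f p"] linear_compose[OF linear_df[of p]]
  unfolding bilinear_def induced_metric_def o_def by blast

lemma sym_h: "h p u v = h p v u"
  by (simp add: induced_metric_def sym_g)

lemmas christoffel_g = christoffel_properties[OF A bilinear_g sym_g nondeg_g
    metric_rep_has_derivative[OF A g chart_at_in[OF A]]]

lemma second_derivative_sym: "second_derivative p u w = second_derivative p w u"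
  unfolding second_derivative_def
  using hess_symmetric[OF B A smooth_f chart_at_in(1)[OF B] chart_at_in(1)[OF A] chart_at_in(2)[OF B] chart_at_in(2)[OF A]]
    christoffel_g(2) by metis

lemma nabla_along_tangent:
  assumes DY: "(local_rep B (chart_at B p) Y has_derivative DY) (at (snd (chart_at B p) p))"
  shows "nabla_along B A g f (\<lambda>x. df x (Y x)) p v = df p (DY v) + second_derivative p v (Y p)"
proof -
  note bc = chart_at_in(1)[OF B] chart_at_in(1)[OF A] chart_at_in(2)[OF B] chart_at_in(2)[OF A]
  show ?thesis
    unfolding nabla_along_def Let_def frechet_derivative_eqI[OF has_derivative_differential[OF B A smooth_f bc DY]]
    by (simp add: to_coords_chart_at[OF B] second_derivative_def differential_eq_jac)
qed

text \<open>The product rule gives two Hessian terms and the derivative of the ambient metric.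
  Compatibility of the ambient Christoffel symbols splits the latter, and each half completes one
  Hessian to \<open>second_derivative\<close>.\<close>

lemma metric_rep_induced_has_derivative:
  fixes p defines "b \<equiv> chart_at B p"
  shows "((\<lambda>y. metric_rep B h b y w z) has_derivative
    (\<lambda>u. g (f p) (second_derivative p u w) (df p z) + g (f p) (df p w) (second_derivative p u z))) (at (snd b p))"
proof -
  define c where "c = chart_at A (f p)"
  define G where "G = metric_rep A g c"
  define \<phi> where "\<phi> y = snd c (f (chart_inv b y))" for y
  let ?S = "snd b ` (fst b \<inter> f -` fst c)"
  let ?y0 = "snd b p"
  have bc: "b \<in> B" "c \<in> A" "p \<in> fst b" "f p \<in> fst c"
    using chart_at_in[OF B] chart_at_in[OF A] by (auto simp: b_def c_def)
  note dom = smooth_map_domain[OF B A smooth_f bc(1,2)]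
  have S: "open ?S" "?y0 \<in> ?S" using dom(1) bc by auto
  have inv: "chart_inv b ?y0 = p" by (rule smooth_structure_chart(5)[OF B bc(1,3)])
  have \<phi>0: "\<phi> ?y0 = snd c (f p)" by (simp add: \<phi>_def inv)
  have df_jac: "df p = jac b c f p" by (simp add: differential_eq_jac b_def c_def)
  define dG where "dG u w z = frechet_derivative (\<lambda>y. metric_rep A g c y w z) (at (snd c (f p))) u" for u w z
  have G0: "G (snd c (f p)) = g (f p)"
    unfolding G_def metric_rep_def smooth_structure_chart(5)[OF A bc(2,4)]
    unfolding c_def coord_field_chart_at[OF A] ..
  have Gl: "linear (\<lambda>w. G (\<phi> y) w z)" "linear (\<lambda>z. G (\<phi> y) w z)" if y: "y \<in> ?S" for y w z
  proof -
    let ?x = "f (chart_inv b y)"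
    have x: "?x \<in> fst c" by (rule dom(3)[OF y])
    have inv: "chart_inv c (\<phi> y) = ?x" unfolding \<phi>_def by (rule smooth_structure_chart(5)[OF A bc(2) x])
    have "linear (\<lambda>v. g ?x v (coord_field A c z ?x))" "linear (g ?x (coord_field A c w ?x))"
      using bilinear_g by (auto simp: bilinear_def)
    then show "linear (\<lambda>w. G (\<phi> y) w z)" "linear (\<lambda>z. G (\<phi> y) w z)"
      unfolding G_def metric_rep_def inv
      using linear_compose[OF linear_coord_field[OF A bc(2) x]] by (auto simp: o_def)
  qed
  have dphi: "(\<phi> has_derivative df p) (at ?y0)"
    unfolding \<phi>_def[abs_def] df_jac by (rule jac_has_derivative[OF B A smooth_f bc])
  have dGphi: "((\<lambda>y. G (\<phi> y) w z) has_derivative (\<lambda>u. dG (df p u) w z)) (at ?y0)" for w z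
  proof -
    have "((\<lambda>y. metric_rep A g c y w z) has_derivative (\<lambda>u. dG u w z)) (at (\<phi> ?y0))"
      unfolding \<phi>0 dG_def by (rule metric_rep_has_derivative[OF A g bc(2,4)])
    from has_derivative_compose[OF dphi this] show ?thesis by (simp add: G_def)
  qed
  have da: "((\<lambda>y. jac b c f (chart_inv b y) w) has_derivative (\<lambda>u. hess b c f p u w)) (at ?y0)" for w
    by (rule hess_has_derivative[OF B A smooth_f bc])
  have d1: "((\<lambda>y. G (\<phi> y) w (jac b c f (chart_inv b y) z)) has_derivative
      (\<lambda>u. G (\<phi> ?y0) w (hess b c f p u z) + dG (df p u) w (jac b c f (chart_inv b ?y0) z))) (at ?y0)" for w
    by (rule has_derivative_apply_linear(1)[OF S Gl(2) dGphi da])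
  have "((\<lambda>y. G (\<phi> y) (jac b c f (chart_inv b y) w) (jac b c f (chart_inv b y) z)) has_derivative
      (\<lambda>u. G (\<phi> ?y0) (hess b c f p u w) (jac b c f (chart_inv b ?y0) z) +
        (G (\<phi> ?y0) (jac b c f (chart_inv b ?y0) w) (hess b c f p u z)
          + dG (df p u) (jac b c f (chart_inv b ?y0) w) (jac b c f (chart_inv b ?y0) z)))) (at ?y0)"
    by (rule has_derivative_apply_linear(1)[where L="\<lambda>y w. G (\<phi> y) w (jac b c f (chart_inv b y) z)", OF S Gl(1) d1 da])
  moreover have "g (f p) (hess b c f p u w) (df p z) + (g (f p) (df p w) (hess b c f p u z) + dG (df p u) (df p w) (df p z))
      = g (f p) (second_derivative p u w) (df p z) + g (f p) (df p w) (second_derivative p u z)" for u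
  proof -
    have "dG (df p u) (df p w) (df p z) = g (f p) (christoffel A g (f p) (df p u) (df p w)) (df p z)
        + g (f p) (df p w) (christoffel A g (f p) (df p u) (df p z))"
      unfolding dG_def c_def by (rule christoffel_g(3))
    moreover have "g (f p) (x + y) v = g (f p) x v + g (f p) y v" "g (f p) v (x + y) = g (f p) v x + g (f p) v y" for x y v
      using bilinear_g[of "f p"] by (auto simp: bilinear_ladd bilinear_radd)
    ultimately show ?thesis unfolding second_derivative_def b_def c_def by simp
  qed
  ultimately have "((\<lambda>y. G (\<phi> y) (jac b c f (chart_inv b y) w) (jac b c f (chart_inv b y) z)) has_derivative
      (\<lambda>u. g (f p) (second_derivative p u w) (df p z) + g (f p) (df p w) (second_derivative p u z))) (at ?y0)"
    unfolding inv \<phi>0 G0 df_jac[symmetric] by simp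
  then show ?thesis
  proof (rule has_derivative_transform_within_open[OF _ S])
    fix y assume y: "y \<in> ?S"
    let ?q = "chart_inv b y"
    note q = dom(2,3)[OF y]
    have inv: "chart_inv c (\<phi> y) = f ?q" unfolding \<phi>_def by (rule smooth_structure_chart(5)[OF A bc(2) q(2)])
    have "df ?q (coord_field B b w ?q) = coord_field A c (jac b c f ?q w) (f ?q)" for w
    proof -
      have "to_coords A c (f ?q) (df ?q (coord_field B b w ?q)) = jac b c f ?q w"
        unfolding to_coords_differential[OF B A smooth_f bc(1,2) q] to_coords_coord_field[OF B bc(1) q(1)] ..
      then show ?thesis using coord_field_to_coords[OF A bc(2) q(2)] by metis
    qed
    then show "G (\<phi> y) (jac b c f ?q w) (jac b c f ?q z) = metric_rep B h b y w z"
      unfolding G_def metric_rep_def inv induced_metric_def by simp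
  qed
qed

lemmas christoffel_h = christoffel_properties[OF B bilinear_h sym_h nondeg_h metric_rep_induced_has_derivative]

text \<open>The tangential part of \<open>second_derivative\<close> is symmetric and compatible with
  the induced metric in the same way as the Christoffel symbols of that metric. The difference is
  therefore symmetric in \<open>u\<close> and \<open>w\<close> and skew in \<open>w\<close> and
  \<open>z\<close>.\<close>

lemma second_derivative_normal:
  "g (f p) (second_derivative p u w - df p (christoffel B h p u w)) (df p z) = 0"
proof -
  let ?F = "\<lambda>u w z. g (f p) (second_derivative p u w - df p (christoffel B h p u w)) (df p z)"
  have sub: "?F u w z = g (f p) (second_derivative p u w) (df p z) - h p (christoffel B h p u w) z" for u w z
    using bilinear_g[of "f p"] by (simp add: bilinear_lsub induced_metric_def)
  show ?thesis
  proof (rule symmetric_alternating_zero[where F="?F"])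
    show "?F u w z = ?F w u z" for u w z
      using second_derivative_sym christoffel_h(2) by metis
    show "?F u w z = - ?F u z w" for u w z
      using christoffel_h(3)[of p u w z] unfolding sub
      by (simp add: sym_g[of "f p" "df p w"] sym_h[of p w])
  qed
qed

text \<open>The derivative of \<open>Y\<close> occurs in both connections and cancels, so only
  values at \<open>p\<close> remain: this is tensoriality of B.\<close>

lemma second_fundamental_form_eq:
  assumes DY: "(local_rep B (chart_at B p) Y has_derivative DY) (at (snd (chart_at B p) p))"
  shows "second_fundamental_form B A g f X Y p =
    second_derivative p (X p) (Y p) - df p (christoffel B h p (X p) (Y p))"
proof -
  have "nabla B h Y p (X p) = DY (X p) + christoffel B h p (X p) (Y p)"
    using frechet_derivative_eqI[OF DY]
    unfolding nabla_def nabla_along_def Let_def differential_ident[OF B] local_rep_def[abs_def] by simp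
  then show ?thesis
    unfolding second_fundamental_form_def nabla_along_tangent[OF DY] by (simp add: linear_add[OF linear_df])
qed

end

section \<open>Paraquaternionic CR-submanifolds\<close>

text \<open>Nondegeneracy on \<open>V\<close> provides orthogonal projections \<open>d\<close> of
  \<open>x\<close> and \<open>e\<close> of \<open>z\<close> to \<open>V\<close>. Then
  \<open>x - d\<close> is orthogonal to \<open>e\<close> by the choice of \<open>d\<close>, and to
  \<open>z - e\<close> by the hypothesis on \<open>x\<close> and the choice of
  \<open>e\<close>.\<close>

lemma nondegenerate_double_orthogonal:
  fixes b :: "'a::euclidean_space \<Rightarrow> 'a \<Rightarrow> real"
  assumes b: "bilinear b" "\<And>u v. b u v = b v u" "nondegenerate_on UNIV b"
    and V: "subspace V" "nondegenerate_on V b"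
    and x: "\<And>z. (\<And>w. w \<in> V \<Longrightarrow> b z w = 0) \<Longrightarrow> b x z = 0"
  shows "x \<in> V"
proof -
  have lin: "linear (b z)" for z using b(1) by (auto simp: bilinear_def)
  have rep: "\<exists>d\<in>V. \<forall>w\<in>V. b d w = b z w" for z
    by (rule nondegenerate_represents_on[OF b(1) V(2,1) lin])
  obtain d where d: "d \<in> V" "\<forall>w\<in>V. b d w = b x w" using rep by blast
  have "b (x - d) z = 0" for z
  proof -
    obtain e where e: "e \<in> V" "\<forall>w\<in>V. b e w = b z w" using rep by blast
    have "b (z - e) w = 0" if "w \<in> V" for w using e that b(1) by (simp add: bilinear_lsub)
    then have "b x (z - e) = 0" "b d (z - e) = 0" using x d(1) b(2) by metis+
    then show ?thesis using d e b(1) by (simp add: bilinear_lsub bilinear_rsub)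
  qed
  then have "x - d = 0" using b(3) unfolding nondegenerate_on_def by blast
  then show ?thesis using d(1) by simp
qed

section \<open>Frames of a distribution\<close>

lemma distribution_frame:
  assumes "distribution B D"
  shows "\<exists>k W X. open W \<and> p \<in> W \<and> (\<forall>i<k. smooth_vector_field B W (X i)) \<and>
    (\<forall>x\<in>W. D x = span ((\<lambda>i. X i x) ` {..<k::nat}) \<and> dim (D x) = k)"
proof -
  obtain k where "\<forall>p. \<exists>W X. open W \<and> p \<in> W \<and> (\<forall>i<k. smooth_vector_field B W (X i)) \<and>
    (\<forall>x\<in>W. D x = span ((\<lambda>i. X i x) ` {..<k}) \<and> dim (D x) = k)"
    using assms unfolding distribution_def by (elim exE)
  from spec[OF this, of p] show ?thesis by (rule exI[of _ k])
qed

text \<open>Coefficients are attached to indices instead of vectors: repetitions among the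
  \<open>X i\<close> do no harm, and the same coefficients can be used with the frame at
  neighbouring points.\<close>

lemma span_image_sum_ex:
  fixes X :: "nat \<Rightarrow> 'a::real_vector"
  assumes "v \<in> span (X ` {..<k})"
  shows "\<exists>a. v = (\<Sum>i<k. a i *\<^sub>R X i)"
  using assms
proof (induction k arbitrary: v)
  case 0
  then show ?case by simp
next
  case (Suc k)
  have "v \<in> span (insert (X k) (X ` {..<k}))" using Suc.prems by (simp add: lessThan_Suc)
  then obtain r where "v - r *\<^sub>R X k \<in> span (X ` {..<k})" by (metis span_breakdown_eq)
  then obtain a where "v - r *\<^sub>R X k = (\<Sum>i<k. a i *\<^sub>R X i)" using Suc.IH by blast
  then have "v = (\<Sum>i<Suc k. (if i = k then r else a i) *\<^sub>R X i)" by (simp add: algebra_simps)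
  then show ?case by (rule exI[of _ "\<lambda>i. if i = k then r else a i"])
qed

section \<open>The paraquaternionic structures along the submanifold\<close>

locale cr_submanifold =
  fixes B :: "('n::{t2_space, second_countable_topology}, 'f::euclidean_space) chart set"
    and A :: "('m::{t2_space, second_countable_topology}, 'e::euclidean_space) chart set"
    and \<sigma> :: "'m \<Rightarrow> ('e \<Rightarrow>\<^sub>L 'e) set" and g :: "'m \<Rightarrow> 'e \<Rightarrow> 'e \<Rightarrow> real"
    and f :: "'n \<Rightarrow> 'm" and D :: "'n \<Rightarrow> 'f set"
  assumes strA: "smooth_structure A" and strB: "smooth_structure B"
    and kaehler: "paraquaternionic_kaehler A \<sigma> g"
    and CR: "paraquaternionic_CR_submanifold B A \<sigma> g f D"

sublocale cr_submanifold \<subseteq> submanifold B A g f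
  using strA strB kaehler CR
  by unfold_locales (auto simp: paraquaternionic_kaehler_def almost_paraquaternionic_hermitian_def
      paraquaternionic_CR_submanifold_def)

context cr_submanifold
begin

lemma canonical_basis_exists: "\<exists>U J. x \<in> U \<and> canonical_local_basis A \<sigma> U J"
  using kaehler by (auto simp: paraquaternionic_kaehler_def almost_paraquaternionic_hermitian_def
      almost_paraquaternionic_def)

lemma distribution_D: "distribution B D"
  using CR by (simp add: paraquaternionic_CR_submanifold_def)

lemma subspace_D: "subspace (D p)"
proof -
  obtain k :: nat and W X where "p \<in> W" "\<forall>x\<in>W. D x = span ((\<lambda>i. X i x) ` {..<k}) \<and> dim (D x) = k"
    using distribution_frame[OF distribution_D, of p] by (elim exE conjE)
  then show ?thesis by simp
qed

lemma nondegenerate_D: "nondegenerate_on (D p) (h p)"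
  using CR by (simp add: paraquaternionic_CR_submanifold_def)

lemma canonical_basis_properties:
  assumes J: "canonical_local_basis A \<sigma> U J"
  shows "x \<in> U \<Longrightarrow> J \<alpha> x (J \<alpha> x v) = - eps \<alpha> *\<^sub>R v"
    "x \<in> U \<Longrightarrow> J \<alpha> x (J (\<alpha> + 1) x v) = eps (\<alpha> + 2) *\<^sub>R J (\<alpha> + 2) x v"
    "x \<in> U \<Longrightarrow> J (\<alpha> + 1) x (J \<alpha> x v) = - eps (\<alpha> + 2) *\<^sub>R J (\<alpha> + 2) x v"
    "x \<in> U \<Longrightarrow> \<sigma> x = span (range (\<lambda>\<alpha>. J \<alpha> x))"
    "x \<in> U \<Longrightarrow> g x (J \<alpha> x u) (J \<alpha> x v) = eps \<alpha> * g x u v"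
    "f p \<in> U \<Longrightarrow> J \<alpha> (f p) ` df p ` D p = df p ` D p"
    "f p \<in> U \<Longrightarrow> z \<in> orthogonal_distribution h D p \<Longrightarrow> J \<alpha> (f p) (df p z) \<in> normal_space B A g f p"
proof -
  show "g x (J \<alpha> x u) (J \<alpha> x v) = eps \<alpha> * g x u v" if "x \<in> U"
    using kaehler J that by (simp add: paraquaternionic_kaehler_def almost_paraquaternionic_hermitian_def)
  show "J \<alpha> (f p) ` df p ` D p = df p ` D p" if "f p \<in> U"
    using CR J that unfolding paraquaternionic_CR_submanifold_def by blast
  show "J \<alpha> (f p) (df p z) \<in> normal_space B A g f p" if "f p \<in> U" "z \<in> orthogonal_distribution h D p"
    using CR J that unfolding paraquaternionic_CR_submanifold_def by blast
  have P: "\<sigma> x = span (range (\<lambda>\<alpha>. J \<alpha> x))" "J \<alpha> x o\<^sub>L J \<alpha> x = - eps \<alpha> *\<^sub>R id_blinfun"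
    "J \<alpha> x o\<^sub>L J (\<alpha> + 1) x = eps (\<alpha> + 2) *\<^sub>R J (\<alpha> + 2) x"
    "- (J (\<alpha> + 1) x o\<^sub>L J \<alpha> x) = eps (\<alpha> + 2) *\<^sub>R J (\<alpha> + 2) x" if "x \<in> U"
    using J that unfolding canonical_local_basis_def by blast+
  show "\<sigma> x = span (range (\<lambda>\<alpha>. J \<alpha> x))" if "x \<in> U" by (rule P(1)[OF that])
  show "J \<alpha> x (J \<alpha> x v) = - eps \<alpha> *\<^sub>R v" if "x \<in> U"
    using arg_cong[OF P(2)[OF that], of "\<lambda>F. blinfun_apply F v"]
    by (simp add: blinfun.scaleR_left blinfun.minus_left)
  show "J \<alpha> x (J (\<alpha> + 1) x v) = eps (\<alpha> + 2) *\<^sub>R J (\<alpha> + 2) x v" if "x \<in> U"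
    using arg_cong[OF P(3)[OF that], of "\<lambda>F. blinfun_apply F v"]
    by (simp add: blinfun.scaleR_left)
  show "J (\<alpha> + 1) x (J \<alpha> x v) = - eps (\<alpha> + 2) *\<^sub>R J (\<alpha> + 2) x v" if "x \<in> U"
    using arg_cong[OF P(4)[OF that], of "\<lambda>F. blinfun_apply F v"]
    by (simp add: blinfun.scaleR_left blinfun.minus_left) (metis minus_minus)
qed

text \<open>Parallelism tested on coordinate fields. With \<open>J'\<close> the derivative of the
  matrix of \<open>J \<alpha>\<close> in the preferred chart at \<open>x\<close>, the covariant
  derivative of \<open>J \<alpha>\<close> becomes a formula in the vectors \<open>v\<close> and
  \<open>w\<close>, with one element \<open>T\<close> of \<open>\<sigma> x\<close> serving all
  \<open>w\<close>.\<close>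

lemma canonical_basis_derivative:
  assumes J: "canonical_local_basis A \<sigma> U J" and x: "x \<in> U" 
  defines "c \<equiv> chart_at A x"
  shows "open (snd c ` (fst c \<inter> U))"
    "\<And>y. y \<in> snd c ` (fst c \<inter> U) \<Longrightarrow> linear (\<lambda>w. local_rep A c (\<lambda>q. J \<alpha> q (coord_field A c w q)) y)"
    "\<exists>J'. (\<forall>w. (local_rep A c (\<lambda>q. J \<alpha> q (coord_field A c w q)) has_derivative (\<lambda>v. J' v w)) (at (snd c x))) \<and>
      (\<forall>v. \<exists>T\<in>\<sigma> x. \<forall>w. T w = J' v w + christoffel A g x v (J \<alpha> x w) - J \<alpha> x (christoffel A g x v w))"
proof -
  have c: "c \<in> A" "x \<in> fst c" using chart_at_in[OF strA] by (auto simp: c_def)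
  have U: "open U" using J smooth_structure_chart(1)[OF strA] unfolding canonical_local_basis_def by auto
  have oc: "open (fst c)" by (rule smooth_structure_chart(1)[OF strA c(1)])
  show S: "open (snd c ` (fst c \<inter> U))" by (rule open_chart_image[OF strA c(1) U])
  have x0: "snd c x \<in> snd c ` (fst c \<inter> U)" using c x by blast
  show "linear (\<lambda>w. local_rep A c (\<lambda>q. J \<alpha> q (coord_field A c w q)) y)"
    if "y \<in> snd c ` (fst c \<inter> U)" for y
  proof -
    have q: "chart_inv c y \<in> fst c" using that smooth_structure_chart(5)[OF strA c(1)] by auto
    have "linear (blinfun_apply (J \<alpha> (chart_inv c y)))"
      by (rule bounded_linear.linear[OF blinfun.bounded_linear_right])
    from linear_compose[OF linear_compose[OF linear_coord_field[OF strA c(1) q] this] linear_to_coords[OF strA c(1) q]]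
    show ?thesis unfolding local_rep_def o_def .
  qed
  have smJ: "smooth_endomorphism_field A U (J \<alpha>)"
    using J unfolding canonical_local_basis_def by blast
  define J' where "J' v w = frechet_derivative (local_rep A c (\<lambda>q. J \<alpha> q (coord_field A c w q))) (at (snd c x)) v" for v w
  have J': "(local_rep A c (\<lambda>q. J \<alpha> q (coord_field A c w q)) has_derivative (\<lambda>v. J' v w)) (at (snd c x))" for w
  proof -
    have "smooth_vector_field A (fst c \<inter> U) (\<lambda>q. J \<alpha> q (coord_field A c w q))"
      using smJ c(1) unfolding smooth_endomorphism_field_def by blast
    then have "smooth_on (snd c ` (fst c \<inter> (fst c \<inter> U))) (local_rep A c (\<lambda>q. J \<alpha> q (coord_field A c w q)))"
      using c(1) unfolding smooth_vector_field_iff[OF strA] by blast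
    from smooth_on_has_derivative[OF this, of "snd c x"] show ?thesis
      unfolding J'_def using c(2) x by blast
  qed
  \<comment> \<open>Fields with constant components in \<open>c\<close> are smooth only on the
    domain of \<open>c\<close>, so the set on which parallelism is tested is cut down to it.\<close>
  have smW: "smooth_endomorphism_field A (U \<inter> fst c) (J \<alpha>)"
    unfolding smooth_endomorphism_field_def smooth_vector_field_iff[OF strA]
  proof (intro ballI allI)
    fix d w a assume da: "d \<in> A" "a \<in> A"
    have "smooth_on (snd a ` (fst a \<inter> (fst d \<inter> U))) (local_rep A a (\<lambda>q. J \<alpha> q (coord_field A d w q)))"
      using smJ da unfolding smooth_endomorphism_field_def smooth_vector_field_iff[OF strA] by blast
    then show "smooth_on (snd a ` (fst a \<inter> (fst d \<inter> (U \<inter> fst c)))) (local_rep A a (\<lambda>q. J \<alpha> q (coord_field A d w q)))"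
      by (rule smooth_on_subset) blast
  qed
  have in\<sigma>: "J \<alpha> q \<in> \<sigma> q" if "q \<in> U \<inter> fst c" for q
    using canonical_basis_properties(4)[OF J, of q] that by (auto intro: span_base)
  have par: "parallel_subbundle A g \<sigma>" using kaehler by (simp add: paraquaternionic_kaehler_def)
  have T_ex: "\<exists>T\<in>\<sigma> x. \<forall>w. T w = J' v w + christoffel A g x v (J \<alpha> x w) - J \<alpha> x (christoffel A g x v w)" for v
  proof -
    have "open (U \<inter> fst c)" "x \<in> U \<inter> fst c" using U oc x c by auto
    then obtain T where T: "T \<in> \<sigma> x" "\<forall>Y. smooth_vector_field A (U \<inter> fst c) Y \<longrightarrow>
        T (Y x) = nabla A g (\<lambda>q. J \<alpha> q (Y q)) x v - J \<alpha> x (nabla A g Y x v)"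
      using par smW in\<sigma> unfolding parallel_subbundle_def by meson
    have "T w = J' v w + christoffel A g x v (J \<alpha> x w) - J \<alpha> x (christoffel A g x v w)" for w
    proof -
      have sm: "smooth_vector_field A (U \<inter> fst c) (coord_field A c w)"
        unfolding smooth_vector_field_iff[OF strA]
      proof
        fix a assume "a \<in> A"
        then have "smooth_on (snd a ` (fst a \<inter> fst c)) (local_rep A a (coord_field A c w))"
          using smooth_coord_field[OF strA c(1)] unfolding smooth_vector_field_iff[OF strA] by blast
        then show "smooth_on (snd a ` (fst a \<inter> (U \<inter> fst c))) (local_rep A a (coord_field A c w))"
          by (rule smooth_on_subset) blast
      qed
      have Yx: "coord_field A c w x = w" unfolding c_def by (rule coord_field_chart_at[OF strA])
      have nab: "nabla A g Y x v = frechet_derivative (local_rep A c Y) (at (snd c x)) v + christoffel A g x v (Y x)" for Y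
        unfolding nabla_def nabla_along_def Let_def differential_ident[OF strA] local_rep_def[abs_def] c_def by simp
      \<comment> \<open>The components are constant, so the covariant derivative of the test field
        is its Christoffel term alone.\<close>
      have "(local_rep A c (coord_field A c w) has_derivative (\<lambda>v. 0)) (at (snd c x))"
      proof (rule has_derivative_transform_within_open[OF has_derivative_const[of w] S x0])
        fix y assume "y \<in> snd c ` (fst c \<inter> U)"
        then have "chart_inv c y \<in> fst c" using smooth_structure_chart(5)[OF strA c(1)] by auto
        then show "w = local_rep A c (coord_field A c w) y"
          unfolding local_rep_def by (simp add: to_coords_coord_field[OF strA c(1)])
      qed
      from frechet_derivative_eqI[OF this] frechet_derivative_eqI[OF J'[of w]]
      show ?thesis
        using T(2)[rule_format, OF sm] unfolding nab Yx by simp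
    qed
    then show ?thesis using T(1) by blast
  qed
  show "\<exists>J'. (\<forall>w. (local_rep A c (\<lambda>q. J \<alpha> q (coord_field A c w q)) has_derivative (\<lambda>v. J' v w)) (at (snd c x))) \<and>
      (\<forall>v. \<exists>T\<in>\<sigma> x. \<forall>w. T w = J' v w + christoffel A g x v (J \<alpha> x w) - J \<alpha> x (christoffel A g x v w))"
    using J' T_ex by (intro exI[of _ J'] conjI allI)
qed

text \<open>The field \<open>J (df Y)\<close> stays in \<open>df D\<close>, hence is
  \<open>df Y'\<close> for a field \<open>Y'\<close> of \<open>D\<close>. Its covariant derivative
  is that of \<open>df Y\<close> transformed by \<open>J\<close>, up to the derivative
  \<open>T\<close> of \<open>J\<close>. Differentiability at \<open>p\<close> is all that is assumed
  of \<open>Y\<close> and all that is obtained for \<open>Y'\<close>.\<close>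

lemma section_transform:
  assumes J: "canonical_local_basis A \<sigma> U J" and p: "f p \<in> U"
    and W: "open W" "p \<in> W" "\<And>q. q \<in> W \<Longrightarrow> Y q \<in> D q"
    and DY: "(local_rep B (chart_at B p) Y has_derivative DY) (at (snd (chart_at B p) p))"
  obtains W' Y' DY' where "open W'" "p \<in> W'" "\<And>q. q \<in> W' \<Longrightarrow> Y' q \<in> D q"
    "(local_rep B (chart_at B p) Y' has_derivative DY') (at (snd (chart_at B p) p))"
    "df p (Y' p) = J \<alpha> (f p) (df p (Y p))"
    "\<And>v. \<exists>T\<in>\<sigma> (f p). df p (DY' v) + second_derivative p v (Y' p) =
       T (df p (Y p)) + J \<alpha> (f p) (df p (DY v) + second_derivative p v (Y p))"
proof -
  define b where "b = chart_at B p"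
  define c where "c = chart_at A (f p)"
  have bc: "b \<in> B" "c \<in> A" "p \<in> fst b" "f p \<in> fst c"
    using chart_at_in[OF B] chart_at_in[OF A] by (auto simp: b_def c_def)
  let ?y0 = "snd b p"
  have inv: "chart_inv b ?y0 = p" by (rule smooth_structure_chart(5)[OF B bc(1,3)])
  have df_jac: "df p = jac b c f p" by (simp add: differential_eq_jac b_def c_def)
  have U: "open U" using J smooth_structure_chart(1)[OF A] unfolding canonical_local_basis_def by auto
  have ofU: "open (f -` U)" "open (f -` fst c)"
    using smooth_f U smooth_structure_chart(1)[OF A bc(2)] unfolding smooth_map_def
    by (auto simp: continuous_on_eq_continuous_at open_vimage)
  define W' where "W' = W \<inter> f -` U \<inter> f -` fst c"
  have W': "open W'" "p \<in> W'" using W ofU p bc by (auto simp: W'_def)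
  define S where "S = snd b ` (fst b \<inter> W')"
  have S: "open S" "?y0 \<in> S" unfolding S_def using open_chart_image[OF B bc(1) W'(1)] bc W'(2) by auto
  have SD: "chart_inv b y \<in> W'" "chart_inv b y \<in> fst b" "y \<in> snd b ` (fst b \<inter> f -` fst c)"
    "f (chart_inv b y) \<in> fst c" "f (chart_inv b y) \<in> U" if "y \<in> S" for y
    using that smooth_structure_chart(5)[OF B bc(1)] unfolding S_def W'_def by auto
  have "\<exists>w\<in>D q. df q w = J \<alpha> (f q) (df q (Y q))" if q: "q \<in> W'" for q
  proof -
    have "J \<alpha> (f q) (df q (Y q)) \<in> df q ` D q"
      using canonical_basis_properties(6)[OF J, of q \<alpha>] q W(3)[of q] unfolding W'_def by blast
    then show ?thesis by (metis imageE)
  qed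
  \<comment> \<open>A mere choice at each point, with no regularity in \<open>q\<close>; the
    derivative at \<open>p\<close> is recovered below from the linear equation
    \<open>sol\<close>.\<close>
  then obtain Y' where Y': "\<And>q. q \<in> W' \<Longrightarrow> Y' q \<in> D q" "\<And>q. q \<in> W' \<Longrightarrow> df q (Y' q) = J \<alpha> (f q) (df q (Y q))"
    by metis
  define Jr where "Jr y w = local_rep A c (\<lambda>q. J \<alpha> q (coord_field A c w q)) y" for y w
  define \<phi> where "\<phi> y = snd c (f (chart_inv b y))" for y
  define z where "z y = to_coords A c (f (chart_inv b y)) (df (chart_inv b y) (Y (chart_inv b y)))" for y
  note cbd = canonical_basis_derivative[OF J p, folded c_def]
  obtain J' where J': "\<And>w. (local_rep A c (\<lambda>q. J \<alpha> q (coord_field A c w q)) has_derivative (\<lambda>v. J' v w)) (at (snd c (f p)))"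
    and T_ex: "\<And>v. \<exists>T\<in>\<sigma> (f p). \<forall>w. T w = J' v w + christoffel A g (f p) v (J \<alpha> (f p) w) - J \<alpha> (f p) (christoffel A g (f p) v w)"
    using cbd(3)[of \<alpha>] by (elim exE conjE) blast
  have dphi: "(\<phi> has_derivative df p) (at ?y0)"
    unfolding \<phi>_def[abs_def] df_jac by (rule jac_has_derivative[OF B A smooth_f bc])
  have \<phi>0: "\<phi> ?y0 = snd c (f p)" by (simp add: \<phi>_def inv)
  have dz: "(z has_derivative (\<lambda>v. df p (DY v) + hess b c f p v (Y p))) (at ?y0)"
    using has_derivative_differential[OF B A smooth_f bc DY[folded b_def]]
    unfolding z_def[abs_def] df_jac b_def to_coords_chart_at[OF B] .
  have z0: "z ?y0 = df p (Y p)" unfolding z_def inv c_def to_coords_chart_at[OF A] ..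
  have Jr0: "Jr (\<phi> ?y0) w = J \<alpha> (f p) w" for w
    unfolding Jr_def \<phi>0 local_rep_def smooth_structure_chart(5)[OF A bc(2,4)]
    unfolding c_def to_coords_chart_at[OF A] coord_field_chart_at[OF A] ..
  have \<phi>S: "\<phi> y \<in> snd c ` (fst c \<inter> U)" if "y \<in> S" for y
    using SD(4,5)[OF that] unfolding \<phi>_def by blast
  have linJr: "linear (Jr (\<phi> y))" if "y \<in> S" for y
    unfolding Jr_def by (rule cbd(2)[OF \<phi>S[OF that]])
  have dJr: "((\<lambda>y. Jr (\<phi> y) w) has_derivative (\<lambda>v. J' (df p v) w)) (at ?y0)" for w
  proof -
    have "((\<lambda>y. Jr y w) has_derivative (\<lambda>v. J' v w)) (at (\<phi> ?y0))" unfolding Jr_def \<phi>0 by (rule J')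
    from has_derivative_compose[OF dphi this] show ?thesis .
  qed
  have dJz: "((\<lambda>y. Jr (\<phi> y) (z y)) has_derivative
      (\<lambda>v. Jr (\<phi> ?y0) (df p (DY v) + hess b c f p v (Y p)) + J' (df p v) (z ?y0))) (at ?y0)"
    by (rule has_derivative_apply_linear(1)[OF S linJr dJr dz])
  have lin: "linear (jac b c f (chart_inv b y))" if "y \<in> S" for y
    by (rule linear_jac[OF B A smooth_f bc(1,2) SD(2)[OF that] SD(4)[OF that]])
  have injp: "inj (jac b c f (chart_inv b ?y0))" unfolding inv df_jac[symmetric] by (rule inj_df)
  have sol: "jac b c f (chart_inv b y) (local_rep B b Y' y) = Jr (\<phi> y) (z y)" if y: "y \<in> S" for y
  proof -
    let ?q = "chart_inv b y"
    note q = SD[OF y]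
    have invc: "chart_inv c (\<phi> y) = f ?q" unfolding \<phi>_def by (rule smooth_structure_chart(5)[OF A bc(2) q(4)])
    have "jac b c f ?q (local_rep B b Y' y) = to_coords A c (f ?q) (df ?q (Y' ?q))"
      unfolding local_rep_def by (rule to_coords_differential[OF B A smooth_f bc(1,2) q(2,4), symmetric])
    also have "\<dots> = to_coords A c (f ?q) (J \<alpha> (f ?q) (df ?q (Y ?q)))" unfolding Y'(2)[OF q(1)] ..
    also have "\<dots> = Jr (\<phi> y) (z y)"
      unfolding Jr_def local_rep_def invc z_def coord_field_to_coords[OF A bc(2) q(4)] ..
    finally show ?thesis .
  qed
  obtain DY' where DY': "(local_rep B b Y' has_derivative DY') (at ?y0)"
    and DY'_eq: "\<And>v. jac b c f (chart_inv b ?y0) (DY' v) = (Jr (\<phi> ?y0) (df p (DY v) + hess b c f p v (Y p)) + J' (df p v) (z ?y0))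
      - hess b c f p v (local_rep B b Y' ?y0)"
    using implicit_linear_has_derivative[where A="\<lambda>y. jac b c f (chart_inv b y)" and S=S, OF S lin
        hess_has_derivative[OF B A smooth_f bc] injp dJz sol] by metis
  have Y'0: "local_rep B b Y' ?y0 = Y' p"
    unfolding local_rep_def inv unfolding b_def to_coords_chart_at[OF B] ..
  have fin: "\<exists>T\<in>\<sigma> (f p). df p (DY' v) + second_derivative p v (Y' p) =
       T (df p (Y p)) + J \<alpha> (f p) (df p (DY v) + second_derivative p v (Y p))" for v
  proof -
    obtain T where T: "T \<in> \<sigma> (f p)" "\<And>w. T w = J' (df p v) w + christoffel A g (f p) (df p v) (J \<alpha> (f p) w)
        - J \<alpha> (f p) (christoffel A g (f p) (df p v) w)"
      using T_ex[of "df p v"] by blast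
    \<comment> \<open>The Hessian term of \<open>Y'\<close> cancels by \<open>DY'_eq\<close>. The
      derivative of the matrix of \<open>J\<close> and the two Christoffel terms then combine to
      \<open>T\<close>.\<close>
    have "df p (DY' v) + second_derivative p v (Y' p) = df p (DY' v) + hess b c f p v (Y' p)
        + christoffel A g (f p) (df p v) (df p (Y' p))"
      unfolding second_derivative_def b_def c_def by simp
    also have "\<dots> = J \<alpha> (f p) (df p (DY v) + hess b c f p v (Y p)) + J' (df p v) (df p (Y p))
        + christoffel A g (f p) (df p v) (J \<alpha> (f p) (df p (Y p)))"
      using DY'_eq[of v] unfolding inv df_jac[symmetric] Y'0 Jr0 z0 Y'(2)[OF W'(2)] by simp
    also have "\<dots> = T (df p (Y p)) + J \<alpha> (f p) (df p (DY v) + second_derivative p v (Y p))"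
      unfolding T(2) second_derivative_def b_def c_def by (simp add: blinfun.add_right)
    finally show ?thesis using T(1) by blast
  qed
  show thesis
    by (rule that[OF W' Y'(1) DY'[unfolded b_def] Y'(2)[OF W'(2)] fin])
qed

text \<open>A combination of the local frame with constant coefficients already attains every
  value.\<close>

lemma section_through:
  assumes "v \<in> D p"
  obtains W Y where "open W" "p \<in> W" "smooth_vector_field B W Y" "\<And>q. q \<in> W \<Longrightarrow> Y q \<in> D q" "Y p = v"
proof -
  obtain k W X where W: "open W" "p \<in> W" "\<forall>i<k. smooth_vector_field B W (X i)"
    and X: "\<forall>x\<in>W. D x = span ((\<lambda>i. X i x) ` {..<k::nat}) \<and> dim (D x) = k"
    using distribution_frame[OF distribution_D, of p] by (elim exE conjE)
  have "v \<in> span ((\<lambda>i. X i p) ` {..<k})" using assms X W(2) by blast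
  then obtain a where a: "v = (\<Sum>i<k. a i *\<^sub>R X i p)"
    using span_image_sum_ex[of v "\<lambda>i. X i p" k] by blast
  define Y where "Y q = (\<Sum>i<k. a i *\<^sub>R X i q)" for q
  have smY: "smooth_vector_field B W Y"
    unfolding smooth_vector_field_iff[OF B]
  proof
    fix c assume c: "c \<in> B"
    have S: "open (snd c ` (fst c \<inter> W))" by (rule open_chart_image[OF B c W(1)])
    have "smooth_on (snd c ` (fst c \<inter> W)) (\<lambda>y. \<Sum>i<k. a i *\<^sub>R local_rep B c (X i) y)"
      using W(3) c unfolding smooth_on_def smooth_vector_field_iff[OF B]
      by (auto intro!: Ck_on_sum S Ck_on_bounded_linear[OF bounded_linear_scaleR_right])
    then show "smooth_on (snd c ` (fst c \<inter> W)) (local_rep B c Y)"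
    proof (rule smooth_on_cong[OF S, rotated])
      fix y assume "y \<in> snd c ` (fst c \<inter> W)"
      then have q: "chart_inv c y \<in> fst c" using smooth_structure_chart(5)[OF B c] by auto
      show "(\<Sum>i<k. a i *\<^sub>R local_rep B c (X i) y) = local_rep B c Y y"
        unfolding local_rep_def Y_def linear_sum[OF linear_to_coords[OF B c q]] linear_cmul[OF linear_to_coords[OF B c q]] ..
    qed
  qed
  have "Y q \<in> D q" if "q \<in> W" for q
    using X that unfolding Y_def by (auto intro!: span_sum span_scale intro: span_base)
  moreover have "Y p = v" by (simp add: Y_def a)
  ultimately show thesis by (rule that[OF W(1,2) smY])
qed

lemma smooth_field_has_derivative:
  assumes "smooth_vector_field B W Y" "p \<in> W" "b \<in> B" "p \<in> fst b"
  shows "(local_rep B b Y has_derivative frechet_derivative (local_rep B b Y) (at (snd b p))) (at (snd b p))"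
  by (rule smooth_on_has_derivative[of "snd b ` (fst b \<inter> W)"])
    (use assms in \<open>auto simp: smooth_vector_field_iff[OF B]\<close>)

lemma \<sigma>_preserves:
  assumes "T \<in> \<sigma> (f p)" "v \<in> D p"
  shows "T (df p v) \<in> df p ` D p"
proof -
  obtain U J where J: "f p \<in> U" "canonical_local_basis A \<sigma> U J" using canonical_basis_exists by blast
  have sub: "subspace (df p ` D p)" by (rule linear_subspace_image[OF linear_df subspace_D])
  have "T \<in> span (range (\<lambda>\<alpha>. J \<alpha> (f p)))"
    using assms(1) canonical_basis_properties(4)[OF J(2,1)] by simp
  then show ?thesis
  proof (induction rule: span_induct)
    case base
    show ?case unfolding subspace_def
      using subspace_0[OF sub] subspace_add[OF sub] subspace_scale[OF sub]
      by (simp add: blinfun.add_left blinfun.scaleR_left)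
  next
    case (step T)
    then obtain \<alpha> where "T = J \<alpha> (f p)" by blast
    then show ?case using canonical_basis_properties(6)[OF J(2,1), of \<alpha>] assms(2) by blast
  qed
qed

text \<open>If \<open>D\<close> is involutive, the part of the second derivative normal to \<open>D\<close> is \<open>J\<close>-linear in the second
  argument and symmetric, hence bilinear over two anticommuting structures, hence zero.\<close>

lemma involutive_imp_second_derivative_tangent:
  assumes inv: "involutive_at B D (chart_at B p) p" and u: "u \<in> D p" and v: "v \<in> D p"
  shows "second_derivative p u v \<in> range (df p)"
proof -
  define R where "R = df p ` D p"
  have R: "subspace R" unfolding R_def by (rule linear_subspace_image[OF linear_df subspace_D])
  obtain Q where Q: "bilinear Q" "\<forall>u w. Q u w = Q w u"
    and Qd: "\<forall>Y W DY. open W \<and> p \<in> W \<and> (\<forall>q\<in>W. Y q \<in> D q) \<and>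
       (local_rep B (chart_at B p) Y has_derivative DY) (at (snd (chart_at B p) p)) \<longrightarrow>
       (\<forall>v\<in>D p. DY v - Q v (Y p) \<in> D p)"
    using inv unfolding involutive_at_def to_coords_chart_at[OF B] image_ident by (elim exE conjE)
  \<comment> \<open>By involutivity \<open>DY v\<close> equals \<open>Q v (Y p)\<close> modulo
    \<open>D p\<close>, so \<open>S v (Y p)\<close> is the covariant derivative of
    \<open>df Y\<close> modulo \<open>R\<close>, now expressed by two vectors at
    \<open>p\<close>.\<close>
  define S where "S u w = second_derivative p u w + df p (Q u w)" for u w
  have symS: "S u w = S w u" for u w
    unfolding S_def using second_derivative_sym Q(2) by metis
  obtain U J where J: "f p \<in> U" "canonical_local_basis A \<sigma> U J" using canonical_basis_exists by blast
  note cb = canonical_basis_properties[OF J(2)]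
  have JR: "J \<alpha> (f p) r \<in> R" if "r \<in> R" for \<alpha> r
    using cb(6)[OF J(1), of \<alpha>] that unfolding R_def by blast
  have step: "\<exists>w'\<in>D p. df p w' = J \<alpha> (f p) (df p w) \<and> (\<forall>x\<in>D p. S x w' - J \<alpha> (f p) (S x w) \<in> R)"
    if w: "w \<in> D p" for \<alpha> w
  proof -
    obtain W Y where W: "open W" "p \<in> W" "smooth_vector_field B W Y" "\<And>q. q \<in> W \<Longrightarrow> Y q \<in> D q" "Y p = w"
      by (rule section_through[OF w]) blast
    define DY where "DY = frechet_derivative (local_rep B (chart_at B p) Y) (at (snd (chart_at B p) p))"
    have DY: "(local_rep B (chart_at B p) Y has_derivative DY) (at (snd (chart_at B p) p))"
      unfolding DY_def by (rule smooth_field_has_derivative[OF W(3,2) chart_at_in[OF B]])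
    obtain W' Y' DY' where W': "open W'" "p \<in> W'" "\<And>q. q \<in> W' \<Longrightarrow> Y' q \<in> D q"
      and DY': "(local_rep B (chart_at B p) Y' has_derivative DY') (at (snd (chart_at B p) p))"
      and Y'p: "df p (Y' p) = J \<alpha> (f p) (df p (Y p))"
      and cov: "\<And>v. \<exists>T\<in>\<sigma> (f p). df p (DY' v) + second_derivative p v (Y' p) =
       T (df p (Y p)) + J \<alpha> (f p) (df p (DY v) + second_derivative p v (Y p))"
      by (rule section_transform[OF J(2,1) W(1,2,4) DY, of \<alpha>]) blast+
    have "S x (Y' p) - J \<alpha> (f p) (S x w) \<in> R" if x: "x \<in> D p" for x
    proof -
      obtain T where T: "T \<in> \<sigma> (f p)" "df p (DY' x) + second_derivative p x (Y' p) =
         T (df p w) + J \<alpha> (f p) (df p (DY x) + second_derivative p x w)"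
        using cov[of x] W(5) by blast
      have 1: "df p (DY x - Q x w) \<in> R" "df p (DY' x - Q x (Y' p)) \<in> R"
        using Qd[rule_format, of W Y DY x] Qd[rule_format, of W' Y' DY' x] W W' DY DY' x unfolding R_def by auto
      have "S x (Y' p) - J \<alpha> (f p) (S x w) = T (df p w) + J \<alpha> (f p) (df p (DY x - Q x w)) - df p (DY' x - Q x (Y' p))"
        using T(2) unfolding S_def by (simp add: linear_diff[OF linear_df] blinfun.diff_right blinfun.add_right algebra_simps)
      also have "\<dots> \<in> R"
        using \<sigma>_preserves[OF T(1) w] 1 JR R unfolding R_def[symmetric] by (intro subspace_diff subspace_add) auto
      finally show ?thesis .
    qed
    then show ?thesis using W'(2,3) Y'p W(5) by (intro bexI[of _ "Y' p"] conjI) auto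
  qed
  \<comment> \<open>Any index would do: what counts is that \<open>J \<alpha>\<close> and
    \<open>J (\<alpha> + 1)\<close> anticommute and that \<open>eps (\<alpha> + 2)\<close> has
    square 1.\<close>
  define \<alpha> :: 3 where "\<alpha> = 1"
  obtain u1 where u1: "u1 \<in> D p" "\<And>x. x \<in> D p \<Longrightarrow> S x u1 - J \<alpha> (f p) (S x u) \<in> R"
    using step[OF u, of \<alpha>] by blast
  obtain v2 where v2: "v2 \<in> D p" "\<And>x. x \<in> D p \<Longrightarrow> S x v2 - J (\<alpha> + 1) (f p) (S x v) \<in> R"
    using step[OF v, of "\<alpha> + 1"] by blast
  define s where "s = S u v"
  \<comment> \<open>\<open>S u1 v2\<close> is evaluated twice, pulling out first the structure of
    the second argument or, by symmetry, that of the first. The two resulting compositions differ by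
    a sign.\<close>
  have "S u1 v2 - J (\<alpha> + 1) (f p) (J \<alpha> (f p) s) \<in> R"
  proof -
    have "(S u1 v2 - J (\<alpha> + 1) (f p) (S u1 v)) + J (\<alpha> + 1) (f p) (S v u1 - J \<alpha> (f p) (S v u)) \<in> R"
      by (rule subspace_add[OF R v2(2)[OF u1(1)] JR[OF u1(2)[OF v]]])
    then show ?thesis by (simp add: s_def symS[of v] blinfun.diff_right)
  qed
  moreover have "S u1 v2 - J \<alpha> (f p) (J (\<alpha> + 1) (f p) s) \<in> R"
  proof -
    have "(S v2 u1 - J \<alpha> (f p) (S v2 u)) + J \<alpha> (f p) (S u v2 - J (\<alpha> + 1) (f p) (S u v)) \<in> R"
      by (rule subspace_add[OF R u1(2)[OF v2(1)] JR[OF v2(2)[OF u]]])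
    then show ?thesis by (simp add: s_def symS[of v2] blinfun.diff_right)
  qed
  ultimately have "J \<alpha> (f p) (J (\<alpha> + 1) (f p) s) - J (\<alpha> + 1) (f p) (J \<alpha> (f p) s) \<in> R"
    using subspace_diff[OF R] by fastforce
  then have "(2 * eps (\<alpha> + 2)) *\<^sub>R J (\<alpha> + 2) (f p) s \<in> R"
    unfolding cb(2,3)[OF J(1)] by (simp add: scaleR_add_left[symmetric])
  \<comment> \<open>The square of \<open>J (\<alpha> + 2)\<close> is a nonzero multiple of the
    identity, so applying it once more isolates a multiple of \<open>s\<close>.\<close>
  from JR[OF this, of "\<alpha> + 2"] have "(2 * eps (\<alpha> + 2) * - eps (\<alpha> + 2)) *\<^sub>R s \<in> R"
    by (simp add: blinfun.scaleR_right cb(1)[OF J(1)])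
  then have "(- 2) *\<^sub>R s \<in> R" by (simp add: eps_def split: if_splits)
  from subspace_scale[OF R this, of "- 1 / 2"] have "s \<in> R" by simp
  then obtain d where "s = df p d" unfolding R_def by blast
  then have "second_derivative p u v = df p (d - Q u v)"
    unfolding s_def S_def by (simp add: linear_diff[OF linear_df] algebra_simps)
  then show ?thesis by blast
qed

lemma involutive_imp_totally_geodesic:
  assumes inv: "involutive_at B D (chart_at B p) p" and u: "u \<in> D p" and v: "v \<in> D p"
  shows "second_derivative p u v = df p (christoffel B h p u v)"
proof -
  obtain w where w: "second_derivative p u v = df p w"
    using involutive_imp_second_derivative_tangent[OF assms] by blast
  have "h p (w - christoffel B h p u v) z = 0" for z
    using second_derivative_normal[of p u v z] unfolding w induced_metric_def linear_diff[OF linear_df] .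
  then have "w - christoffel B h p u v = 0" using nondeg_h[of p] unfolding nondegenerate_on_def by blast
  then show ?thesis using w by simp
qed

lemma totally_geodesic_imp_involutive:
  assumes tg: "\<And>u v. u \<in> D p \<Longrightarrow> v \<in> D p \<Longrightarrow> second_derivative p u v = df p (christoffel B h p u v)"
  shows "involutive_at B D (chart_at B p) p"
\<comment> \<open>With this \<open>Q\<close> the expression \<open>DY v - Q v (Y p)\<close> is the
  covariant derivative of \<open>Y\<close> for the induced metric.\<close>
proof (rule involutive_atI[where Q="\<lambda>u v. - christoffel B h p u v"])
  show "bilinear (\<lambda>u v. - christoffel B h p u v)"
    using christoffel_h(1)[of p] unfolding bilinear_def by (auto intro: linear_compose_neg)
  show "- christoffel B h p u w = - christoffel B h p w u" for u w
    using christoffel_h(2) by metis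
  fix Y W DY v
  assume W: "open W" "p \<in> W" "\<And>q. q \<in> W \<Longrightarrow> Y q \<in> D q"
    and DY: "(local_rep B (chart_at B p) Y has_derivative DY) (at (snd (chart_at B p) p))"
    and "v \<in> to_coords B (chart_at B p) p ` D p"
  then have v: "v \<in> D p" by (simp add: to_coords_chart_at[OF B])
  have Yp: "Y p \<in> D p" using W by blast
  have "DY v + christoffel B h p v (Y p) \<in> D p"
  proof (rule nondegenerate_double_orthogonal[OF bilinear_h sym_h nondeg_h subspace_D nondegenerate_D])
    fix z assume "\<And>w. w \<in> D p \<Longrightarrow> h p z w = 0"
    then have z: "z \<in> orthogonal_distribution h D p" by (simp add: orthogonal_distribution_def)
    obtain U J where J: "f p \<in> U" "canonical_local_basis A \<sigma> U J" using canonical_basis_exists by blast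
    define \<alpha> :: 3 where "\<alpha> = 1"
    note cb = canonical_basis_properties[OF J(2)]
    define \<xi> where "\<xi> = J \<alpha> (f p) (df p z)"
    have \<xi>: "g (f p) (df p w) \<xi> = 0" for w
      using cb(7)[OF J(1) z, of \<alpha>] unfolding \<xi>_def normal_space_def sym_g[of "f p" "df p w"] by blast
    obtain W' Y' DY' where W': "open W'" "p \<in> W'" "\<And>q. q \<in> W' \<Longrightarrow> Y' q \<in> D q"
      and DY': "(local_rep B (chart_at B p) Y' has_derivative DY') (at (snd (chart_at B p) p))"
      and Y'p: "df p (Y' p) = J \<alpha> (f p) (df p (Y p))"
      and cov: "\<And>v. \<exists>T\<in>\<sigma> (f p). df p (DY' v) + second_derivative p v (Y' p) =
       T (df p (Y p)) + J \<alpha> (f p) (df p (DY v) + second_derivative p v (Y p))"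
      by (rule section_transform[OF J(2,1) W DY, of \<alpha>]) blast+
    obtain T where T: "T \<in> \<sigma> (f p)" "df p (DY' v) + second_derivative p v (Y' p) =
       T (df p (Y p)) + J \<alpha> (f p) (df p (DY v) + second_derivative p v (Y p))"
      using cov by blast
    obtain t where t: "T (df p (Y p)) = df p t" using \<sigma>_preserves[OF T(1) Yp] by blast
    have Y'p': "Y' p \<in> D p" using W' by blast
    \<comment> \<open>By assumption both second derivatives are tangential, so the right-hand side
      is tangent to the submanifold and its product with the normal vector \<open>\<xi>\<close>
      vanishes. On the left \<open>J \<alpha>\<close> is an isometry up to sign and drops out of the
      product.\<close>
    have "J \<alpha> (f p) (df p (DY v + christoffel B h p v (Y p)))
        = df p (DY' v + christoffel B h p v (Y' p) - t)"
      using T(2) unfolding tg[OF v Yp] tg[OF v Y'p'] t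
      by (simp add: linear_add[OF linear_df] linear_diff[OF linear_df] algebra_simps)
    then have "eps \<alpha> * h p (DY v + christoffel B h p v (Y p)) z = 0"
      using cb(5)[OF J(1), of \<alpha> "df p (DY v + christoffel B h p v (Y p))" "df p z"] \<xi>
      unfolding \<xi>_def induced_metric_def by simp
    then show "h p (DY v + christoffel B h p v (Y p)) z = 0" by (simp add: eps_def split: if_splits)
  qed
  then show "DY v - - christoffel B h p v (to_coords B (chart_at B p) p (Y p)) \<in> to_coords B (chart_at B p) p ` D p"
    by (simp add: to_coords_chart_at[OF B])
qed

end

section \<open>Frobenius' theorem\<close>

text \<open>Maximality of the atlas admits the composite of a chart with a diffeomorphism of open
  sets. The inverse \<open>\<psi>\<close> is supplied explicitly together with its smoothness, so no
  inverse function theorem enters.\<close>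

lemma chart_reparametrization:
  fixes B :: "('n::{t2_space, second_countable_topology}, 'f::euclidean_space) chart set"
  assumes B: "smooth_structure B" and b: "b \<in> B"
    and \<Omega>: "open \<Omega>" "\<Omega> \<subseteq> snd b ` fst b" and \<phi>: "smooth_on \<Omega> \<phi>" "open (\<phi> ` \<Omega>)"
    and \<psi>: "smooth_on (\<phi> ` \<Omega>) \<psi>" "\<And>y. y \<in> \<Omega> \<Longrightarrow> \<psi> (\<phi> y) = y"
  defines "c \<equiv> ({q \<in> fst b. snd b q \<in> \<Omega>}, \<lambda>q. \<phi> (snd b q))"
  shows "c \<in> B"
    and "q \<in> fst c \<Longrightarrow> to_coords B c q v = frechet_derivative \<phi> (at (snd b q)) (to_coords B b q v)"
proof -
  note ch = smooth_structure_chart[OF B b]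
  have fc: "q \<in> fst c \<longleftrightarrow> q \<in> fst b \<and> snd b q \<in> \<Omega>" and sc: "snd c q = \<phi> (snd b q)" for q
    by (auto simp: c_def)
  have fc_eq: "fst c = fst b \<inter> snd b -` \<Omega>" by (auto simp: c_def)
  have im: "snd c ` (fst c \<inter> X) = \<phi> ` (\<Omega> \<inter> snd b ` (fst b \<inter> X))" for X
    using \<Omega>(2) ch(5,6) by (auto simp: c_def image_iff)
  have im0: "snd c ` fst c = \<phi> ` \<Omega>" using im[of UNIV] \<Omega>(2) by (simp add: Int_absorb2)
  have opc: "open (fst c)"
    unfolding fc_eq by (rule continuous_open_preimage[OF ch(3,1) \<Omega>(1)])
  have inj: "inj_on (snd c) (fst c)"
  proof (rule inj_onI)
    fix q q' assume q: "q \<in> fst c" "q' \<in> fst c" "snd c q = snd c q'"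
    then have "snd b q = snd b q'" using \<psi>(2) unfolding fc sc by metis
    then show "q = q'" using ch(5) q(1,2) unfolding fc by metis
  qed
  have invc: "chart_inv c (\<phi> y) = chart_inv b y" if y: "y \<in> \<Omega>" for y
  proof -
    have yb: "y \<in> snd b ` fst b" using \<Omega>(2) y by blast
    have "chart_inv b y \<in> fst c" "snd c (chart_inv b y) = \<phi> y"
      unfolding fc sc using ch(6,7)[OF yb] y by auto
    then show ?thesis unfolding chart_inv_def[of c] using inv_into_f_f[OF inj] by metis
  qed
  have contphi: "continuous_on \<Omega> \<phi>" and contpsi: "continuous_on (\<phi> ` \<Omega>) \<psi>"
    using \<phi>(1) \<psi>(1) unfolding smooth_on_def by (metis Ck_on.simps(1))+
  have "homeomorphism (fst c) (snd c ` fst c) (snd c) (chart_inv c)"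
  proof (rule homeomorphismI)
    show "continuous_on (fst c) (snd c)"
      unfolding sc[abs_def]
      by (rule continuous_on_compose2[OF contphi continuous_on_subset[OF ch(3)]]) (auto simp: fc)
    have "continuous_on (\<phi> ` \<Omega>) (\<lambda>\<eta>. chart_inv b (\<psi> \<eta>))"
      by (rule continuous_on_compose2[OF ch(4) contpsi]) (use \<psi>(2) \<Omega>(2) in auto)
    moreover have "chart_inv b (\<psi> \<eta>) = chart_inv c \<eta>" if "\<eta> \<in> \<phi> ` \<Omega>" for \<eta>
      using that invc \<psi>(2) by auto
    ultimately show "continuous_on (snd c ` fst c) (chart_inv c)"
      unfolding im0 by (rule continuous_on_eq)
    show "chart_inv c (snd c q) = q" if "q \<in> fst c" for q
      using that invc ch(5) unfolding fc sc by auto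
    show "snd c (chart_inv c y) = y" if "y \<in> snd c ` fst c" for y
      using that inj by (auto simp: chart_inv_def)
  qed (auto simp: chart_inv_def inj)
  then have isc: "is_chart c" unfolding is_chart_def using opc \<phi>(2) im0 by simp
  have comp: "compatible c d" if d: "d \<in> B" for d
  proof -
    note chd = smooth_structure_chart[OF B d]
    have bd: "smooth_on (snd b ` (fst b \<inter> fst d)) (snd d \<circ> chart_inv b)"
      "smooth_on (snd d ` (fst b \<inter> fst d)) (snd b \<circ> chart_inv d)"
      using B b d unfolding smooth_structure_def compatible_def by blast+
    let ?O = "\<Omega> \<inter> snd b ` (fst b \<inter> fst d)"
    have oO: "open ?O" by (intro open_Int \<Omega>(1) open_chart_image[OF B b chd(1)])
    have "\<phi> ` ?O = \<phi> ` \<Omega> \<inter> \<psi> -` ?O" using \<psi>(2) by auto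
    then have oim: "open (\<phi> ` ?O)"
      using continuous_open_preimage[OF contpsi \<phi>(2) oO] by simp
    have 1: "smooth_on (\<phi> ` ?O) (\<lambda>\<eta>. (snd d \<circ> chart_inv b) (\<psi> \<eta>))"
      by (rule smooth_on_compose[OF oim open_chart_image[OF B b chd(1)] _ bd(1) smooth_on_subset[OF \<psi>(1)]])
        (use \<psi>(2) in auto)
    have s1: "smooth_on (snd c ` (fst c \<inter> fst d)) (snd d \<circ> chart_inv c)"
      unfolding im
      by (rule smooth_on_cong[OF oim _ 1]) (use \<psi>(2) invc in auto)
    have od: "open (snd d ` (fst c \<inter> fst d))"
      using open_chart_image[OF B d opc] by (simp add: Int_commute)
    have 2: "smooth_on (snd d ` (fst c \<inter> fst d)) (\<lambda>y. \<phi> ((snd b \<circ> chart_inv d) y))"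
      by (rule smooth_on_compose[OF od \<Omega>(1) _ \<phi>(1) smooth_on_subset[OF bd(2)]])
        (use chd(5) fc in auto)
    have "smooth_on (snd d ` (fst c \<inter> fst d)) (snd c \<circ> chart_inv d)"
      by (rule smooth_on_cong[OF od _ 2]) (simp add: sc)
    with s1 show ?thesis unfolding compatible_def by simp
  qed
  show cB: "c \<in> B" using B isc comp unfolding smooth_structure_def by blast
  assume q: "q \<in> fst c"
  then have qb: "q \<in> fst b" "snd b q \<in> \<Omega>" by (auto simp: fc)
  have "jac b c (\<lambda>x. x) q = frechet_derivative \<phi> (at (snd b q))"
    unfolding jac_def
  proof (rule frechet_derivative_cong_open[OF \<Omega>(1) qb(2)])
    fix y assume "y \<in> \<Omega>"
    then have "y \<in> snd b ` fst b" using \<Omega>(2) by blast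
    then show "snd c (chart_inv b y) = \<phi> y" unfolding sc using ch(6) by simp
  qed
  then show "to_coords B c q v = frechet_derivative \<phi> (at (snd b q)) (to_coords B b q v)"
    using jac_to_coords[OF B b cB qb(1) q] by metis
qed

text \<open>A family of \<open>k\<close> vectors spanning dimension \<open>k\<close> is independent
  and without repetitions, so its coordinate functionals exist; they extend linearly to the whole
  space.\<close>

lemma dual_functionals:
  fixes x :: "nat \<Rightarrow> 'a::euclidean_space"
  assumes "dim (span (x ` {..<k})) = k"
  shows "\<exists>\<kappa>. (\<forall>i. linear (\<kappa> i)) \<and> (\<forall>i<k. \<forall>j<k. \<kappa> i (x j) = (if i = j then 1 else (0::real)))"
proof -
  have d: "dim (x ` {..<k}) = k" using assms by simp
  have card: "card (x ` {..<k}) \<le> k" using card_image_le[of "{..<k}" x] by simp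
  have ind: "independent (x ` {..<k})"
    by (rule card_le_dim_spanning[of _ "x ` {..<k}"]) (use card d in \<open>auto intro: span_base\<close>)
  have "card (x ` {..<k}) = k" using ind d dim_eq_card_independent by metis
  then have inj: "inj_on x {..<k}" by (intro eq_card_imp_inj_on) auto
  have "\<exists>h::'a \<Rightarrow> real. linear h \<and> (\<forall>y\<in>x ` {..<k}. h y = (if y = x i then 1 else 0))" for i
    by (rule linear_independent_extend[OF ind])
  then obtain \<kappa> :: "nat \<Rightarrow> 'a \<Rightarrow> real" where \<kappa>: "\<And>i. linear (\<kappa> i)"
    "\<And>i y. y \<in> x ` {..<k} \<Longrightarrow> \<kappa> i y = (if y = x i then 1 else 0)" by metis
  have "\<kappa> i (x j) = (if i = j then 1 else 0)" if "i < k" "j < k" for i j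
    using \<kappa>(2)[of "x j" i] that inj by (auto dest: inj_onD)
  with \<kappa>(1) show ?thesis by blast
qed

text \<open>Picard iteration uses maps into the operator space, whereas smoothness is available for
  columns. A sum of rank one operators converts the one into the other; for linear \<open>F\<close>
  it is \<open>F\<close> itself.\<close>

definition basis_blinfun :: "('a::euclidean_space \<Rightarrow> 'b::real_normed_vector) \<Rightarrow> 'a \<Rightarrow>\<^sub>L 'b"
  where "basis_blinfun F = (\<Sum>i\<in>Basis. blinfun_scaleR_left (F i) o\<^sub>L blinfun_inner_left i)"

lemma basis_blinfun_apply:
  assumes "linear F"
  shows "blinfun_apply (basis_blinfun F) v = F v"
  unfolding basis_blinfun_def linear_Basis_expansion[OF assms, of v]
  by (simp add: blinfun.sum_left inner_commute)

lemma Ck_on_basis_blinfun: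
  assumes "open S" "\<And>w. Ck_on k S (\<lambda>y. F y w)"
  shows "Ck_on k S (\<lambda>y. basis_blinfun (F y))"
  unfolding basis_blinfun_def
proof (rule Ck_on_sum[OF assms(1)])
  fix i :: 'b
  have "bounded_linear (\<lambda>w. blinfun_scaleR_left w o\<^sub>L blinfun_inner_left i)"
    by (rule bounded_linear_compose[OF bounded_bilinear.bounded_linear_left[OF bounded_bilinear_blinfun_compose]
          bounded_linear_blinfun_scaleR_left])
  from Ck_on_bounded_linear[OF this assms]
  show "Ck_on k S (\<lambda>y. blinfun_scaleR_left (F y i) o\<^sub>L blinfun_inner_left i)" .
qed

lemma C1_blinfun_derivative:
  fixes F :: "'a::euclidean_space \<Rightarrow> 'b::real_normed_vector"
  assumes "open S" "Ck_on (Suc 0) S F"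
  shows "\<exists>F'. (\<forall>y\<in>S. (F has_derivative blinfun_apply (F' y)) (at y)) \<and> continuous_on S F'"
proof (intro exI[of _ "\<lambda>y. basis_blinfun (frechet_derivative F (at y))"] conjI ballI)
  show "continuous_on S (\<lambda>y. basis_blinfun (frechet_derivative F (at y)))"
    using Ck_on_basis_blinfun[OF assms(1), of 0 "\<lambda>y. frechet_derivative F (at y)"] Ck_on_Suc_D2[OF assms(2)] by simp
  fix y assume "y \<in> S"
  from Ck_on_Suc_D[OF assms(2) this]
  have "(F has_derivative frechet_derivative F (at y)) (at y)" .
  moreover from has_derivative_linear[OF this]
  have "blinfun_apply (basis_blinfun (frechet_derivative F (at y))) = frechet_derivative F (at y)"
    by (intro HOL.ext basis_blinfun_apply)
  ultimately show "(F has_derivative blinfun_apply (basis_blinfun (frechet_derivative F (at y)))) (at y)" by simp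
qed

text \<open>The equation improves the regularity of its solution: if \<open>u\<close> is C^k, so is
  its derivative \<open>G (u x) v\<close>, hence \<open>u\<close> is C^(k+1).\<close>

lemma frobenius_smooth_solution:
  fixes G :: "'a::euclidean_space \<Rightarrow> 'a \<Rightarrow> 'a"
  assumes S: "open S" "y0 \<in> S" and lin: "\<And>y. y \<in> S \<Longrightarrow> linear (G y)"
    and smG: "\<And>w. smooth_on S (\<lambda>y. G y w)"
    and sym: "\<And>y v w. y \<in> S \<Longrightarrow> frechet_derivative (\<lambda>x. G x w) (at y) (G y v) =
      frechet_derivative (\<lambda>x. G x v) (at y) (G y w)"
  shows "\<exists>r u. r > 0 \<and> u 0 = y0 \<and> smooth_on (ball 0 r) u \<and>
    (\<forall>x\<in>ball 0 r. u x \<in> S \<and> (u has_derivative G (u x)) (at x))"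
proof -
  define Gb where "Gb y = basis_blinfun (G y)" for y
  have Gb: "blinfun_apply (Gb y) = G y" if "y \<in> S" for y
    unfolding Gb_def by (intro HOL.ext basis_blinfun_apply lin that)
  have "Ck_on (Suc 0) S Gb"
    unfolding Gb_def[abs_def] by (rule Ck_on_basis_blinfun[OF S(1)]) (use smG in \<open>simp add: smooth_on_def del: Ck_on.simps\<close>)
  then obtain G' where G': "\<And>y. y \<in> S \<Longrightarrow> (Gb has_derivative blinfun_apply (G' y)) (at y)" "continuous_on S G'"
    using C1_blinfun_derivative[OF S(1), of Gb] by blast
  have G'_eq: "G' y v w = frechet_derivative (\<lambda>x. G x w) (at y) v" if y: "y \<in> S" for y v w
  proof -
    have "((\<lambda>x. Gb x w) has_derivative (\<lambda>v. G' y v w)) (at y)"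
      using bounded_linear.has_derivative[OF blinfun.bounded_linear_left G'(1)[OF y]] .
    then have "((\<lambda>x. G x w) has_derivative (\<lambda>v. G' y v w)) (at y)"
      by (rule has_derivative_transform_within_open[OF _ S(1) y]) (simp add: Gb)
    from frechet_derivative_eqI[OF this] show ?thesis by simp
  qed
  have "G' y (Gb y v) w = G' y (Gb y w) v" if "y \<in> S" for y v w
    unfolding Gb[OF that] G'_eq[OF that] by (rule sym[OF that])
  from frobenius_solution[OF S G' this]
  obtain r u where r: "r > 0" "u 0 = y0" and u0: "\<And>x. x \<in> ball 0 r \<Longrightarrow> u x \<in> S \<and> (u has_derivative Gb (u x)) (at x)"
    by blast
  have u: "u x \<in> S" "(u has_derivative G (u x)) (at x)" if "x \<in> ball 0 r" for x
    using u0[OF that] Gb[of "u x"] by auto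
  have "Ck_on k (ball 0 r) u" for k
  proof (induction k)
    case 0
    show ?case unfolding Ck_on.simps
      by (intro continuous_at_imp_continuous_on ballI has_derivative_continuous[OF u(2)])
  next
    case (Suc k)
    show ?case
    proof (rule Ck_on_Suc_I[OF open_ball u(2)])
      show "Ck_on k (ball 0 r) (\<lambda>x. G (u x) v)" for v
        by (rule Ck_on_compose[where f="\<lambda>y. G y v", OF open_ball S(1) u(1) _ Suc.IH]) (use smG in \<open>auto simp: smooth_on_def\<close>)
    qed
  qed
  then have "smooth_on (ball 0 r) u" by (simp add: smooth_on_def)
  then show ?thesis using r u by (intro exI[of _ r] exI[of _ u] conjI ballI)
qed

text \<open>\<open>P\<close> projects onto the fibre at the base point. Nearby the fibres
  \<open>E y\<close> remain complementary to the kernel of \<open>P\<close>, and \<open>G y\<close>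
  is the projection onto \<open>E y\<close> along this fixed kernel. Hence \<open>P (G y w)\<close>
  does not depend on \<open>y\<close>, which later makes the fields \<open>\<lambda>y. G y w\<close>
  commute.\<close>

lemma projection_onto_distribution:
  fixes B :: "('n::{t2_space, second_countable_topology}, 'f::euclidean_space) chart set"
  assumes B: "smooth_structure B" and D: "distribution B D" and b: "b \<in> B" "p \<in> fst b"
  defines "E \<equiv> \<lambda>y. to_coords B b (chart_inv b y) ` D (chart_inv b y)"
  shows "\<exists>T P G. open T \<and> snd b p \<in> T \<and> T \<subseteq> snd b ` fst b \<and> linear P \<and> range P = E (snd b p) \<and>
    (\<forall>w. P (P w) = P w) \<and> (\<forall>y\<in>T. linear (G y)) \<and> (\<forall>w. smooth_on T (\<lambda>y. G y w)) \<and>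
    (\<forall>y\<in>T. \<forall>w. G y w \<in> E y \<and> P (G y w) = P w \<and> G y (P w) = G y w \<and> (w \<in> E y \<longrightarrow> G y w = w))"
proof -
  note ch = smooth_structure_chart[OF B b(1)]
  obtain k W X where W: "open W" "p \<in> W" and Xs: "\<forall>i<k. smooth_vector_field B W (X i)"
    and X: "\<forall>x\<in>W. D x = span ((\<lambda>i. X i x) ` {..<k::nat}) \<and> dim (D x) = k"
    using distribution_frame[OF D, of p] by (elim exE conjE)
  define O0 where "O0 = snd b ` (fst b \<inter> W)"
  define x where "x i y = local_rep B b (X i) y" for i y
  let ?y0 = "snd b p"
  have O0: "open O0" "?y0 \<in> O0" using open_chart_image[OF B b(1) W(1)] b W(2) by (auto simp: O0_def)
  have q: "chart_inv b y \<in> fst b" "chart_inv b y \<in> W" "y \<in> snd b ` fst b" if "y \<in> O0" for y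
    using that ch(5) by (auto simp: O0_def)
  have xs: "smooth_on O0 (x i)" if "i < k" for i
    using Xs that b(1) unfolding smooth_vector_field_iff[OF B] O0_def x_def[abs_def] by blast
  have E: "E y = span ((\<lambda>i. x i y) ` {..<k})" if y: "y \<in> O0" for y
  proof -
    have "D (chart_inv b y) = span ((\<lambda>i. X i (chart_inv b y)) ` {..<k})" using X q(2)[OF y] by blast
    then show ?thesis unfolding E_def x_def local_rep_def
      by (simp add: linear_span_image[OF linear_to_coords[OF B b(1) q(1)[OF y]], symmetric] image_image)
  qed
  have "dim (span ((\<lambda>i. x i ?y0) ` {..<k})) = k"
  proof -
    have "inj (to_coords B b p)"
      by (rule inj_on_inverseI[where g="\<lambda>w. coord_field B b w p"]) (rule coord_field_to_coords[OF B b])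
    then have d1: "dim (to_coords B b p ` D p) = dim (D p)"
      by (intro dim_image_eq linear_to_coords[OF B b]) (auto intro: inj_on_subset)
    have d2: "E ?y0 = to_coords B b p ` D p" unfolding E_def using ch(5)[OF b(2)] by simp
    have "dim (D p) = k" using X W(2) by blast
    then show ?thesis unfolding E[OF O0(2), symmetric] d2 d1 .
  qed
  then obtain \<kappa> where \<kappa>: "\<And>i. linear (\<kappa> i)"
    and \<kappa>x: "\<And>i j. i < k \<Longrightarrow> j < k \<Longrightarrow> \<kappa> i (x j ?y0) = (if i = j then 1 else (0::real))"
    using dual_functionals[of "\<lambda>i. x i ?y0" k] by blast
  \<comment> \<open>\<open>F y\<close> carries the frame at the base point to the frame at
    \<open>y\<close> and vanishes on the kernel of \<open>P\<close>; \<open>N y\<close> extends this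
    by the identity on the kernel. As \<open>N y\<close> is the identity at the base point, it is
    invertible nearby, and \<open>G y\<close> will be \<open>F y\<close> after its inverse.\<close>
  define F where "F y w = (\<Sum>i<k. \<kappa> i w *\<^sub>R x i y)" for y w
  define P where "P = F ?y0"
  define N where "N y w = F y w + (w - P w)" for y w
  have linF: "linear (F y)" for y
    unfolding F_def by (rule linearI) (simp_all add: linear_add[OF \<kappa>] linear_cmul[OF \<kappa>] scaleR_add_left sum.distrib scaleR_sum_right)
  have linP: "linear P" unfolding P_def by (rule linF)
  have linN: "linear (N y)" for y
    unfolding N_def using linF[of y] linP by (intro linear_compose_add linear_compose_sub linear_ident)
  have \<kappa>P: "\<kappa> i (P w) = \<kappa> i w" if "i < k" for i w
    unfolding P_def F_def linear_sum[OF \<kappa>] linear_cmul[OF \<kappa>] using that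
    by (simp add: \<kappa>x if_distrib cong: if_cong)
  have FP: "F y (P w) = F y w" for y w unfolding F_def by (simp add: \<kappa>P)
  have PP: "P (P w) = P w" for w using FP[of ?y0] by (simp add: P_def)
  have FE: "F y w \<in> E y" if "y \<in> O0" for y w
    unfolding F_def E[OF that] by (auto intro!: span_sum span_scale intro: span_base)
  have EF: "\<exists>w. e = F y w \<and> P w = w" if y: "y \<in> O0" and e: "e \<in> E y" for y e
  proof -
    obtain a where a: "e = (\<Sum>i<k. a i *\<^sub>R x i y)"
      using e span_image_sum_ex[of e "\<lambda>i. x i y" k] unfolding E[OF y] by blast
    define w where "w = (\<Sum>i<k. a i *\<^sub>R x i ?y0)"
    have "\<kappa> i w = a i" if "i < k" for i
      unfolding w_def linear_sum[OF \<kappa>] linear_cmul[OF \<kappa>] using that by (simp add: \<kappa>x if_distrib cong: if_cong)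
    then have "F y w = e" "P w = w" unfolding P_def F_def a w_def by auto
    then show ?thesis by blast
  qed
  have rangeP: "range P = E ?y0"
  proof
    show "range P \<subseteq> E ?y0" using FE[OF O0(2)] by (auto simp: P_def)
    show "E ?y0 \<subseteq> range P" using EF[OF O0(2)] unfolding P_def by blast
  qed
  have N0: "N ?y0 w = w" for w by (simp add: N_def P_def)
  have CkN: "Ck_on m O0 (\<lambda>y. N y w)" for m w
    unfolding N_def F_def
    by (intro Ck_on_add O0 Ck_on_const Ck_on_sum Ck_on_bounded_linear[OF bounded_linear_scaleR_right])
      (use xs in \<open>auto simp: smooth_on_def\<close>)
  have contN: "continuous (at ?y0) (\<lambda>y. N y w)" for w
    using CkN[of 0 w] O0 by (simp add: continuous_on_eq_continuous_at)
  have injN0: "inj (N ?y0)" by (rule injI) (simp add: N0)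
  obtain T K where T: "open T" "?y0 \<in> T" "T \<subseteq> O0" and "K > 0"
    and K: "\<forall>y\<in>T. \<forall>w. norm w \<le> K * norm (N y w)"
    using linear_family_bounded_below[where A=N, OF O0 linN contN injN0] by (elim exE conjE)
  have injN: "inj (N y)" if "y \<in> T" for y
    unfolding linear_injective_0[OF linN]
  proof (intro allI impI)
    fix w assume "N y w = 0"
    with K that have "norm w \<le> K * norm (0::'f)" by metis
    then show "w = 0" by simp
  qed
  have "\<exists>m. N y m = w" if "y \<in> T" for y w
    using linear_injective_imp_surjective[OF linN injN[OF that]] by (metis surjD)
  then obtain M where NM: "\<And>y w. y \<in> T \<Longrightarrow> N y (M y w) = w" by metis
  have MN: "M y (N y w) = w" if "y \<in> T" for y w
    using injN[OF that] NM[OF that, of "N y w"] by (auto dest: injD)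
  have linM: "linear (M y)" if y: "y \<in> T" for y
  proof (rule linearI)
    show "M y (v + w) = M y v + M y w" for v w
      using MN[OF y, of "M y v + M y w"] by (simp add: linear_add[OF linN] NM[OF y])
    show "M y (r *\<^sub>R w) = r *\<^sub>R M y w" for r w
      using MN[OF y, of "r *\<^sub>R M y w"] by (simp add: linear_cmul[OF linN] NM[OF y])
  qed
  have CkM: "Ck_on m T (\<lambda>y. M y w)" for m w
    by (rule implicit_linear_Ck_on[where A=N and z="\<lambda>y. w", OF T(1) linN injN Ck_on_subset[OF CkN T(3)] Ck_on_const])
      (auto simp: NM)
  define G where "G y w = F y (M y w)" for y w
  have CkF: "Ck_on m T (\<lambda>y. F y w)" for m w
    unfolding F_def
    by (intro Ck_on_sum T(1) Ck_on_bounded_linear[OF bounded_linear_scaleR_right])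
      (use xs Ck_on_subset[OF _ T(3)] in \<open>auto simp: smooth_on_def\<close>)
  have smG: "smooth_on T (\<lambda>y. G y w)" for w
    unfolding smooth_on_def G_def using Ck_on_apply_linear[OF T(1) linF CkF CkM] by blast
  have linG: "linear (G y)" if "y \<in> T" for y
    using linear_compose[OF linM[OF that] linF[of y]] by (simp add: G_def[abs_def] o_def)
  have NP: "N y (P w) = F y w" for y w by (simp add: N_def PP FP)
  have Nker: "N y (w - P w) = w - P w" for y w
    unfolding N_def by (simp add: linear_diff[OF linF] linear_diff[OF linP] FP PP)
  have main: "G y w \<in> E y \<and> P (G y w) = P w \<and> G y (P w) = G y w \<and> (w \<in> E y \<longrightarrow> G y w = w)" if y: "y \<in> T" for y w
  proof (intro conjI impI)
    have yO: "y \<in> O0" using y T(3) by blast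
    show "G y w \<in> E y" unfolding G_def by (rule FE[OF yO])
    \<comment> \<open>The splitting of \<open>w\<close> into its component in \<open>E y\<close> and
      one in the kernel of \<open>P\<close>.\<close>
    have w: "w = G y w + (M y w - P (M y w))"
      using NM[OF y, of w] by (simp add: N_def G_def)
    have "P (M y w - P (M y w)) = 0" by (simp add: linear_diff[OF linP] PP)
    then show "P (G y w) = P w" using arg_cong[OF w, of P] by (simp add: linear_add[OF linP])
    have "M y (w - P w) = w - P w" using MN[OF y, of "w - P w"] unfolding Nker .
    then have "G y (w - P w) = F y w - F y (P w)" unfolding G_def by (simp add: linear_diff[OF linF])
    then have "G y (w - P w) = 0" by (simp add: FP)
    then show "G y (P w) = G y w" by (simp add: linear_diff[OF linG[OF y]])
    assume "w \<in> E y"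
    then obtain m where m: "w = F y m" "P m = m" using EF[OF yO] by blast
    then have "w = N y m" using NP[of y m] by simp
    then have "M y w = m" using MN[OF y] by simp
    then show "G y w = w" using m by (simp add: G_def)
  qed
  have "T \<subseteq> snd b ` fst b" using T(3) by (auto simp: O0_def)
  then show ?thesis
    using T(1,2) linP rangeP PP linG smG main by (intro exI[of _ T] exI[of _ P] exI[of _ G] conjI allI ballI) auto
qed

text \<open>Projecting onto the fibres along a fixed complement yields commuting fields that span
  \<open>D\<close>, so the equation \<open>Du = G(u)\<close> can be solved. The leaf is the image
  under \<open>u\<close> of a ball in the range of \<open>P\<close>, and a shear of the chart
  flattens it.\<close>

lemma frobenius:
  fixes B :: "('n::{t2_space, second_countable_topology}, 'f::euclidean_space) chart set"
  assumes B: "smooth_structure B" and D: "distribution B D"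
    and inv: "\<And>p. involutive_at B D (chart_at B p) p"
  shows "integrable_distribution B D"
  unfolding integrable_distribution_def
proof
  fix p
  define b where "b = chart_at B p"
  have b: "b \<in> B" "p \<in> fst b" using chart_at_in[OF B] by (auto simp: b_def)
  note ch = smooth_structure_chart[OF B b(1)]
  define E where "E y = to_coords B b (chart_inv b y) ` D (chart_inv b y)" for y
  define y0 where "y0 = snd b p"
  obtain T P G where T: "open T" "y0 \<in> T" "T \<subseteq> snd b ` fst b" and P: "linear P" "range P = E y0"
    and PP: "\<forall>w. P (P w) = P w" and linG: "\<forall>y\<in>T. linear (G y)" and smG: "\<forall>w. smooth_on T (\<lambda>y. G y w)"
    and G: "\<forall>y\<in>T. \<forall>w. G y w \<in> E y \<and> P (G y w) = P w \<and> G y (P w) = G y w \<and> (w \<in> E y \<longrightarrow> G y w = w)"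
    using projection_onto_distribution[OF B D b] unfolding E_def y0_def by (elim exE conjE)
  have sym: "frechet_derivative (\<lambda>x. G x w) (at y) (G y v) = frechet_derivative (\<lambda>x. G x v) (at y) (G y w)"
    if y: "y \<in> T" for y v w
  proof -
    let ?q = "chart_inv b y"
    define dG where "dG u w = frechet_derivative (\<lambda>x. G x w) (at y) u" for u w
    have dG: "((\<lambda>x. G x w) has_derivative (\<lambda>u. dG u w)) (at y)" for w
      unfolding dG_def using smooth_on_has_derivative[OF smG[rule_format] y] .
    have yb: "y \<in> snd b ` fst b" using T(3) y by blast
    have q: "?q \<in> fst b" "snd b ?q = y" using ch(6,7)[OF yb] by auto
    obtain Q where Q: "bilinear Q" "\<forall>u w. Q u w = Q w u"
      and Qd: "\<forall>Y W DY. open W \<and> ?q \<in> W \<and> (\<forall>q\<in>W. Y q \<in> D q) \<and>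
       (local_rep B b Y has_derivative DY) (at y) \<longrightarrow>
       (\<forall>v\<in>E y. DY v - Q v (to_coords B b ?q (Y ?q)) \<in> E y)"
      using involutive_at_change[OF B chart_at_in(1)[OF B] b(1) chart_at_in(2)[OF B] q(1) inv]
      unfolding involutive_at_def q(2) E_def[symmetric] by (elim exE conjE)
    have key: "dG u w - Q u (G y w) \<in> E y" if u: "u \<in> E y" for u w
    proof -
      define Y where "Y q = coord_field B b (G (snd b q) w) q" for q
      define W where "W = fst b \<inter> snd b -` T"
      have "open W" unfolding W_def by (rule continuous_open_preimage[OF ch(3,1) T(1)])
      moreover have "?q \<in> W" using q y by (simp add: W_def)
      moreover have "Y q \<in> D q" if "q \<in> W" for q
      proof -
        have q: "q \<in> fst b" "snd b q \<in> T" using that by (auto simp: W_def)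
        have "G (snd b q) w \<in> to_coords B b q ` D q"
          using G q(2) ch(5)[OF q(1)] unfolding E_def by metis
        then show ?thesis unfolding Y_def using coord_field_to_coords[OF B b(1) q(1)] by auto
      qed
      moreover have rep: "local_rep B b Y x = G x w" if "x \<in> T" for x
      proof -
        have x: "x \<in> snd b ` fst b" using that T(3) by blast
        show ?thesis unfolding local_rep_def Y_def ch(6)[OF x] by (rule to_coords_coord_field[OF B b(1) ch(7)[OF x]])
      qed
      moreover have "(local_rep B b Y has_derivative (\<lambda>u. dG u w)) (at y)"
        by (rule has_derivative_transform_within_open[OF dG T(1) y]) (simp add: rep)
      ultimately have "dG u w - Q u (to_coords B b ?q (Y ?q)) \<in> E y"
        using Qd[rule_format, of W Y "\<lambda>u. dG u w" u] u by simp
      moreover have "to_coords B b ?q (Y ?q) = G y w"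
        using rep[OF y] unfolding local_rep_def .
      ultimately show ?thesis by simp
    qed
    have subE: "subspace (E y)"
    proof -
      have "E y = range (G y)"
        using G y by (auto simp: image_iff) metis
      then show ?thesis using linear_subspace_image[OF linG[rule_format, OF y] subspace_UNIV] by simp
    qed
    \<comment> \<open>The coordinate expression of the bracket of two of the fields. It lies in
      \<open>E y\<close>, since the \<open>Q\<close> terms cancel, and \<open>P\<close> kills it,
      since \<open>P (G x w)\<close> is constant in \<open>x\<close>; but \<open>P\<close> is
      injective on \<open>E y\<close>.\<close>
    define \<delta> where "\<delta> = dG (G y v) w - dG (G y w) v"
    have "(dG (G y v) w - Q (G y v) (G y w)) - (dG (G y w) v - Q (G y w) (G y v)) \<in> E y"
      by (rule subspace_diff[OF subE key key]) (use G y in blast)+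
    then have \<delta>E: "\<delta> \<in> E y" using Q(2) unfolding \<delta>_def by (metis (no_types, lifting) diff_diff_eq2 diff_add_cancel add_diff_eq add.commute diff_diff_add)
    have PdG: "P (dG u w) = 0" for u w
    proof -
      have "((\<lambda>x. P (G x w)) has_derivative (\<lambda>u. P (dG u w))) (at y)"
        using bounded_linear.has_derivative[OF linear_conv_bounded_linear[THEN iffD1, OF P(1)] dG] .
      then have "((\<lambda>x. P w) has_derivative (\<lambda>u. P (dG u w))) (at y)"
        by (rule has_derivative_transform_within_open[OF _ T(1) y]) (use G in blast)
      from has_derivative_unique[OF this has_derivative_const] show ?thesis by (rule fun_cong)
    qed
    have "P \<delta> = 0" unfolding \<delta>_def by (simp add: linear_diff[OF P(1)] PdG)
    have "\<delta> = G y (P \<delta>)" using G y \<delta>E by metis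
    also have "\<dots> = 0" unfolding \<open>P \<delta> = 0\<close> by (rule linear_0[OF linG[rule_format, OF y]])
    finally show ?thesis unfolding \<delta>_def dG_def by simp
  qed
  have linG': "linear (G y)" if "y \<in> T" for y using linG that by blast
  have smG': "smooth_on T (\<lambda>y. G y w)" for w using smG by blast
  have "\<exists>r u. r > 0 \<and> u 0 = y0 \<and> smooth_on (ball 0 r) u \<and>
      (\<forall>x\<in>ball 0 r. u x \<in> T \<and> (u has_derivative G (u x)) (at x))"
    by (rule frobenius_smooth_solution[where G=G, OF T(1,2) linG' smG' sym])
  then obtain r u where r: "r > 0" "u 0 = y0" and smu: "smooth_on (ball 0 r) u"
    and u: "\<forall>x\<in>ball 0 r. u x \<in> T \<and> (u has_derivative G (u x)) (at x)"
    by (elim exE conjE)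
  \<comment> \<open>\<open>u x\<close> and \<open>y0 + x\<close> have the same image under
    \<open>P\<close>, so the leaf is a graph over the range of \<open>P\<close>.\<close>
  have Pu: "P (u x) = P y0 + P x" if x: "x \<in> ball 0 r" for x
  proof -
    have "((\<lambda>x. P (u x) - P x) has_derivative (\<lambda>v. 0)) (at x within ball 0 r)" if x: "x \<in> ball 0 r" for x
    proof -
      have bl: "bounded_linear P" using P(1) linear_conv_bounded_linear by blast
      have "((\<lambda>x. P (u x) - P x) has_derivative (\<lambda>v. P (G (u x) v) - P v)) (at x)"
        by (intro has_derivative_diff bounded_linear.has_derivative[OF bl] has_derivative_ident) (use u x in blast)
      moreover have "P (G (u x) v) - P v = 0" for v using G u x by simp
      ultimately show ?thesis by (simp add: has_derivative_at_withinI)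
    qed
    from has_derivative_zero_constant[OF convex_ball this]
    obtain c where "\<And>x. x \<in> ball 0 r \<Longrightarrow> P (u x) - P x = c" by blast
    from this[OF x] this[of 0] r show ?thesis by (simp add: linear_0[OF P(1)] algebra_simps)
  qed
  have blP: "bounded_linear P" using P(1) linear_conv_bounded_linear by blast
  define \<Omega> where "\<Omega> = {y \<in> snd b ` fst b. P (y - y0) \<in> ball 0 r}"
  \<comment> \<open>Up to a translation, a shear along the kernel of \<open>P\<close>: the leaf
    point \<open>u (P (y - y0))\<close> with the same image under \<open>P\<close> as
    \<open>y\<close> is moved to \<open>P (y - y0)\<close>, so the leaf goes into the range of
    \<open>P\<close>. Since \<open>\<phi>\<close> preserves the parameter \<open>P (y - y0)\<close>,
    its inverse \<open>\<psi>\<close> can be written down.\<close>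
  define \<phi> where "\<phi> y = y + (- u (P (y - y0)) + P (y - y0))" for y
  define \<psi> where "\<psi> \<eta> = u (P \<eta>) + (\<eta> + - P \<eta>)" for \<eta>
  have contP: "continuous_on UNIV (\<lambda>y. P (y - y0))"
    by (intro bounded_linear.continuous_on[OF blP] continuous_intros)
  have "\<Omega> = snd b ` fst b \<inter> (\<lambda>y. P (y - y0)) -` ball 0 r" by (auto simp: \<Omega>_def)
  then have \<Omega>: "open \<Omega>" using ch(2) by (simp only: open_Int open_vimage[OF open_ball contP])
  have PPd: "P (y - y0) = P y - P y0" for y by (rule linear_diff[OF P(1)])
  have P\<phi>: "P (\<phi> y) = P (y - y0)" if "P (y - y0) \<in> ball 0 r" for y
    unfolding \<phi>_def linear_add[OF P(1)] linear_neg[OF P(1)] Pu[OF that] PP[rule_format]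
    unfolding PPd by simp
  have \<psi>\<phi>: "\<psi> (\<phi> y) = y" if "P (y - y0) \<in> ball 0 r" for y
    unfolding \<psi>_def P\<phi>[OF that] by (simp add: \<phi>_def)
  have P\<psi>: "P (\<psi> \<eta> - y0) = P \<eta>" if "P \<eta> \<in> ball 0 r" for \<eta>
    unfolding PPd \<psi>_def linear_add[OF P(1)] linear_neg[OF P(1)] Pu[OF that] PP[rule_format] by simp
  have \<phi>\<psi>: "\<phi> (\<psi> \<eta>) = \<eta>" if "P \<eta> \<in> ball 0 r" for \<eta>
    unfolding \<phi>_def P\<psi>[OF that] by (simp add: \<psi>_def)
  have oP: "open {\<eta>. P \<eta> \<in> ball 0 r}"
    using open_vimage[OF open_ball linear_continuous_on[OF blP]] unfolding vimage_def by blast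
  have Cku: "Ck_on k (ball 0 r) u" for k using smu by (simp add: smooth_on_def)
  have CkP: "Ck_on k S (\<lambda>y. P (y - y0))" if "open S" for k S
    using Ck_on_bounded_linear[OF blP that Ck_on_add[OF that Ck_on_id Ck_on_const[of k S "- y0"]]] by simp
  have sm\<phi>: "smooth_on \<Omega> \<phi>"
    unfolding smooth_on_def \<phi>_def[abs_def]
    by (intro allI Ck_on_add \<Omega> Ck_on_id CkP Ck_on_bounded_linear[OF bounded_linear_minus[OF bounded_linear_ident]]
        Ck_on_compose[OF \<Omega> open_ball _ Cku]) (simp add: \<Omega>_def)
  have sm\<psi>: "smooth_on {\<eta>. P \<eta> \<in> ball 0 r} \<psi>"
    unfolding smooth_on_def \<psi>_def[abs_def]
    by (intro allI Ck_on_add oP Ck_on_id Ck_on_bounded_linear[OF bounded_linear_minus[OF bounded_linear_ident]]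
        Ck_on_bounded_linear[OF blP] Ck_on_compose[OF oP open_ball _ Cku]) simp
  have im\<phi>: "\<phi> ` \<Omega> = {\<eta>. P \<eta> \<in> ball 0 r} \<inter> \<psi> -` (snd b ` fst b)"
  proof
    show "\<phi> ` \<Omega> \<subseteq> {\<eta>. P \<eta> \<in> ball 0 r} \<inter> \<psi> -` (snd b ` fst b)"
    proof
      fix \<eta> assume "\<eta> \<in> \<phi> ` \<Omega>"
      then obtain y where y: "\<eta> = \<phi> y" "P (y - y0) \<in> ball 0 r" "y \<in> snd b ` fst b" by (auto simp: \<Omega>_def)
      show "\<eta> \<in> {\<eta>. P \<eta> \<in> ball 0 r} \<inter> \<psi> -` (snd b ` fst b)"
        unfolding y(1) vimage_def using P\<phi>[OF y(2)] \<psi>\<phi>[OF y(2)] y(2,3) by simp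
    qed
    show "{\<eta>. P \<eta> \<in> ball 0 r} \<inter> \<psi> -` (snd b ` fst b) \<subseteq> \<phi> ` \<Omega>"
    proof
      fix \<eta> assume "\<eta> \<in> {\<eta>. P \<eta> \<in> ball 0 r} \<inter> \<psi> -` (snd b ` fst b)"
      then have \<eta>: "P \<eta> \<in> ball 0 r" "\<psi> \<eta> \<in> snd b ` fst b" by auto
      have "\<psi> \<eta> \<in> \<Omega>" unfolding \<Omega>_def using P\<psi>[OF \<eta>(1)] \<eta> by simp
      with \<phi>\<psi>[OF \<eta>(1)] show "\<eta> \<in> \<phi> ` \<Omega>" by (metis imageI)
    qed
  qed
  have cont\<psi>: "continuous_on {\<eta>. P \<eta> \<in> ball 0 r} \<psi>"
    using sm\<psi> unfolding smooth_on_def by (metis Ck_on.simps(1))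
  have o\<phi>: "open (\<phi> ` \<Omega>)" unfolding im\<phi> by (rule continuous_open_preimage[OF cont\<psi> oP ch(2)])
  define c where "c = ({q \<in> fst b. snd b q \<in> \<Omega>}, \<lambda>q. \<phi> (snd b q))"
  have \<Omega>sub: "\<Omega> \<subseteq> snd b ` fst b" by (auto simp: \<Omega>_def)
  have sm\<psi>': "smooth_on (\<phi> ` \<Omega>) \<psi>" by (rule smooth_on_subset[OF sm\<psi>]) (use im\<phi> in blast)
  have \<psi>\<phi>': "\<psi> (\<phi> y) = y" if "y \<in> \<Omega>" for y using \<psi>\<phi> that by (simp add: \<Omega>_def)
  have cB: "c \<in> B"
    unfolding c_def by (rule chart_reparametrization(1)[OF B b(1) \<Omega> \<Omega>sub sm\<phi> o\<phi> sm\<psi>' \<psi>\<phi>'])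
  have to_c: "to_coords B c q v = frechet_derivative \<phi> (at (snd b q)) (to_coords B b q v)" if "q \<in> fst c" for q v
    unfolding c_def
    by (rule chart_reparametrization(2)[OF B b(1) \<Omega> \<Omega>sub sm\<phi> o\<phi> sm\<psi>' \<psi>\<phi>' that[unfolded c_def]])
  define V where "V = range P"
  \<comment> \<open>One slice is enough, as \<open>integrable_distribution\<close> asks for one
    integral manifold through each point; nothing is claimed about the parallel slices.\<close>
  define L where "L = {q \<in> fst c. snd c q \<in> V}"
  have V: "subspace V" unfolding V_def by (rule linear_subspace_image[OF P(1) subspace_UNIV])
  have Pv: "P v = v" if "v \<in> V" for v using that PP by (auto simp: V_def)
  have pL: "p \<in> L"
    using b r(1) subspace_0[OF V] unfolding L_def c_def \<Omega>_def
    by (simp add: \<phi>_def y0_def[symmetric] r(2) linear_0[OF P(1)]) (simp add: y0_def)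
  have tangent: "to_coords B c q ` D q = V" if q: "q \<in> L" for q
  proof -
    have qb: "q \<in> fst b" "snd b q \<in> \<Omega>" "q \<in> fst c" "\<phi> (snd b q) \<in> V" using q by (auto simp: L_def c_def)
    define y where "y = snd b q"
    have y: "y \<in> \<Omega>" "\<phi> y \<in> V" "P (y - y0) \<in> ball 0 r" using qb by (auto simp: y_def \<Omega>_def)
    define \<eta> where "\<eta> = P (y - y0)"
    have \<eta>: "\<eta> \<in> ball 0 r" "\<phi> y = \<eta>" using P\<phi>[OF y(3)] Pv[OF y(2)] y(3) by (auto simp: \<eta>_def)
    \<comment> \<open>On the slice the new coordinate equals its own projection
      \<open>\<eta>\<close>, which forces the point to be \<open>u \<eta>\<close>; there the
      differential equation for \<open>u\<close> gives the tangent space.\<close>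
    have uy: "u \<eta> = y" using \<eta>(2) unfolding \<phi>_def \<eta>_def[symmetric] by (simp add: algebra_simps)
    have yT: "y \<in> T" using u \<eta>(1) uy by auto
    have Ey: "E y = to_coords B b q ` D q" unfolding E_def y_def using ch(5)[OF qb(1)] by simp
    have dP: "((\<lambda>y. P (y - y0)) has_derivative P) (at y)"
    proof -
      have "((\<lambda>y. y - y0) has_derivative (\<lambda>v. v)) (at y)" by (auto intro!: derivative_eq_intros)
      from bounded_linear.has_derivative[OF blP this] show ?thesis .
    qed
    have "(u has_derivative G (u \<eta>)) (at \<eta>)" using u \<eta>(1) by blast
    then have "(u has_derivative G y) (at (P (y - y0)))" unfolding uy unfolding \<eta>_def .
    from has_derivative_compose[OF dP this]
    have "((\<lambda>y. u (P (y - y0))) has_derivative (\<lambda>v. G y (P v))) (at y)" .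
    then have "(\<phi> has_derivative (\<lambda>v. v + (- G y (P v) + P v))) (at y)"
      unfolding \<phi>_def[abs_def] by (intro has_derivative_add has_derivative_ident has_derivative_minus dP)
    from frechet_derivative_eqI[OF this] have fd: "frechet_derivative \<phi> (at y) v = v + (- G y v + P v)" for v
      using G yT by simp
    have tc: "to_coords B c q v = frechet_derivative \<phi> (at y) (to_coords B b q v)" for v
      unfolding y_def by (rule to_c[OF qb(3)])
    have "to_coords B c q ` D q = (\<lambda>e. frechet_derivative \<phi> (at y) e) ` E y"
      unfolding Ey image_image tc ..
    also have "\<dots> = P ` E y"
    proof (rule image_cong[OF refl])
      fix e assume "e \<in> E y"
      then have "G y e = e" using G yT by blast
      then show "frechet_derivative \<phi> (at y) e = P e" unfolding fd by simp
    qed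
    also have "\<dots> = V"
    proof
      show "P ` E y \<subseteq> V" by (auto simp: V_def)
      show "V \<subseteq> P ` E y"
      proof
        fix v assume "v \<in> V"
        then have "v = P (G y v)" "G y v \<in> E y" using Pv G yT by simp_all
        then show "v \<in> P ` E y" by blast
      qed
    qed
    finally show ?thesis .
  qed
  have "integral_manifold B D L"
    unfolding integral_manifold_def
  proof
    fix q assume q: "q \<in> L"
    have "L \<inter> fst c = {q' \<in> fst c. snd c q' - snd c q \<in> V}"
      using q subspace_diff[OF V] subspace_add[OF V] unfolding L_def
      by auto (metis diff_add_cancel)
    then show "\<exists>c\<in>B. \<exists>V. q \<in> fst c \<and> subspace V \<and> L \<inter> fst c = {q' \<in> fst c. snd c q' - snd c q \<in> V} \<and>
        (\<forall>q\<in>L \<inter> fst c. to_coords B c q ` D q = V)"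
      using cB V q tangent by (intro bexI[of _ c] exI[of _ V] conjI ballI) (auto simp: L_def)
  qed
  then show "\<exists>L. p \<in> L \<and> integral_manifold B D L" using pL by blast
qed

section \<open>Integral manifolds and global sections\<close>

text \<open>In a slice chart the fibres of \<open>D\<close> along \<open>L\<close> are the constant
  subspace \<open>V\<close>. The components of a section therefore stay in \<open>V\<close> along
  lines in \<open>V\<close>, and so do their derivatives: \<open>Q = 0\<close> works in this chart,
  and the preferred chart is reached by \<open>involutive_at_change\<close>.\<close>

lemma integrable_imp_involutive:
  fixes B :: "('n::{t2_space, second_countable_topology}, 'f::euclidean_space) chart set"
  assumes B: "smooth_structure B" and int: "integrable_distribution B D"
  shows "involutive_at B D (chart_at B p) p"
proof -
  obtain L where L: "p \<in> L" "integral_manifold B D L"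
    using int unfolding integrable_distribution_def by blast
  have "\<exists>c\<in>B. \<exists>V. p \<in> fst c \<and> subspace V \<and> L \<inter> fst c = {q \<in> fst c. snd c q - snd c p \<in> V} \<and>
      (\<forall>q\<in>L \<inter> fst c. to_coords B c q ` D q = V)"
    using L unfolding integral_manifold_def by blast
  then obtain c V where c: "c \<in> B" "p \<in> fst c" and V: "subspace V"
    and Lc: "L \<inter> fst c = {q \<in> fst c. snd c q - snd c p \<in> V}"
    and tan: "\<forall>q\<in>L \<inter> fst c. to_coords B c q ` D q = V"
    by (elim bexE exE conjE)
  note ch = smooth_structure_chart[OF B c(1)]
  have "involutive_at B D c p"
  proof (rule involutive_atI[where Q="\<lambda>_ _. 0"])
    show "bilinear (\<lambda>_ _. 0)" by (simp add: bilinear_def linear_zero)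
    fix Y W DY v
    assume W: "open W" "p \<in> W" "\<And>q. q \<in> W \<Longrightarrow> Y q \<in> D q"
      and DY: "(local_rep B c Y has_derivative DY) (at (snd c p))" and "v \<in> to_coords B c p ` D p"
    then have v: "v \<in> V" using tan L(1) c(2) by blast
    let ?y0 = "snd c p"
    let ?O = "snd c ` (fst c \<inter> W)"
    have O: "open ?O" "?y0 \<in> ?O" using open_chart_image[OF B c(1) W(1)] c W by auto
    have inV: "local_rep B c Y (?y0 + t *\<^sub>R v) \<in> V" if t: "?y0 + t *\<^sub>R v \<in> ?O" for t
    proof -
      from t obtain q where q0: "?y0 + t *\<^sub>R v = snd c q" "q \<in> fst c \<inter> W" by (rule imageE)
      then have q: "q \<in> fst c" "q \<in> W" "snd c q = ?y0 + t *\<^sub>R v" by simp_all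
      have "q \<in> L \<inter> fst c" unfolding Lc using q v V by (simp add: subspace_scale)
      then have "to_coords B c q ` D q = V" using tan by blast
      then show ?thesis unfolding local_rep_def q(3)[symmetric] ch(5)[OF q(1)] using W(3)[OF q(2)] by blast
    qed
    have "((\<lambda>t. ?y0 + t *\<^sub>R v) has_derivative (\<lambda>t. t *\<^sub>R v)) (at 0)" by (auto intro!: derivative_eq_intros)
    moreover have "(local_rep B c Y has_derivative DY) (at (?y0 + 0 *\<^sub>R v))" using DY by simp
    ultimately have "((\<lambda>t. local_rep B c Y (?y0 + t *\<^sub>R v)) has_derivative (\<lambda>t. DY (t *\<^sub>R v))) (at 0)"
      by (rule has_derivative_compose[where g="local_rep B c Y" and f="\<lambda>t. ?y0 + t *\<^sub>R v"])
    then have dz: "((\<lambda>t. local_rep B c Y (?y0 + t *\<^sub>R v) \<bullet> z) has_derivative (\<lambda>t. DY (t *\<^sub>R v) \<bullet> z)) (at 0)" for z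
      by (rule has_derivative_inner_left)
    have oO: "open ((\<lambda>t::real. ?y0 + t *\<^sub>R v) -` ?O)"
      by (intro open_vimage O(1) continuous_intros)
    \<comment> \<open>Orthogonality refers to the inner product of the model space and serves only
      to detect the subspace \<open>V\<close>; it is unrelated to the metric.\<close>
    have orth: "DY v \<bullet> z = 0" if z: "\<And>w. w \<in> V \<Longrightarrow> w \<bullet> z = 0" for z
    proof -
      have "((\<lambda>t. 0) has_derivative (\<lambda>t. DY (t *\<^sub>R v) \<bullet> z)) (at 0)"
        by (rule has_derivative_transform_within_open[OF dz oO]) (use O(2) z inV in auto)
      from fun_cong[OF has_derivative_unique[OF this has_derivative_const], of 1] show ?thesis by simp
    qed
    obtain x z where xz: "x \<in> span V" "\<And>w. w \<in> span V \<Longrightarrow> orthogonal z w" "DY v = x + z"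
      using orthogonal_subspace_decomp_exists[of V "DY v"] by metis
    have z: "w \<bullet> z = 0" if "w \<in> V" for w
      using xz(2)[OF span_base[OF that]] by (simp add: orthogonal_def inner_commute)
    have xV: "x \<in> V" using xz(1) V by (simp add: span_eq_iff[THEN iffD2])
    have "z \<bullet> z = 0" using orth[OF z] z[OF xV] unfolding xz(3) by (simp add: inner_add_left)
    then have "DY v \<in> V" using xz(3) xV by simp
    then show "DY v - 0 \<in> to_coords B c p ` D p" using tan L(1) c(2) by simp
  qed simp
  then show ?thesis by (rule involutive_at_change[OF B c(1) chart_at_in(1)[OF B] c(2) chart_at_in(2)[OF B]])
qed

text \<open>\<open>sections\<close> contains only fields defined everywhere. A cutoff in a chart
  extends a local field by zero without changing its value at \<open>p\<close>.\<close>

lemma global_section_through: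
  fixes B :: "('n::{t2_space, second_countable_topology}, 'f::euclidean_space) chart set"
  assumes B: "smooth_structure B" and W: "open W" "p \<in> W" and Y: "smooth_vector_field B W Y"
    and YD: "\<And>q. q \<in> W \<Longrightarrow> Y q \<in> D q" and D: "\<And>q. subspace (D q)"
  shows "\<exists>X\<in>sections B D. X p = Y p"
proof -
  define b where "b = chart_at B p"
  have b: "b \<in> B" "p \<in> fst b" using chart_at_in[OF B] by (auto simp: b_def)
  note ch = smooth_structure_chart[OF B b(1)]
  define O0 where "O0 = snd b ` (fst b \<inter> W)"
  have O0: "open O0" "snd b p \<in> O0" using open_chart_image[OF B b(1) W(1)] b W by (auto simp: O0_def)
  obtain r where r: "r > 0" "cball (snd b p) r \<subseteq> O0" using O0 open_contains_cball by meson
  obtain \<beta> :: "'f \<Rightarrow> real" where \<beta>: "smooth_on UNIV \<beta>" "\<beta> (snd b p) = 1" "\<And>y. y \<notin> ball (snd b p) r \<Longrightarrow> \<beta> y = 0"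
    using bump_function_exists[OF r(1), of "snd b p"] by blast
  \<comment> \<open>\<open>X\<close> vanishes off \<open>K\<close>. As a compact set in a Hausdorff
    manifold \<open>K\<close> is closed, so its complement and \<open>fst b \<inter> W\<close> form
    an open cover on whose members \<open>X\<close> is zero or a smooth product.\<close>
  define K where "K = chart_inv b ` cball (snd b p) r"
  have "O0 \<subseteq> snd b ` fst b" by (auto simp: O0_def)
  then have "compact K" unfolding K_def
    by (intro compact_continuous_image continuous_on_subset[OF ch(4)] compact_cball) (use r(2) in blast)
  then have K: "open (- K)" using compact_imp_closed by blast
  define X where "X q = (if q \<in> fst b \<inter> W then \<beta> (snd b q) *\<^sub>R Y q else 0)" for q
  have X0: "X q = 0" if "q \<notin> K" for q
  proof (cases "q \<in> fst b \<inter> W")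
    case True
    have "snd b q \<notin> ball (snd b p) r"
    proof
      assume "snd b q \<in> ball (snd b p) r"
      then have "snd b q \<in> cball (snd b p) r" by auto
      then have "chart_inv b (snd b q) \<in> K" unfolding K_def by blast
      then show False using that ch(5) True by simp
    qed
    then show ?thesis using \<beta>(3) by (simp add: X_def)
  qed (auto simp: X_def)
  have sm: "smooth_vector_field B UNIV X"
    unfolding smooth_vector_field_iff[OF B]
  proof
    fix c assume c: "c \<in> B"
    note chc = smooth_structure_chart[OF B c]
    have bW: "open (fst b \<inter> W)" using ch(1) W(1) by (rule open_Int)
    let ?S = "snd c ` (fst c \<inter> (fst b \<inter> W))"
    have S: "open ?S" by (rule open_chart_image[OF B c bW])
    have cS: "chart_inv c y \<in> fst b" "chart_inv c y \<in> W" "chart_inv c y \<in> fst c" if "y \<in> ?S" for y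
      using that chc(5) by auto
    have 1: "Ck_on k ?S (local_rep B c X)" for k
    proof (rule Ck_on_cong[OF S])
      have sb: "smooth_on (snd c ` (fst c \<inter> (\<lambda>x. x) -` fst b)) (\<lambda>y. snd b (chart_inv c y))"
        by (rule smooth_map_domain(5)[OF B B smooth_map_ident[OF B] c b(1)])
      have Ckb: "Ck_on k ?S (\<lambda>y. snd b (chart_inv c y))"
        using Ck_on_subset[OF sb[unfolded smooth_on_def, rule_format, of k], of ?S] by auto
      have "Ck_on k (snd c ` (fst c \<inter> W)) (local_rep B c Y)"
        using Y c unfolding smooth_vector_field_iff[OF B] smooth_on_def by blast
      then have CkY: "Ck_on k ?S (local_rep B c Y)" by (rule Ck_on_subset) auto
      have Ck\<beta>: "Ck_on k UNIV \<beta>" using \<beta>(1) by (simp add: smooth_on_def)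
      show "Ck_on k ?S (\<lambda>y. \<beta> (snd b (chart_inv c y)) *\<^sub>R local_rep B c Y y)"
        by (intro Ck_on_bilinear[OF bounded_bilinear_scaleR S _ CkY] Ck_on_compose[OF S open_UNIV _ Ck\<beta> Ckb]) simp
      show "\<beta> (snd b (chart_inv c y)) *\<^sub>R local_rep B c Y y = local_rep B c X y" if "y \<in> ?S" for y
        using cS[OF that] by (simp add: local_rep_def X_def linear_cmul[OF linear_to_coords[OF B c]])
    qed
    let ?S' = "snd c ` (fst c \<inter> - K)"
    have S': "open ?S'" by (rule open_chart_image[OF B c K])
    have 2: "Ck_on k ?S' (local_rep B c X)" for k
    proof (rule Ck_on_cong[OF S' _ Ck_on_const])
      fix y assume "y \<in> ?S'"
      then have "chart_inv c y \<notin> K" "chart_inv c y \<in> fst c" using chc(5) by auto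
      then show "0 = local_rep B c X y"
        by (simp add: local_rep_def X0 linear_0[OF linear_to_coords[OF B c]])
    qed
    have KW: "K \<subseteq> fst b \<inter> W"
      using r(2) ch(5) unfolding K_def O0_def by auto
    show "smooth_on (snd c ` (fst c \<inter> UNIV)) (local_rep B c X)"
      unfolding smooth_on_def
    proof (intro allI Ck_on_local)
      fix k y assume "y \<in> snd c ` (fst c \<inter> UNIV)"
      then obtain q where q: "q \<in> fst c" "y = snd c q" by blast
      show "\<exists>T. open T \<and> y \<in> T \<and> Ck_on k T (local_rep B c X)"
      proof (cases "q \<in> fst b \<inter> W")
        case True
        then show ?thesis using S 1 q by (intro exI[of _ ?S]) auto
      next
        case False
        then have "q \<notin> K" using KW by blast
        then show ?thesis using S' 2 q by (intro exI[of _ ?S']) auto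
      qed
    qed
  qed
  have "X q \<in> D q" for q
    using YD D[of q] by (auto simp: X_def subspace_scale subspace_0)
  then have "X \<in> sections B D" using sm by (simp add: sections_def)
  moreover have "X p = Y p" using b W \<beta>(2) by (simp add: X_def)
  ultimately show ?thesis by blast
qed

theorem theorem4p2:
  fixes AM :: "('m::{t2_space, second_countable_topology}, 'e::euclidean_space) chart set"
    and \<sigma> :: "'m \<Rightarrow> ('e \<Rightarrow>\<^sub>L 'e) set"
    and g :: "'m \<Rightarrow> 'e \<Rightarrow> 'e \<Rightarrow> real"
    and AN :: "('n::{t2_space, second_countable_topology}, 'f::euclidean_space) chart set"
    and f :: "'n \<Rightarrow> 'm"
    and D :: "'n \<Rightarrow> 'f set"
  assumes "smooth_structure AM"
    and "paraquaternionic_kaehler AM \<sigma> g"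
    and "smooth_structure AN"
    and "paraquaternionic_CR_submanifold AN AM \<sigma> g f D"
  shows "integrable_distribution AN D \<longleftrightarrow>
    (\<forall>X\<in>sections AN D. \<forall>Y\<in>sections AN D. \<forall>p. second_fundamental_form AN AM g f X Y p = 0)"
proof -
  interpret cr_submanifold AN AM \<sigma> g f D
    by unfold_locales (fact assms)+
  have B_eq: "second_fundamental_form AN AM g f X Y p =
      second_derivative p (X p) (Y p) - df p (christoffel AN h p (X p) (Y p))"
    if "Y \<in> sections AN D" for X Y p
    by (rule second_fundamental_form_eq[OF smooth_field_has_derivative[of UNIV Y p, OF _ _ chart_at_in[OF B]]])
      (use that in \<open>auto simp: sections_def\<close>)
  have vals: "X p \<in> D p" if "X \<in> sections AN D" for X p
    using that by (simp add: sections_def)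
  show ?thesis
  proof
    assume "integrable_distribution AN D"
    then have "involutive_at AN D (chart_at AN p) p" for p
      by (rule integrable_imp_involutive[OF B])
    then show "\<forall>X\<in>sections AN D. \<forall>Y\<in>sections AN D. \<forall>p. second_fundamental_form AN AM g f X Y p = 0"
      by (simp add: B_eq involutive_imp_totally_geodesic vals)
  next
    assume 0: "\<forall>X\<in>sections AN D. \<forall>Y\<in>sections AN D. \<forall>p. second_fundamental_form AN AM g f X Y p = 0"
    \<comment> \<open>The assumption concerns global sections. As B depends only on values at
      \<open>p\<close>, it becomes a statement about vectors once every vector of \<open>D p\<close>
      is the value of such a section.\<close>
    have ext: "\<exists>X\<in>sections AN D. X p = v" if v: "v \<in> D p" for p v
    proof -
      obtain W Y where W: "open W" "p \<in> W" "smooth_vector_field AN W Y" "\<And>q. q \<in> W \<Longrightarrow> Y q \<in> D q" "Y p = v"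
        by (rule section_through[OF v]) blast
      from global_section_through[OF B W(1,2,3), of D] W(4,5) subspace_D show ?thesis by blast
    qed
    have "second_derivative p u v = df p (christoffel AN h p u v)" if uv: "u \<in> D p" "v \<in> D p" for p u v
    proof -
      obtain X Y where X: "X \<in> sections AN D" "X p = u" and Y: "Y \<in> sections AN D" "Y p = v"
        using ext uv by meson
      from 0 X(1) Y(1) have "second_fundamental_form AN AM g f X Y p = 0" by blast
      then show ?thesis unfolding B_eq[OF Y(1)] X(2) Y(2) by simp
    qed
    then have "involutive_at AN D (chart_at AN p) p" for p
      by (rule totally_geodesic_imp_involutive)
    then show "integrable_distribution AN D"
      by (rule frobenius[OF B distribution_D])
  qed
qed

end
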